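(* Let $(D,\sigma)$ and $(\Omega,\rho)$ be Riemann surfaces with smooth conformal metrics, where $\Omega\subset\mathbf C$ is a complex domain, let $K_2=K_\rho$ be the Gaussian curvature of $\rho$, and let $h:(D,\sigma)\to(\Omega,\rho)$ be a $\rho$-harmonic mapping. Let $z$ be a local conformal parameter on $D$ and let $$J(z)=J_h(z)=\rho^2(h(z))\left(|h_z|^2-|h_{\bar z}|^2\right),\qquad D_h(z)=\rho^2(h(z))\left(|h_z|^2+|h_{\bar z}|^2\right),$$ $$A=h_{zz}\,(\bar h)_{\bar z}+(\bar h)_{z\bar z}\,h_z,\qquad B=h_{z\bar z}\,(\bar h)_z+h_{\bar z}\,(\bar h)_{zz}.$$ Then, at every point $z$ at which $J(z)>0$ and $h_{\bar z}(z)\neq 0$, $$-\Delta\log J=K_2\,D_h+\frac{4\rho^4}{J^2}\left(\frac{|h_z|^2}{|h_{\bar z}|^2}|B|^2+\frac{|h_{\bar z}|^2}{|h_z|^2}|A|^2-2\,\Re(A\bar B)\right),$$ where $K_2$ and $\rho$ are evaluated at $h(z)$. In particular, if $h$ is a sense-preserving homeomorphism and $K_2\ge 0$, then $-\log J_h$ is subharmonic.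
   Context: A conformal metric on $\Omega\subset\mathbf C$ is given by a positive smooth function $\rho$ (the metric being $\rho^2(w)|dw|^2$). Its Gaussian curvature is, in the normalization used here, $K_\rho=-\dfrac{2\Delta\log\rho}{\rho^2}$, where $\Delta f=f_{xx}+f_{yy}$ is the Euclidean Laplacian. A $C^2$ mapping $h$ into $(\Omega,\rho)$ is called harmonic (or $\rho$-harmonic) if, in a local conformal parameter $z=x+iy$ of the source surface and with $w$ the parameter on $\Omega$, $$h_{z\bar z}+\big((\log\rho^2)_w\circ h\big)\,h_z\,h_{\bar z}=0.$$ Here $h_z,h_{\bar z}$ are the Wirtinger derivatives, and $(\bar h)_z$, $(\bar h)_{\bar z}$, $(\bar h)_{zz}$, $(\bar h)_{z\bar z}$ denote Wirtinger derivatives of the complex conjugate function $\bar h$ (so $(\bar h)_{\bar z}=\overline{h_z}$ and $(\bar h)_z=\overline{h_{\bar z}}$). The Laplacian $\Delta$ in the formula is the Euclidean Laplacian in the parameter $z=x+iy$. A real function is superharmonic if its negative is subharmonic. *)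

theory Defs
  imports "HOL-Complex_Analysis.Complex_Analysis"
begin

section \<open>Partial derivatives, Wirtinger derivatives, smoothness\<close>

definition partial_x :: "(complex \<Rightarrow> 'b::real_normed_vector) \<Rightarrow> complex \<Rightarrow> 'b" where
  "partial_x f z = vector_derivative (\<lambda>t. f (z + of_real t)) (at 0)"

definition partial_y :: "(complex \<Rightarrow> 'b::real_normed_vector) \<Rightarrow> complex \<Rightarrow> 'b" where
  "partial_y f z = vector_derivative (\<lambda>t. f (z + \<i> * of_real t)) (at 0)"

definition wirt_z :: "(complex \<Rightarrow> complex) \<Rightarrow> complex \<Rightarrow> complex" where
  "wirt_z f z = (partial_x f z - \<i> * partial_y f z) / 2"

definition wirt_zbar :: "(complex \<Rightarrow> complex) \<Rightarrow> complex \<Rightarrow> complex" where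
  "wirt_zbar f z = (partial_x f z + \<i> * partial_y f z) / 2"

definition laplacian :: "(complex \<Rightarrow> real) \<Rightarrow> complex \<Rightarrow> real" where
  "laplacian f z = partial_x (partial_x f) z + partial_y (partial_y f) z"

text \<open>Only used for open \<open>S\<close>. Differentiability is real differentiability.\<close>

fun Ck_on :: "nat \<Rightarrow> complex set \<Rightarrow> (complex \<Rightarrow> 'b::real_normed_vector) \<Rightarrow> bool" where
  "Ck_on 0 S f \<longleftrightarrow> continuous_on S f"
| "Ck_on (Suc k) S f \<longleftrightarrow>
     (\<forall>z\<in>S. f differentiable (at z)) \<and> Ck_on k S (partial_x f) \<and> Ck_on k S (partial_y f)"

definition smooth_on :: "complex set \<Rightarrow> (complex \<Rightarrow> 'b::real_normed_vector) \<Rightarrow> bool" where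
  "smooth_on S f \<longleftrightarrow> (\<forall>k. Ck_on k S f)"


section \<open>Riemann surfaces\<close>

type_synonym 'a chart = "'a set \<times> ('a \<Rightarrow> complex)"

fun complex_chart :: "'a topology \<Rightarrow> 'a chart \<Rightarrow> bool" where
  "complex_chart X (U, \<phi>) \<longleftrightarrow>
     openin X U \<and> open (\<phi> ` U) \<and>
     homeomorphic_map (subtopology X U) (top_of_set (\<phi> ` U)) \<phi>"

fun transition :: "'a chart \<Rightarrow> 'a chart \<Rightarrow> complex \<Rightarrow> complex" where
  "transition (U, \<phi>) (V, \<psi>) = \<psi> \<circ> inv_into U \<phi>"

fun compatible_charts :: "'a chart \<Rightarrow> 'a chart \<Rightarrow> bool" where
  "compatible_charts (U, \<phi>) (V, \<psi>) \<longleftrightarrow>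
     transition (U, \<phi>) (V, \<psi>) holomorphic_on \<phi> ` (U \<inter> V) \<and>
     transition (V, \<psi>) (U, \<phi>) holomorphic_on \<psi> ` (U \<inter> V)"

text \<open>Second countability is not required: it is automatic by Rado's theorem.\<close>

definition riemann_surface :: "'a topology \<Rightarrow> 'a chart set \<Rightarrow> bool" where
  "riemann_surface X \<A> \<longleftrightarrow>
     Hausdorff_space X \<and> connected_space X \<and> topspace X \<noteq> {} \<and>
     (\<forall>c\<in>\<A>. complex_chart X c) \<and>
     (\<Union>c\<in>\<A>. fst c) = topspace X \<and>
     (\<forall>c\<in>\<A>. \<forall>d\<in>\<A>. compatible_charts c d)"

text \<open>The local conformal parameters are the charts of the maximal atlas generated by \<open>\<A>\<close>.\<close>

definition conformal_parameter :: "'a topology \<Rightarrow> 'a chart set \<Rightarrow> 'a chart \<Rightarrow> bool" where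
  "conformal_parameter X \<A> c \<longleftrightarrow> complex_chart X c \<and> (\<forall>d\<in>\<A>. compatible_charts c d)"

text \<open>
  The metric is \<open>\<sigma> c (z)\<^sup>2 |dz|\<^sup>2\<close> in the parameter \<open>c\<close>; the last clause says that these
  expressions agree on overlaps.
\<close>

definition smooth_conformal_metric ::
  "'a topology \<Rightarrow> 'a chart set \<Rightarrow> ('a chart \<Rightarrow> complex \<Rightarrow> real) \<Rightarrow> bool" where
  "smooth_conformal_metric X \<A> \<sigma> \<longleftrightarrow>
     (\<forall>U \<phi>. conformal_parameter X \<A> (U, \<phi>) \<longrightarrow>
        smooth_on (\<phi> ` U) (\<sigma> (U, \<phi>)) \<and> (\<forall>z\<in>\<phi> ` U. 0 < \<sigma> (U, \<phi>) z)) \<and>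
     (\<forall>U \<phi> V \<psi>. conformal_parameter X \<A> (U, \<phi>) \<and> conformal_parameter X \<A> (V, \<psi>) \<longrightarrow>
        (\<forall>p\<in>U \<inter> V. \<sigma> (U, \<phi>) (\<phi> p) =
           \<sigma> (V, \<psi>) (\<psi> p) * cmod (deriv (transition (U, \<phi>) (V, \<psi>)) (\<phi> p))))"

fun in_parameter :: "('a \<Rightarrow> complex) \<Rightarrow> 'a chart \<Rightarrow> complex \<Rightarrow> complex" where
  "in_parameter h (U, \<phi>) = h \<circ> inv_into U \<phi>"


section \<open>Plane domains with a conformal metric\<close>

definition smooth_plane_metric :: "complex set \<Rightarrow> (complex \<Rightarrow> real) \<Rightarrow> bool" where
  "smooth_plane_metric \<Omega> \<rho> \<longleftrightarrow> smooth_on \<Omega> \<rho> \<and> (\<forall>w\<in>\<Omega>. 0 < \<rho> w)"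

text \<open>Normalised as twice the usual Gaussian curvature \<open>- \<Delta> log \<rho> / \<rho>\<^sup>2\<close>.\<close>

definition gauss_curvature :: "(complex \<Rightarrow> real) \<Rightarrow> complex \<Rightarrow> real" where
  "gauss_curvature \<rho> w = - 2 * laplacian (\<lambda>v. ln (\<rho> v)) w / (\<rho> w)\<^sup>2"


section \<open>Harmonic maps\<close>

definition harmonic_map ::
  "'a topology \<Rightarrow> 'a chart set \<Rightarrow> complex set \<Rightarrow> (complex \<Rightarrow> real) \<Rightarrow> ('a \<Rightarrow> complex) \<Rightarrow> bool" where
  "harmonic_map X \<A> \<Omega> \<rho> h \<longleftrightarrow>
     h ` topspace X \<subseteq> \<Omega> \<and>
     (\<forall>U \<phi>. conformal_parameter X \<A> (U, \<phi>) \<longrightarrow>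
        (let H = in_parameter h (U, \<phi>) in
           Ck_on 2 (\<phi> ` U) H \<and>
           (\<forall>z\<in>\<phi> ` U.
              wirt_zbar (wirt_z H) z +
              wirt_z (\<lambda>w. of_real (ln ((\<rho> w)\<^sup>2))) (H z) * wirt_z H z * wirt_zbar H z = 0)))"

definition metric_jacobian :: "(complex \<Rightarrow> real) \<Rightarrow> (complex \<Rightarrow> complex) \<Rightarrow> complex \<Rightarrow> real" where
  "metric_jacobian \<rho> H z = (\<rho> (H z))\<^sup>2 * ((cmod (wirt_z H z))\<^sup>2 - (cmod (wirt_zbar H z))\<^sup>2)"

definition energy_density :: "(complex \<Rightarrow> real) \<Rightarrow> (complex \<Rightarrow> complex) \<Rightarrow> complex \<Rightarrow> real" where
  "energy_density \<rho> H z = (\<rho> (H z))\<^sup>2 * ((cmod (wirt_z H z))\<^sup>2 + (cmod (wirt_zbar H z))\<^sup>2)"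

text \<open>
  Topological orientation preservation, meant for homeomorphisms \<open>h\<close>: images of positively
  oriented small circles wind once, positively, around the image of the centre.
\<close>

definition sense_preserving :: "'a topology \<Rightarrow> 'a chart set \<Rightarrow> ('a \<Rightarrow> complex) \<Rightarrow> bool" where
  "sense_preserving X \<A> h \<longleftrightarrow>
     (\<forall>U \<phi> a r. conformal_parameter X \<A> (U, \<phi>) \<and> 0 < r \<and> cball a r \<subseteq> \<phi> ` U \<longrightarrow>
        winding_number (in_parameter h (U, \<phi>) \<circ> circlepath a r) (in_parameter h (U, \<phi>) a) = 1)"


section \<open>Subharmonic functions\<close>

text \<open>
  Upper semicontinuity and the sub-mean value inequality, for functions with finite values.
  Since \<open>integral\<close> is \<open>0\<close> on non-integrable functions, integrability is demanded explicitly;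
  a circle on which it fails would have mean \<open>-\<infinity>\<close>, violating the inequality.
\<close>

definition subharmonic_on :: "complex set \<Rightarrow> (complex \<Rightarrow> real) \<Rightarrow> bool" where
  "subharmonic_on S u \<longleftrightarrow>
     (\<forall>c. openin (top_of_set S) {z \<in> S. u z < c}) \<and>
     (\<forall>a r. 0 < r \<and> cball a r \<subseteq> S \<longrightarrow>
        (\<lambda>t. u (a + of_real r * cis t)) integrable_on {0..2*pi} \<and>
        u a \<le> integral {0..2*pi} (\<lambda>t. u (a + of_real r * cis t)) / (2*pi))"

end

theory Submission
  imports Defs
begin

text \<open>
  Write \<open>P = h\<^sub>z\<close>, \<open>Q = h\<close> differentiated by \<open>zbar\<close>, \<open>F = \<rho>(h)\<^sup>2 |P|\<^sup>2\<close>, and let \<open>\<Phi> = \<rho>(h)\<^sup>2 P cnj Q\<close>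
  be the Hopf differential, which is holomorphic because \<open>h\<close> is harmonic. Then \<open>J = F - |\<Phi>|\<^sup>2 / F\<close>, so
  everything follows from the Bochner formula \<open>\<Delta> log F = - K J\<close>. As \<open>h\<close> is only \<open>C\<^sup>2\<close>,
  \<open>log F\<close> is a priori only \<open>C\<^sup>1\<close>; the right-hand side is \<open>C\<^sup>1\<close>, and regularity of the \<open>dbar\<close> equation,
  obtained from the Cauchy transform, shows that \<open>log F\<close> is \<open>C\<^sup>2\<close> where \<open>P\<close> does not vanish.

  For a sense-preserving homeomorphism winding numbers give \<open>|Q| \<le> |P|\<close>. Locally
  \<open>P = (z - c)\<^sup>n k exp (- s)\<close> with \<open>k\<close> holomorphic and zero-free, and \<open>\<tau> = |Q| / |P|\<close> extends continuously
  to \<open>c\<close>. If \<open>\<tau> c = 1\<close>, then the nonnegative superharmonic function \<open>- log \<tau>\<close> vanishes near \<open>c\<close>, so that \<open>J = 0\<close>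
  on an open set, contradicting Sard's theorem and injectivity. If \<open>\<tau> c < 1\<close>, then \<open>h\<close> winds \<open>n + 1\<close> times
  around \<open>h c\<close>, whence \<open>n = 0\<close> and \<open>J c > 0\<close>.
\<close>

section \<open>Wirtinger calculus\<close>

text \<open>Written through \<open>F\<close> and \<open>\<Phi>\<close>, \<open>log J\<close> calls
  for no third derivatives of \<open>h\<close>: \<open>\<Phi>\<close> is holomorphic, and the first
  derivatives of \<open>F\<close> are \<open>F * \<omega>\<close> and its conjugate, with
  \<open>\<omega>\<close> the z-derivative of \<open>log F\<close>. As D = F + |\<Phi>|^2 / F, the
  Laplacian of \<open>log J\<close> becomes - K D - 4 |2 \<omega> \<Phi> - \<Phi>'|^2 / J^2. The
  bracket of the theorem is this square multiplied out, since 2 \<omega> \<Phi> - \<Phi>' = \<rho>^2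
  (A cnj Q / cnj P - B P / Q). Only that rewriting divides by \<open>Q\<close>; subharmonicity rests
  on the undivided form.

  The words "in particular" hide the main difficulty. The formula speaks only of points with J > 0,
  and a homeomorphism is not assumed to have a nonzero Jacobian. Positivity everywhere is a theorem
  of Lewy type. The sign of the curvature therefore enters twice: it makes log (|Q| / |P|), whose
  Laplacian is K J, subharmonic, and it fixes the sign of the final formula.\<close>

definition has_wirt :: "(complex \<Rightarrow> complex) \<Rightarrow> complex \<Rightarrow> complex \<Rightarrow> complex \<Rightarrow> bool" where
  "has_wirt f a b z \<longleftrightarrow> (f has_derivative (\<lambda>d. a * d + b * cnj d)) (at z)"

text \<open>Membership in \<open>C\<^sup>1(S)\<close>, carrying the two Wirtinger derivatives along.\<close>

definition C1w ::
  "complex set \<Rightarrow> (complex \<Rightarrow> complex) \<Rightarrow> (complex \<Rightarrow> complex) \<Rightarrow> (complex \<Rightarrow> complex) \<Rightarrow> bool" where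
  "C1w S f a b \<longleftrightarrow> (\<forall>z\<in>S. has_wirt f (a z) (b z) z) \<and> continuous_on S a \<and> continuous_on S b"

lemma has_wirt_const: "has_wirt (\<lambda>z. c) 0 0 z"
  by (simp add: has_wirt_def)

lemma has_wirt_add:
  "has_wirt f a b z \<Longrightarrow> has_wirt g c d z \<Longrightarrow> has_wirt (\<lambda>z. f z + g z) (a + c) (b + d) z"
  unfolding has_wirt_def
  by (erule (1) has_derivative_eq_rhs[OF has_derivative_add]) (auto simp: algebra_simps)

lemma has_wirt_diff:
  "has_wirt f a b z \<Longrightarrow> has_wirt g c d z \<Longrightarrow> has_wirt (\<lambda>z. f z - g z) (a - c) (b - d) z"
  unfolding has_wirt_def
  by (erule (1) has_derivative_eq_rhs[OF has_derivative_diff]) (auto simp: algebra_simps)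

lemma has_wirt_mult:
  "has_wirt f a b z \<Longrightarrow> has_wirt g c d z \<Longrightarrow>
   has_wirt (\<lambda>z. f z * g z) (a * g z + f z * c) (b * g z + f z * d) z"
  unfolding has_wirt_def
  by (erule (1) has_derivative_eq_rhs[OF has_derivative_mult]) (auto simp: algebra_simps)

lemma has_wirt_cnj: "has_wirt f a b z \<Longrightarrow> has_wirt (\<lambda>z. cnj (f z)) (cnj b) (cnj a) z"
  unfolding has_wirt_def
  by (erule has_derivative_eq_rhs[OF has_derivative_cnj]) (auto simp: algebra_simps)

lemma has_wirt_compose:
  assumes "has_wirt f a b z" "has_wirt g c d (f z)"
  shows "has_wirt (\<lambda>z. g (f z)) (c * a + d * cnj b) (c * b + d * cnj a) z"
  using assms unfolding has_wirt_def
  by (auto simp: algebra_simps intro: has_derivative_eq_rhs[OF has_derivative_compose[of f _ z UNIV g]])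

lemma has_wirt_field:
  "(f has_field_derivative c) (at z) \<longleftrightarrow> has_wirt f c 0 z"
  by (simp add: has_wirt_def has_field_derivative_def)

lemma has_wirt_holo_compose:
  assumes "has_wirt f a b z" "(g has_field_derivative c) (at (f z))"
  shows "has_wirt (\<lambda>z. g (f z)) (c * a) (c * b) z"
  using has_wirt_compose[OF assms(1)] assms(2) unfolding has_wirt_field by fastforce

lemma has_wirt_cong:
  assumes "has_wirt f a b z" "open S" "z \<in> S" "\<And>x. x \<in> S \<Longrightarrow> g x = f x"
  shows "has_wirt g a b z"
  using assms has_derivative_transform_within_open[of f _ z UNIV S g] unfolding has_wirt_def by metis

text \<open>The outer function lives on the reals only, so the complex chain rule does not apply.
  The inner differential takes real values, and multiplication by the real number \<open>f'\<close>
  then commutes with the embedding.\<close>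

lemma has_wirt_real_compose:
  assumes "has_wirt (\<lambda>z. of_real (n z)) a b z" "(f has_real_derivative f') (at (n z))"
  shows "has_wirt (\<lambda>z. of_real (f (n z))) (of_real f' * a) (of_real f' * b) z"
proof -
  have "(n has_derivative (\<lambda>d. Re (a * d + b * cnj d))) (at z)"
    using has_derivative_Re[OF assms(1)[unfolded has_wirt_def]] by simp
  then have 1: "((\<lambda>z. of_real (f (n z))) has_derivative (\<lambda>d. complex_of_real (f' * Re (a * d + b * cnj d)))) (at z)"
    using assms(2) unfolding has_field_derivative_def
    by (intro has_derivative_of_real) (auto intro: has_derivative_compose[of n _ z UNIV f])
  have "((\<lambda>z. 0) has_derivative (\<lambda>d. Im (a * d + b * cnj d))) (at z)"
    using has_derivative_Im[OF assms(1)[unfolded has_wirt_def]] by (simp only: Im_complex_of_real)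
  from has_derivative_unique[OF this has_derivative_const]
  have I: "Im (a * d + b * cnj d) = 0" for d by meson
  have "complex_of_real (f' * Re (a * d + b * cnj d)) = of_real f' * a * d + of_real f' * b * cnj d" for d
  proof -
    have "of_real (Re (a * d + b * cnj d)) = a * d + b * cnj d"
      using I[of d] by (intro complex_eqI) (simp_all only: Re_complex_of_real Im_complex_of_real)
    then show ?thesis by (simp only: of_real_mult distrib_left mult.assoc)
  qed
  with 1 show ?thesis unfolding has_wirt_def by simp
qed

lemma has_wirt_partial_x:
  assumes "has_wirt f a b z"
  shows "((\<lambda>t. f (z + of_real t)) has_vector_derivative (a + b)) (at 0)"
proof -
  have "((\<lambda>t. z + of_real t) has_derivative (\<lambda>t. of_real t)) (at 0)"
    by (auto intro!: derivative_eq_intros)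
  from has_derivative_compose[OF this, of f "\<lambda>d. a * d + b * cnj d"] assms
  have "((\<lambda>t. f (z + of_real t)) has_derivative (\<lambda>t. a * (of_real t) + b * cnj (of_real t))) (at 0)"
    by (simp add: has_wirt_def)
  then show ?thesis
    unfolding has_vector_derivative_def
    by (rule has_derivative_eq_rhs) (simp add: fun_eq_iff scaleR_conv_of_real algebra_simps)
qed

lemma has_wirt_partial_y:
  assumes "has_wirt f a b z"
  shows "((\<lambda>t. f (z + \<i> * of_real t)) has_vector_derivative (\<i> * (a - b))) (at 0)"
proof -
  have "((\<lambda>t. z + \<i> * of_real t) has_derivative (\<lambda>t. \<i> * of_real t)) (at 0)"
    by (auto intro!: derivative_eq_intros)
  from has_derivative_compose[OF this, of f "\<lambda>d. a * d + b * cnj d"] assms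
  have "((\<lambda>t. f (z + \<i> * of_real t)) has_derivative (\<lambda>t. a * (\<i> * of_real t) + b * cnj (\<i> * of_real t))) (at 0)"
    by (simp add: has_wirt_def)
  then show ?thesis
    unfolding has_vector_derivative_def
    by (rule has_derivative_eq_rhs) (simp add: fun_eq_iff scaleR_conv_of_real algebra_simps)
qed

text \<open>\<open>wirt_z\<close> and \<open>wirt_zbar\<close> have arbitrary values where no
  derivative exists. All calculus therefore runs through \<open>has_wirt\<close>, and the operators
  are read off here.\<close>

lemma has_wirt_imp:
  assumes "has_wirt f a b z"
  shows "partial_x f z = a + b" "partial_y f z = \<i> * (a - b)" "wirt_z f z = a" "wirt_zbar f z = b"
proof -
  show x: "partial_x f z = a + b"
    unfolding partial_x_def using has_wirt_partial_x[OF assms] by (rule vector_derivative_at)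
  show y: "partial_y f z = \<i> * (a - b)"
    unfolding partial_y_def using has_wirt_partial_y[OF assms] by (rule vector_derivative_at)
  show "wirt_z f z = a" "wirt_zbar f z = b"
    unfolding wirt_z_def wirt_zbar_def x y by (simp_all add: algebra_simps)
qed

text \<open>Both partial derivatives of a real function are real: Im (a + b) = 0 and Re (a - b) = 0,
  which together say that \<open>b\<close> is conjugate to \<open>a\<close>.\<close>

lemma has_wirt_real_partials:
  fixes u :: "complex \<Rightarrow> real"
  assumes "has_wirt (\<lambda>z. of_real (u z)) a b z"
  shows "partial_x u z = 2 * Re a" "partial_y u z = - 2 * Im a" "b = cnj a"
proof -
  have x: "((\<lambda>t. complex_of_real (u (z + of_real t))) has_vector_derivative (a + b)) (at 0)"
    using has_wirt_partial_x[OF assms] .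
  have y: "((\<lambda>t. complex_of_real (u (z + \<i> * of_real t))) has_vector_derivative (\<i> * (a - b))) (at 0)"
    using has_wirt_partial_y[OF assms] .
  have "Im (a + b) = 0"
    by (rule vector_derivative_unique_at[OF bounded_linear.has_vector_derivative[OF bounded_linear_Im x]])
      (simp add: has_vector_derivative_const)
  moreover have "Im (\<i> * (a - b)) = 0"
    by (rule vector_derivative_unique_at[OF bounded_linear.has_vector_derivative[OF bounded_linear_Im y]])
      (simp add: has_vector_derivative_const)
  ultimately show b: "b = cnj a" by (simp add: complex_eq_iff)
  show "partial_x u z = 2 * Re a"
    unfolding partial_x_def using bounded_linear.has_vector_derivative[OF bounded_linear_Re x] b by (simp add: vector_derivative_at)
  show "partial_y u z = - 2 * Im a"
    unfolding partial_y_def using bounded_linear.has_vector_derivative[OF bounded_linear_Re y] b by (simp add: vector_derivative_at)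
qed

text \<open>A real-linear map of the plane is determined by its values at 1 and \<open>\<i>\<close>,
  which are the two partial derivatives.\<close>

lemma has_wirt_of_partials:
  assumes "f differentiable (at z)"
  shows "has_wirt f (wirt_z f z) (wirt_zbar f z) z"
proof -
  obtain D where D: "(f has_derivative D) (at z)" using assms by (auto simp: differentiable_def)
  interpret D: bounded_linear D using D by (rule has_derivative_bounded_linear)
  have "D d = Re d *\<^sub>R D 1 + Im d *\<^sub>R D \<i>" for d
    unfolding D.scaleR[symmetric] D.add[symmetric] 
    by (rule arg_cong[of _ _ D]) (simp add: complex_eq_iff)
  then have "D = (\<lambda>d. (D 1 - \<i> * D \<i>) / 2 * d + (D 1 + \<i> * D \<i>) / 2 * cnj d)"
  proof (intro ext)
    fix d
    have "(D 1 - \<i> * D \<i>) / 2 * d + (D 1 + \<i> * D \<i>) / 2 * cnj d =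
        D 1 * ((d + cnj d) / 2) - \<i> * D \<i> * ((d - cnj d) / 2)"
      by (simp add: field_simps)
    also have "\<dots> = Re d *\<^sub>R D 1 + Im d *\<^sub>R D \<i>"
      by (simp add: complex_add_cnj complex_diff_cnj scaleR_conv_of_real mult.commute mult.left_commute)
    finally show "D d = (D 1 - \<i> * D \<i>) / 2 * d + (D 1 + \<i> * D \<i>) / 2 * cnj d"
      using \<open>\<And>d. D d = Re d *\<^sub>R D 1 + Im d *\<^sub>R D \<i>\<close>[of d] by simp
  qed
  then have "has_wirt f ((D 1 - \<i> * D \<i>) / 2) ((D 1 + \<i> * D \<i>) / 2) z"
    using D by (simp add: has_wirt_def)
  then show ?thesis using has_wirt_imp by metis
qed

lemma differentiable_of_real_complex:
  fixes u :: "complex \<Rightarrow> real"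
  assumes "u differentiable (at z)"
  shows "(\<lambda>z. complex_of_real (u z)) differentiable (at z)"
  using assms unfolding differentiable_def by (blast intro: has_derivative_of_real)

lemma has_wirt_of_real_partials:
  fixes u :: "complex \<Rightarrow> real"
  assumes "u differentiable (at z)"
  shows "has_wirt (\<lambda>z. of_real (u z)) ((of_real (partial_x u z) - \<i> * of_real (partial_y u z)) / 2)
           ((of_real (partial_x u z) + \<i> * of_real (partial_y u z)) / 2) z"
proof -
  obtain a b where ab: "has_wirt (\<lambda>z. of_real (u z)) a b z"
    using has_wirt_of_partials[OF differentiable_of_real_complex[OF assms]] by blast
  note r = has_wirt_real_partials[OF ab]
  have "(of_real (partial_x u z) - \<i> * of_real (partial_y u z)) / 2 = a"
    "(of_real (partial_x u z) + \<i> * of_real (partial_y u z)) / 2 = b"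
    unfolding r by (simp_all add: complex_eq_iff)
  then show ?thesis using ab by simp
qed

section \<open>Continuously differentiable functions with explicit derivatives\<close>

lemma has_wirt_imp_isCont: "has_wirt f a b z \<Longrightarrow> isCont f z"
  unfolding has_wirt_def by (rule has_derivative_continuous)

lemma C1wD: "C1w S f a b \<Longrightarrow> z \<in> S \<Longrightarrow> has_wirt f (a z) (b z) z"
  and C1w_cont_z: "C1w S f a b \<Longrightarrow> continuous_on S a"
  and C1w_cont_zbar: "C1w S f a b \<Longrightarrow> continuous_on S b"
  by (auto simp: C1w_def)

lemma C1w_cont: "C1w S f a b \<Longrightarrow> continuous_on S f"
  by (auto simp: C1w_def intro!: continuous_at_imp_continuous_on has_wirt_imp_isCont)

lemma C1w_subset: "C1w S f a b \<Longrightarrow> T \<subseteq> S \<Longrightarrow> C1w T f a b"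
  by (auto simp: C1w_def intro: continuous_on_subset)

lemma C1w_const: "C1w S (\<lambda>z. c) (\<lambda>z. 0) (\<lambda>z. 0)"
  by (auto simp: C1w_def has_wirt_const)

lemma C1w_add: "C1w S f a b \<Longrightarrow> C1w S g c d \<Longrightarrow> C1w S (\<lambda>z. f z + g z) (\<lambda>z. a z + c z) (\<lambda>z. b z + d z)"
  by (auto simp: C1w_def intro!: has_wirt_add continuous_intros)

lemma C1w_diff: "C1w S f a b \<Longrightarrow> C1w S g c d \<Longrightarrow> C1w S (\<lambda>z. f z - g z) (\<lambda>z. a z - c z) (\<lambda>z. b z - d z)"
  by (auto simp: C1w_def intro!: has_wirt_diff continuous_intros)

lemma C1w_mult: "C1w S f a b \<Longrightarrow> C1w S g c d \<Longrightarrow>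
   C1w S (\<lambda>z. f z * g z) (\<lambda>z. a z * g z + f z * c z) (\<lambda>z. b z * g z + f z * d z)"
  using C1w_cont[of S f a b] C1w_cont[of S g c d]
  by (auto simp: C1w_def intro!: has_wirt_mult continuous_intros)

lemma C1w_cnj: "C1w S f a b \<Longrightarrow> C1w S (\<lambda>z. cnj (f z)) (\<lambda>z. cnj (b z)) (\<lambda>z. cnj (a z))"
  by (auto simp: C1w_def intro!: has_wirt_cnj continuous_intros)

lemma C1w_compose:
  assumes "C1w S f a b" "C1w T g c d" "f ` S \<subseteq> T"
  shows "C1w S (\<lambda>z. g (f z)) (\<lambda>z. c (f z) * a z + d (f z) * cnj (b z)) (\<lambda>z. c (f z) * b z + d (f z) * cnj (a z))"
proof -
  have "has_wirt (\<lambda>z. g (f z)) (c (f z) * a z + d (f z) * cnj (b z)) (c (f z) * b z + d (f z) * cnj (a z)) z"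
    if "z \<in> S" for z
    using assms that by (intro has_wirt_compose[of f]) (auto simp: C1w_def)
  moreover have "continuous_on S (\<lambda>z. c (f z))" "continuous_on S (\<lambda>z. d (f z))"
    using assms C1w_cont[OF assms(1)] by (auto simp: C1w_def intro: continuous_on_compose2)
  ultimately show ?thesis
    using assms(1) by (auto simp: C1w_def intro!: continuous_intros)
qed

lemma C1w_holo: "g holomorphic_on T \<Longrightarrow> open T \<Longrightarrow> C1w T g (deriv g) (\<lambda>z. 0)"
  by (auto simp: C1w_def has_wirt_field[symmetric] holomorphic_derivI
      intro: holomorphic_on_imp_continuous_on holomorphic_deriv)

lemma C1w_holo_compose:
  assumes "C1w S f a b" "g holomorphic_on T" "open T" "f ` S \<subseteq> T"
  shows "C1w S (\<lambda>z. g (f z)) (\<lambda>z. deriv g (f z) * a z) (\<lambda>z. deriv g (f z) * b z)"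
proof -
  show ?thesis using C1w_compose[OF assms(1) C1w_holo[OF assms(2,3)] assms(4)] by simp
qed

lemma C1w_inverse:
  assumes "C1w S f a b" "\<And>z. z \<in> S \<Longrightarrow> f z \<noteq> 0"
  shows "C1w S (\<lambda>z. inverse (f z)) (\<lambda>z. - a z / (f z)\<^sup>2) (\<lambda>z. - b z / (f z)\<^sup>2)"
proof -
  have "has_wirt (\<lambda>z. inverse (f z)) (- inverse ((f z)\<^sup>2) * a z) (- inverse ((f z)\<^sup>2) * b z) z" if "z \<in> S" for z
    using assms that
    by (intro has_wirt_holo_compose) (auto simp: C1w_def power2_eq_square intro!: derivative_eq_intros)
  then show ?thesis using assms C1w_cont[OF assms(1)]
    by (auto simp: C1w_def field_simps intro!: continuous_intros)
qed

lemma C1w_divide: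
  assumes "C1w S f a b" "C1w S g c d" "\<And>z. z \<in> S \<Longrightarrow> g z \<noteq> 0"
  shows "C1w S (\<lambda>z. f z / g z) (\<lambda>z. (a z * g z - f z * c z) / (g z)\<^sup>2) (\<lambda>z. (b z * g z - f z * d z) / (g z)\<^sup>2)"
proof -
  have *: "C1w S (\<lambda>z. f z * inverse (g z)) (\<lambda>z. a z * inverse (g z) + f z * (- c z / (g z)\<^sup>2))
      (\<lambda>z. b z * inverse (g z) + f z * (- d z / (g z)\<^sup>2))"
    by (intro C1w_mult C1w_inverse assms)
  show ?thesis
    using * assms(3) C1w_cont[OF assms(1)] C1w_cont[OF assms(2)] assms(1,2)
    by (auto simp: C1w_def field_simps power2_eq_square intro!: continuous_intros)
qed

lemma C1w_real_compose:
  assumes "C1w S (\<lambda>z. of_real (n z)) a b" "\<And>z. z \<in> S \<Longrightarrow> (f has_real_derivative f' (n z)) (at (n z))"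
    and "continuous_on (n ` S) f'"
  shows "C1w S (\<lambda>z. of_real (f (n z))) (\<lambda>z. of_real (f' (n z)) * a z) (\<lambda>z. of_real (f' (n z)) * b z)"
proof -
  have "continuous_on S n"
    using continuous_on_Re[OF C1w_cont[OF assms(1)]] by simp
  then have "continuous_on S (\<lambda>z. f' (n z))"
    using assms(3) continuous_on_compose2 by blast
  moreover have "has_wirt (\<lambda>z. of_real (f (n z))) (of_real (f' (n z)) * a z) (of_real (f' (n z)) * b z) z"
    if "z \<in> S" for z
    using assms that by (intro has_wirt_real_compose[of n]) (auto simp: C1w_def)
  ultimately show ?thesis
    using assms(1) by (auto simp: C1w_def intro!: continuous_intros)
qed

lemma C1w_cong:
  assumes "C1w S f a b" "open S" "\<And>z. z \<in> S \<Longrightarrow> f' z = f z" "\<And>z. z \<in> S \<Longrightarrow> a' z = a z" "\<And>z. z \<in> S \<Longrightarrow> b' z = b z"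
  shows "C1w S f' a' b'"
proof -
  have "has_wirt f' (a z) (b z) z" if "z \<in> S" for z
    using assms that by (auto simp: C1w_def intro: has_wirt_cong[where f = f and S = S])
  moreover have "continuous_on S a'"
    by (rule continuous_on_eq[OF C1w_cont_z[OF assms(1)]]) (simp add: assms(4))
  moreover have "continuous_on S b'"
    by (rule continuous_on_eq[OF C1w_cont_zbar[OF assms(1)]]) (simp add: assms(5))
  ultimately show ?thesis using assms(4,5) by (auto simp: C1w_def)
qed

lemma C1w_eq_rhs:
  assumes "C1w S f a b" "\<And>z. z \<in> S \<Longrightarrow> a' z = a z" "\<And>z. z \<in> S \<Longrightarrow> b' z = b z"
  shows "C1w S f a' b'"
proof -
  have "continuous_on S a'"
    by (rule continuous_on_eq[OF C1w_cont_z[OF assms(1)]]) (simp add: assms(2))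
  moreover have "continuous_on S b'"
    by (rule continuous_on_eq[OF C1w_cont_zbar[OF assms(1)]]) (simp add: assms(3))
  ultimately show ?thesis using assms by (auto simp: C1w_def)
qed

text \<open>Glues local results. All neighbourhoods must share the same \<open>a\<close> and
  \<open>b\<close>, so derivatives found locally are first normalised to \<open>wirt_z\<close> and
  \<open>wirt_zbar\<close>.\<close>

lemma C1w_Union:
  assumes "\<And>z. z \<in> S \<Longrightarrow> \<exists>T. open T \<and> z \<in> T \<and> C1w T f a b"
  shows "C1w S f a b"
proof -
  have "has_wirt f (a z) (b z) z" "isCont a z" "isCont b z" if "z \<in> S" for z
    using assms[OF that] by (auto simp: C1w_def continuous_on_eq_continuous_at)
  then show ?thesis
    by (simp add: C1w_def continuous_at_imp_continuous_on)
qed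

lemma C1w_of_Ck:
  assumes "Ck_on (Suc 0) S f"
  shows "C1w S f (wirt_z f) (wirt_zbar f)"
proof -
  have "continuous_on S (partial_x f)" "continuous_on S (partial_y f)"
    "\<And>z. z \<in> S \<Longrightarrow> has_wirt f (wirt_z f z) (wirt_zbar f z) z"
    using assms by (auto intro: has_wirt_of_partials)
  then show ?thesis
    by (auto simp: C1w_def wirt_z_def[abs_def] wirt_zbar_def[abs_def] intro!: continuous_intros)
qed

lemma Ck_on_Suc_imp: "Ck_on (Suc k) S f \<Longrightarrow> Ck_on k S f"
proof (induction k arbitrary: f)
  case 0
  then show ?case by (auto intro!: continuous_at_imp_continuous_on differentiable_imp_continuous_within)
next
  case (Suc k)
  show ?case
    unfolding Ck_on.simps(2)[of k S f]
    using Suc.prems[unfolded Ck_on.simps(2)[of "Suc k" S f]] Suc.IH by blast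
qed

text \<open>The dbar derivative of u_z is a quarter of the Laplacian plus an imaginary multiple of
  u_xy - u_yx. Taking the real part bypasses the symmetry of the mixed derivatives.\<close>

lemma laplacian_eq:
  fixes u :: "complex \<Rightarrow> real"
  assumes "open S" "z \<in> S" "C1w S (\<lambda>z. of_real (u z)) w w'" "C1w S w wz wb"
  shows "laplacian u z = 4 * Re (wb z)"
proof -
  have px: "partial_x u y = 2 * Re (w y)" and py: "partial_y u y = - 2 * Im (w y)" if "y \<in> S" for y
    using has_wirt_real_partials[OF C1wD[OF assms(3) that]] by auto
  have W: "has_wirt w (wz z) (wb z) z" using assms C1wD by blast
  have "has_wirt (\<lambda>y. of_real (2 * Re (w y))) (wz z + cnj (wb z)) (wb z + cnj (wz z)) z"
    using has_wirt_add[OF W has_wirt_cnj[OF W]] by (simp add: complex_add_cnj)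
  then have 1: "has_wirt (\<lambda>y. of_real (partial_x u y)) (wz z + cnj (wb z)) (wb z + cnj (wz z)) z"
    by (rule has_wirt_cong[OF _ assms(1,2)]) (simp add: px)
  have "has_wirt (\<lambda>y. \<i> * (w y - cnj (w y))) (0 * (w z - cnj (w z)) + \<i> * (wz z - cnj (wb z))) (0 * (w z - cnj (w z)) + \<i> * (wb z - cnj (wz z))) z"
    by (rule has_wirt_mult[OF has_wirt_const has_wirt_diff[OF W has_wirt_cnj[OF W]]])
  then have 2: "has_wirt (\<lambda>y. of_real (partial_y u y)) (\<i> * (wz z - cnj (wb z))) (\<i> * (wb z - cnj (wz z))) z"
    by (auto simp: py complex_eq_iff intro: has_wirt_cong[of "\<lambda>y. \<i> * (w y - cnj (w y))" _ _ z S, OF _ assms(1,2)])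
  show ?thesis
    unfolding laplacian_def has_wirt_real_partials(1)[OF 1] has_wirt_real_partials(2)[OF 2] by simp
qed

lemma has_wirt_path:
  assumes "has_wirt f a b (\<gamma> t)" "(\<gamma> has_vector_derivative v) (at t within T)"
  shows "((\<lambda>t. f (\<gamma> t)) has_vector_derivative (a * v + b * cnj v)) (at t within T)"
proof -
  have "((\<lambda>t. f (\<gamma> t)) has_derivative (\<lambda>s. a * (s *\<^sub>R v) + b * cnj (s *\<^sub>R v))) (at t within T)"
    using has_derivative_compose[of \<gamma> "\<lambda>s. s *\<^sub>R v" t T f "\<lambda>d. a * d + b * cnj d"] assms
    unfolding has_wirt_def has_vector_derivative_def by simp
  then show ?thesis
    unfolding has_vector_derivative_def
    by (rule has_derivative_eq_rhs) (simp add: fun_eq_iff scaleR_conv_of_real algebra_simps)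
qed

section \<open>The class of C1 functions with the derivatives suppressed\<close>

definition C1 :: "complex set \<Rightarrow> (complex \<Rightarrow> complex) \<Rightarrow> bool" where
  "C1 S f \<longleftrightarrow> (\<exists>a b. C1w S f a b)"

lemma C1I: "C1w S f a b \<Longrightarrow> C1 S f" by (auto simp: C1_def)
lemma C1_const: "C1 S (\<lambda>z. c)" using C1w_const C1_def by blast
lemma C1_add: "C1 S f \<Longrightarrow> C1 S g \<Longrightarrow> C1 S (\<lambda>z. f z + g z)" unfolding C1_def by (blast intro: C1w_add)
lemma C1_diff: "C1 S f \<Longrightarrow> C1 S g \<Longrightarrow> C1 S (\<lambda>z. f z - g z)" unfolding C1_def by (blast intro: C1w_diff)
lemma C1_mult: "C1 S f \<Longrightarrow> C1 S g \<Longrightarrow> C1 S (\<lambda>z. f z * g z)" unfolding C1_def by (blast intro: C1w_mult)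
lemma C1_cnj: "C1 S f \<Longrightarrow> C1 S (\<lambda>z. cnj (f z))" unfolding C1_def by (blast intro: C1w_cnj)
lemma C1_divide: "C1 S f \<Longrightarrow> C1 S g \<Longrightarrow> (\<And>z. z \<in> S \<Longrightarrow> g z \<noteq> 0) \<Longrightarrow> C1 S (\<lambda>z. f z / g z)"
  unfolding C1_def by (blast intro: C1w_divide)
lemma C1_compose: "C1 T g \<Longrightarrow> C1 S f \<Longrightarrow> f ` S \<subseteq> T \<Longrightarrow> C1 S (\<lambda>z. g (f z))"
  unfolding C1_def by (blast intro: C1w_compose)
lemma C1_subset: "C1 S f \<Longrightarrow> T \<subseteq> S \<Longrightarrow> C1 T f" unfolding C1_def by (blast intro: C1w_subset)

lemmas C1_intros = C1_const C1_add C1_diff C1_mult C1_cnj C1_divide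

lemma C1w_id: "C1w S (\<lambda>z. z) (\<lambda>z. 1) (\<lambda>z. 0)"
  by (auto simp: C1w_def has_wirt_def)

section \<open>The Cauchy transform and the dbar equation\<close>

text \<open>The exponent is at least 2, so at the corner the difference quotient is bounded by a
  positive power of |h|. Truncated powers are the building blocks of the cutoff function.\<close>

lemma max_power_deriv:
  fixes t :: real
  shows "((\<lambda>t. (max 0 t) ^ Suc (Suc k)) has_real_derivative real (Suc (Suc k)) * (max 0 t) ^ Suc k) (at t)"
proof -
  consider "t > 0" | "t < 0" | "t = 0" by linarith
  then show ?thesis
  proof cases
    case 1
    have "((\<lambda>t. t ^ Suc (Suc k)) has_real_derivative real (Suc (Suc k)) * t ^ Suc k) (at t)"
      using DERIV_pow[of "Suc (Suc k)" t UNIV] by (simp only: diff_Suc_Suc diff_zero)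
    then have "((\<lambda>t. (max 0 t) ^ Suc (Suc k)) has_real_derivative real (Suc (Suc k)) * t ^ Suc k) (at t)"
      by (rule has_field_derivative_transform_within_open[where S = "{0<..}"]) (use 1 in \<open>auto simp: max_def\<close>)
    then show ?thesis using 1 by (simp add: max_def)
  next
    case 2
    have "((\<lambda>t. (max 0 t) ^ Suc (Suc k)) has_real_derivative 0) (at t)"
      by (rule has_field_derivative_transform_within_open[OF DERIV_const[of 0], where S = "{..<0}"])
        (use 2 in \<open>auto simp: max_def\<close>)
    then show ?thesis using 2 by (simp add: max_def)
  next
    case 3
    have "(\<lambda>h. (max 0 h) ^ Suc (Suc k) / h) \<midarrow>(0::real)\<rightarrow> 0"
    proof (rule Lim_null_comparison)
      show "\<forall>\<^sub>F h in at 0. norm ((max 0 h) ^ Suc (Suc k) / h) \<le> \<bar>h::real\<bar> ^ Suc k"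
        by (rule always_eventually) (auto simp: max_def intro: mult_nonpos_nonneg)
      have "((\<lambda>h::real. \<bar>h\<bar> ^ Suc k) \<longlongrightarrow> \<bar>0\<bar> ^ Suc k) (at 0)"
        by (intro tendsto_intros)
      then show "((\<lambda>h::real. \<bar>h\<bar> ^ Suc k) \<longlongrightarrow> 0) (at 0)" by simp
    qed
    then show ?thesis using 3 by (simp add: has_field_derivative_iff)
  qed
qed

text \<open>The cutoff is p / (p + m), where \<open>p\<close> is a truncated cube of \<beta>^2 - |z
  - c|^2 and \<open>m\<close> one of |z - c|^2 - \<alpha>^2. They never vanish together because
  \<alpha> < \<beta>. Cubes are just smooth enough to leave the first derivatives C1.\<close>

lemma cutoff_exists:
  fixes c :: complex and \<alpha> \<beta> :: real
  assumes "0 < \<alpha>" "\<alpha> < \<beta>"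
  obtains \<eta> \<eta>z \<eta>b where "C1w UNIV \<eta> \<eta>z \<eta>b" "C1 UNIV \<eta>z" "C1 UNIV \<eta>b"
    "\<And>z. dist c z < \<alpha> \<Longrightarrow> \<eta> z = 1" "\<And>z. \<beta> < dist c z \<Longrightarrow> \<eta> z = 0"
proof -
  define n where "n z = (dist c z)\<^sup>2" for z
  have nz: "of_real (n z) = (z - c) * cnj (z - c)" for z
    unfolding n_def dist_norm by (metis complex_norm_square norm_minus_commute)
  have "C1w UNIV (\<lambda>z. (z - c) * cnj (z - c)) (\<lambda>z. (1 - 0) * cnj (z - c) + (z - c) * cnj (0 - 0))
      (\<lambda>z. (0 - 0) * cnj (z - c) + (z - c) * cnj (1 - 0))"
    by (intro C1w_mult C1w_cnj C1w_diff C1w_const) (rule C1w_id)+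
  then have n: "C1w UNIV (\<lambda>z. of_real (n z)) (\<lambda>z. cnj (z - c)) (\<lambda>z. z - c)"
    by (simp add: nz)
  have lin: "C1 UNIV (\<lambda>z. z - c)" "C1 UNIV (\<lambda>z. cnj (z - c))"
    by (intro C1_intros C1I[OF C1w_id])+
  have main: "\<exists>a b. C1w UNIV (\<lambda>z. of_real (max 0 (s * n z + d) ^ 3)) a b \<and> C1 UNIV a \<and> C1 UNIV b" for s d :: real
  proof -
    have v: "C1w UNIV (\<lambda>z. of_real (s * n z + d)) (\<lambda>z. of_real s * cnj (z - c)) (\<lambda>z. of_real s * (z - c))"
      using C1w_add[OF C1w_mult[OF C1w_const[of _ "of_real s"] n] C1w_const[of _ "of_real d"]] by simp
    have c2: "C1 UNIV (\<lambda>z. of_real (3 * max 0 (s * n z + d) ^ 2))"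
    proof -
      have "C1w UNIV (\<lambda>z. of_real (max 0 (s * n z + d) ^ 2)) (\<lambda>z. of_real (2 * max 0 (s * n z + d)) * (of_real s * cnj (z - c)))
         (\<lambda>z. of_real (2 * max 0 (s * n z + d)) * (of_real s * (z - c)))"
        by (rule C1w_real_compose[OF v, where f = "\<lambda>t. max 0 t ^ 2" and f' = "\<lambda>t. 2 * max 0 t"])
          (use max_power_deriv[of 0] in \<open>auto intro!: continuous_intros simp: numeral_eq_Suc\<close>)
      from C1_mult[OF C1_const[of _ 3] C1I[OF this]] show ?thesis by simp
    qed
    have "C1w UNIV (\<lambda>z. of_real (max 0 (s * n z + d) ^ 3)) (\<lambda>z. of_real (3 * max 0 (s * n z + d) ^ 2) * (of_real s * cnj (z - c)))
         (\<lambda>z. of_real (3 * max 0 (s * n z + d) ^ 2) * (of_real s * (z - c)))"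
        by (rule C1w_real_compose[OF v, where f = "\<lambda>t. max 0 t ^ 3" and f' = "\<lambda>t. 3 * max 0 t ^ 2"])
          (use max_power_deriv[of 1] in \<open>auto intro!: continuous_intros simp: numeral_eq_Suc\<close>)
    moreover have "C1 UNIV (\<lambda>z. of_real (3 * max 0 (s * n z + d) ^ 2) * (of_real s * cnj (z - c)))"
      "C1 UNIV (\<lambda>z. of_real (3 * max 0 (s * n z + d) ^ 2) * (of_real s * (z - c)))"
      by (rule C1_mult[OF c2 C1_mult[OF C1_const lin(2)]], rule C1_mult[OF c2 C1_mult[OF C1_const lin(1)]])
    ultimately show ?thesis by blast
  qed
  define p where "p z = complex_of_real (max 0 (-1 * n z + \<beta>\<^sup>2) ^ 3)" for z
  define m where "m z = complex_of_real (max 0 (1 * n z + (- \<alpha>\<^sup>2)) ^ 3)" for z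
  obtain pz pb where p: "C1w UNIV p pz pb" "C1 UNIV pz" "C1 UNIV pb"
    using main[of "-1" "\<beta>\<^sup>2"] unfolding p_def by blast
  obtain mz mb where m: "C1w UNIV m mz mb" "C1 UNIV mz" "C1 UNIV mb"
    using main[of 1 "- \<alpha>\<^sup>2"] unfolding m_def by blast
  have ab: "\<alpha>\<^sup>2 < \<beta>\<^sup>2" using assms by (simp add: power_strict_mono)
  have nonz: "p z + m z \<noteq> 0" for z
  proof -
    have "max 0 (-1 * n z + \<beta>\<^sup>2) ^ 3 + max 0 (1 * n z + (- \<alpha>\<^sup>2)) ^ 3 > 0"
    proof (cases "n z < \<beta>\<^sup>2")
      case True then show ?thesis by (intro add_pos_nonneg) auto
    next
      case False then show ?thesis using ab by (intro add_nonneg_pos) auto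
    qed
    then show ?thesis unfolding p_def m_def by (metis of_real_add of_real_eq_0_iff less_irrefl)
  qed
  have q: "C1w UNIV (\<lambda>z. p z + m z) (\<lambda>z. pz z + mz z) (\<lambda>z. pb z + mb z)"
    by (rule C1w_add[OF p(1) m(1)])
  show ?thesis
  proof (rule that[OF C1w_divide[OF p(1) q nonz]])
    note C = C1I[OF p(1)] C1I[OF m(1)] p(2,3) m(2,3)
    show "C1 UNIV (\<lambda>z. (pz z * (p z + m z) - p z * (pz z + mz z)) / (p z + m z)\<^sup>2)"
      "C1 UNIV (\<lambda>z. (pb z * (p z + m z) - p z * (pb z + mb z)) / (p z + m z)\<^sup>2)"
      unfolding power2_eq_square using nonz by (auto intro!: C1_intros C)
    show "p z / (p z + m z) = 1" if "dist c z < \<alpha>" for z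
    proof -
      have "n z < \<alpha>\<^sup>2" unfolding n_def using that by (intro power_strict_mono) auto
      then have "m z = 0" by (simp add: m_def)
      then show ?thesis using nonz[of z] by simp
    qed
    show "p z / (p z + m z) = 0" if "\<beta> < dist c z" for z
    proof -
      have "\<beta>\<^sup>2 < n z" unfolding n_def using that assms by (intro power_strict_mono) auto
      then show ?thesis by (simp add: p_def)
    qed
  qed
qed

text \<open>The strict inequality describes an open set, on which the function is constant. Thus the
  derivatives of a cutoff can serve as cutoff factors with the same radius.\<close>

lemma C1w_zero_outside:
  assumes "C1w UNIV f a b" "\<And>z. \<beta> < dist c z \<Longrightarrow> f z = 0" "\<beta> < dist c z"
  shows "a z = 0" "b z = 0"
proof -
  have "open {z. \<beta> < dist c z}" by (intro open_Collect_less continuous_intros)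
  then have "has_wirt f 0 0 z"
    using has_wirt_cong[OF has_wirt_const[of 0 z], of "{z. \<beta> < dist c z}" f] assms(2,3) by auto
  moreover have "has_wirt f (a z) (b z) z" using assms(1) C1wD by blast
  ultimately show "a z = 0" "b z = 0" using has_wirt_imp by metis+
qed

text \<open>Outside \<open>S\<close> the values of \<open>f\<close> are arbitrary, but the product
  is zero there. Every point lies in \<open>S\<close> or in the open set beyond radius \<beta>,
  because the closed disc lies in \<open>S\<close>.\<close>

lemma C1w_cutoff_mult:
  assumes "C1w UNIV \<eta> \<eta>z \<eta>b" "C1w S f a b" "open S" "cball c \<beta> \<subseteq> S"
    and zero: "\<And>z. \<beta> < dist c z \<Longrightarrow> \<eta> z = 0"
  shows "C1w UNIV (\<lambda>z. \<eta> z * f z) (\<lambda>z. \<eta>z z * f z + \<eta> z * a z) (\<lambda>z. \<eta>b z * f z + \<eta> z * b z)"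
proof (rule C1w_Union)
  fix z
  note z0 = C1w_zero_outside[OF assms(1) zero]
  show "\<exists>T. open T \<and> z \<in> T \<and> C1w T (\<lambda>z. \<eta> z * f z) (\<lambda>z. \<eta>z z * f z + \<eta> z * a z) (\<lambda>z. \<eta>b z * f z + \<eta> z * b z)"
  proof (cases "z \<in> S")
    case True
    then show ?thesis using C1w_mult[OF C1w_subset[OF assms(1), of S] assms(2)] assms(3) by auto
  next
    case False
    have o: "open {z. \<beta> < dist c z}" by (intro open_Collect_less continuous_intros)
    have "C1w {z. \<beta> < dist c z} (\<lambda>z. \<eta> z * f z) (\<lambda>z. \<eta>z z * f z + \<eta> z * a z) (\<lambda>z. \<eta>b z * f z + \<eta> z * b z)"
      by (rule C1w_cong[OF C1w_const[of _ 0] o]) (auto simp: z0 zero)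
    then show ?thesis using o False assms(4) by (intro exI[of _ "{z. \<beta> < dist c z}"]) (auto simp: subset_iff not_le)
  qed
qed

text \<open>
  The solution \<open>- 1/\<pi> \<integral> q(\<zeta>) / (\<zeta> - z) dA\<close> of the \<open>dbar\<close> equation, in polar coordinates around \<open>z\<close>, where
  the area element cancels the singularity. It is only used for \<open>q\<close> with compact support, at points \<open>z\<close> whose
  disc of radius \<open>R\<close> contains the support.
\<close>

definition cauchy_tr :: "real \<Rightarrow> (complex \<Rightarrow> complex) \<Rightarrow> complex \<Rightarrow> complex" where
  "cauchy_tr R q z =
     - (1 / of_real pi) * integral (cbox (0, 0) (R, 2 * pi)) (\<lambda>x. q (z + of_real (fst x) * cis (snd x)) * cis (- snd x))"

lemma cauchy_tr_cont_integrand: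
  assumes "continuous_on UNIV q"
  shows "continuous_on T (\<lambda>x. q (z + of_real (fst x) * cis (snd x)) * cis (- snd x))"
  by (intro continuous_intros continuous_on_compose2[OF assms]) auto

lemma cauchy_tr_integrable:
  assumes "continuous_on UNIV q"
  shows "(\<lambda>x. q (z + of_real (fst x) * cis (snd x)) * cis (- snd x)) integrable_on (cbox (0, 0) (R, 2 * pi))"
  by (rule integrable_continuous[OF cauchy_tr_cont_integrand[OF assms]])

lemma cauchy_tr_add:
  assumes "continuous_on UNIV p" "continuous_on UNIV q"
  shows "cauchy_tr R (\<lambda>z. p z + q z) z = cauchy_tr R p z + cauchy_tr R q z"
  unfolding cauchy_tr_def distrib_right
  by (subst Henstock_Kurzweil_Integration.integral_add[OF cauchy_tr_integrable[OF assms(1)] cauchy_tr_integrable[OF assms(2)]])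
    (simp add: algebra_simps)

lemma cauchy_tr_cont:
  assumes "continuous_on UNIV q"
  shows "continuous_on UNIV (cauchy_tr R q)"
proof -
  have "continuous_on (UNIV \<times> cbox (0, 0) (R, 2 * pi)) (\<lambda>(z, x). q (z + of_real (fst x) * cis (snd x)) * cis (- snd x))"
    unfolding split_beta by (intro continuous_intros continuous_on_compose2[OF assms]) auto
  from integral_continuous_on_param[OF this] show ?thesis
    unfolding cauchy_tr_def[abs_def] by (intro continuous_intros)
qed

text \<open>In polar coordinates around the moving point the kernel no longer depends on
  \<open>z\<close>, so derivatives pass under the integral and fall on \<open>q\<close>
  alone.\<close>

lemma cauchy_tr_C1w:
  assumes "C1w UNIV q a b"
  shows "C1w UNIV (cauchy_tr R q) (cauchy_tr R a) (cauchy_tr R b)"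
proof -
  note ca = C1w_cont_z[OF assms] and cb = C1w_cont_zbar[OF assms] and cq = C1w_cont[OF assms]
  let ?B = "cbox (0::real, 0::real) (R, 2 * pi)"
  let ?g = "\<lambda>z x. z + of_real (fst x) * cis (snd x) :: complex"
  \<comment> \<open>The Leibniz rule wants the differential as a continuous family of bounded linear
    maps; \<open>W u v\<close> packages d |-> u d + v cnj d.\<close>
  define cL :: "complex \<Rightarrow>\<^sub>L complex" where "cL = Blinfun cnj"
  have cL: "blinfun_apply cL d = cnj d" for d
    unfolding cL_def by (simp add: bounded_linear_Blinfun_apply bounded_linear_cnj)
  define W :: "complex \<Rightarrow> complex \<Rightarrow> complex \<Rightarrow>\<^sub>L complex"
    where "W u v = blinfun_mult_right u + (blinfun_mult_right v o\<^sub>L cL)" for u v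
  have W: "blinfun_apply (W u v) d = u * d + v * cnj d" for u v d
    by (simp add: W_def blinfun.bilinear_simps cL)
  define fx where "fx z x = W (a (?g z x) * cis (- snd x)) (b (?g z x) * cis (- snd x))" for z and x :: "real \<times> real"
  have cW: "continuous_on T (\<lambda>x. W (u x) (v x))" if "continuous_on T u" "continuous_on T v"
    for T :: "(complex \<times> real \<times> real) set" and u v
    unfolding W_def
    by (intro continuous_intros bounded_linear.continuous_on[OF bounded_linear_blinfun_mult_right] that)
  have cW': "continuous_on T (\<lambda>x. W (u x) (v x))" if "continuous_on T u" "continuous_on T v"
    for T :: "(real \<times> real) set" and u v
    unfolding W_def
    by (intro continuous_intros bounded_linear.continuous_on[OF bounded_linear_blinfun_mult_right] that)
  have "has_wirt (cauchy_tr R q) (cauchy_tr R a z) (cauchy_tr R b z) z" for z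
  proof -
    have "((\<lambda>z. integral ?B (\<lambda>x. q (?g z x) * cis (- snd x))) has_derivative integral ?B (fx z)) (at z within UNIV)"
    proof (rule leibniz_rule)
      fix y :: complex and x :: "real \<times> real"
      have "has_wirt (\<lambda>y. ?g y x) (1 + 0) (0 + 0) y"
        by (rule has_wirt_add[OF _ has_wirt_const]) (simp add: has_wirt_def)
      from has_wirt_compose[OF this C1wD[OF assms UNIV_I]]
      have "has_wirt (\<lambda>y. q (?g y x)) (a (?g y x)) (b (?g y x)) y" by simp
      from has_wirt_mult[OF this has_wirt_const[of "cis (- snd x)"]]
      show "((\<lambda>y. q (?g y x) * cis (- snd x)) has_derivative blinfun_apply (fx y x)) (at y within UNIV)"
        unfolding fx_def W has_wirt_def by simp
    next
      show "continuous_on (UNIV \<times> ?B) (\<lambda>(z, x). fx z x)"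
        unfolding fx_def split_beta
        by (intro cW continuous_intros continuous_on_compose2[OF ca] continuous_on_compose2[OF cb]) auto
    qed (auto intro!: cauchy_tr_integrable cq)
    then have 1: "((\<lambda>z. - (1 / of_real pi) * integral ?B (\<lambda>x. q (?g z x) * cis (- snd x))) has_derivative
        (\<lambda>d. - (1 / of_real pi) * blinfun_apply (integral ?B (fx z)) d)) (at z)"
      by (intro has_derivative_mult_right) simp
    have "continuous_on ?B (fx z)"
      unfolding fx_def
      by (intro cW' continuous_intros continuous_on_compose2[OF ca] continuous_on_compose2[OF cb]) auto
    then have "fx z integrable_on ?B" by (rule integrable_continuous)
    note ib = blinfun_apply_integral[OF this]
    have "- (1 / of_real pi) * blinfun_apply (integral ?B (fx z)) d = cauchy_tr R a z * d + cauchy_tr R b z * cnj d" for d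
    proof -
      have "blinfun_apply (integral ?B (fx z)) d = integral ?B (\<lambda>x. blinfun_apply (fx z x) d)"
        by (rule ib)
      also have "\<dots> = integral ?B (\<lambda>x. a (?g z x) * cis (- snd x) * d + b (?g z x) * cis (- snd x) * cnj d)"
        unfolding fx_def W ..
      also have "\<dots> = integral ?B (\<lambda>x. a (?g z x) * cis (- snd x) * d) + integral ?B (\<lambda>x. b (?g z x) * cis (- snd x) * cnj d)"
        by (intro Henstock_Kurzweil_Integration.integral_add integrable_on_mult_left cauchy_tr_integrable ca cb)
      also have "\<dots> = integral ?B (\<lambda>x. a (?g z x) * cis (- snd x)) * d + integral ?B (\<lambda>x. b (?g z x) * cis (- snd x)) * cnj d"
        by (simp only: integral_mult_left)
      finally show ?thesis unfolding cauchy_tr_def by (simp add: algebra_simps)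
    qed
    with 1 show ?thesis unfolding has_wirt_def cauchy_tr_def[abs_def] by simp
  qed
  then show ?thesis using cauchy_tr_cont[OF ca] cauchy_tr_cont[OF cb] by (simp add: C1w_def)
qed

lemma cis_vector_derivative: "(cis has_vector_derivative (\<i> * cis t)) (at t within T)"
proof -
  have "((\<lambda>t. exp (\<i> * of_real t)) has_vector_derivative (\<i> * exp (\<i> * of_real t))) (at t within T)"
    by (rule has_vector_derivative_real_field) (auto intro!: derivative_eq_intros)
  then show ?thesis by (simp add: cis_conv_exp[abs_def])
qed

lemma polar_vector_derivative:
  "((\<lambda>t. z + of_real r * cis t) has_vector_derivative (of_real r * (\<i> * cis t))) (at t within T)"
  "((\<lambda>r. z + of_real r * cis t) has_vector_derivative (cis t)) (at r within T)"
proof -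
  have "((\<lambda>t. z + of_real r * cis t) has_vector_derivative (0 + of_real r * (\<i> * cis t))) (at t within T)"
    by (intro has_vector_derivative_add has_vector_derivative_const has_vector_derivative_mult_right cis_vector_derivative)
  then show "((\<lambda>t. z + of_real r * cis t) has_vector_derivative (of_real r * (\<i> * cis t))) (at t within T)" by simp
  show "((\<lambda>r. z + of_real r * cis t) has_vector_derivative (cis t)) (at r within T)"
    unfolding has_vector_derivative_def
    by (auto intro!: derivative_eq_intros simp: scaleR_conv_of_real)
qed

text \<open>
  Along \<open>z + r cis t\<close>, twice \<open>b cis (- t)\<close> is the radial derivative \<open>A\<close> of \<open>q\<close> minus \<open>T\<close>, where
  \<open>\<i> r T\<close> is the angular derivative and so has mean zero.
\<close>

lemma cauchy_tr_dbar:
  assumes q: "C1w UNIV q a b" and zero: "\<And>w. \<delta> < dist c w \<Longrightarrow> q w = 0"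
    and z: "dist c z < \<delta>" and R: "2 * \<delta> < R"
  shows "cauchy_tr R b z = q z"
proof -
  note ca = C1w_cont_z[OF q] and cb = C1w_cont_zbar[OF q] and cq = C1w_cont[OF q]
  have R0: "0 \<le> R" using z R zero_le_dist[of c z] by linarith
  let ?B = "cbox (0::real, 0::real) (R, 2 * pi)"
  let ?g = "\<lambda>x. z + of_real (fst x) * cis (snd x) :: complex"
  define A where "A x = a (?g x) * cis (snd x) + b (?g x) * cis (- snd x)" for x
  define T where "T x = a (?g x) * cis (snd x) - b (?g x) * cis (- snd x)" for x
  have cA: "continuous_on X A" and cT: "continuous_on X T" for X
    unfolding A_def T_def
    by (intro continuous_intros continuous_on_compose2[OF ca] continuous_on_compose2[OF cb]; auto)+
  have iT: "integral ?B T = 0"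
  proof -
    have in0: "integral (cbox 0 (2*pi)) (\<lambda>t. T (r, t)) = 0" if "r \<noteq> 0" for r
    proof -
      have "((\<lambda>t. a (z + of_real r * cis t) * (of_real r * (\<i> * cis t)) + b (z + of_real r * cis t) * cnj (of_real r * (\<i> * cis t)))
          has_integral (q (z + of_real r * cis (2*pi)) - q (z + of_real r * cis 0))) {0..2*pi}"
        by (intro fundamental_theorem_of_calculus has_wirt_path[OF C1wD[OF q UNIV_I]] polar_vector_derivative) auto
      moreover have "(\<lambda>t. a (z + of_real r * cis t) * (of_real r * (\<i> * cis t)) + b (z + of_real r * cis t) * cnj (of_real r * (\<i> * cis t)))
          = (\<lambda>t. (of_real r * \<i>) * T (r, t))"
        by (simp add: fun_eq_iff T_def cis_cnj algebra_simps)
      ultimately have "((\<lambda>t. (of_real r * \<i>) * T (r, t)) has_integral 0) {0..2*pi}"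
        by simp
      then have *: "((\<lambda>t. inverse (of_real r * \<i>) * ((of_real r * \<i>) * T (r, t))) has_integral (inverse (of_real r * \<i>) * 0)) {0..2*pi}"
        by (rule has_integral_mult_right)
      then have "((\<lambda>t. T (r, t)) has_integral 0) {0..2*pi}"
      proof -
        have "inverse d * (d * x) = x" if "d \<noteq> 0" for d x :: complex using that by simp
        note id = this[of "of_real r * \<i>"]
        have "of_real r * \<i> \<noteq> 0" using that by simp
        from * show ?thesis by (simp only: id[OF \<open>of_real r * \<i> \<noteq> 0\<close>] mult_zero_right)
      qed
      then show ?thesis by (simp add: integral_unique)
    qed
    have "integral ?B T = integral (cbox 0 R) (\<lambda>r. integral (cbox 0 (2*pi)) (\<lambda>t. T (r, t)))"
      by (rule integral_prod_continuous[OF cT])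
    \<comment> \<open>The angular argument divides by r, so the null set r = 0 is discarded.\<close>
    also have "\<dots> = integral (cbox 0 R) (\<lambda>r. 0)"
      by (rule integral_spike[of "{0}"]) (auto simp: in0[simplified])
    finally show ?thesis by simp
  qed
  have iA: "integral ?B A = - 2 * of_real pi * q z"
  proof -
    have in1: "integral (cbox 0 R) (\<lambda>r. A (r, t)) = - q z" for t
    proof -
      have "((\<lambda>r. a (z + of_real r * cis t) * cis t + b (z + of_real r * cis t) * cnj (cis t))
          has_integral (q (z + of_real R * cis t) - q (z + of_real 0 * cis t))) {0..R}"
        by (intro fundamental_theorem_of_calculus has_wirt_path[OF C1wD[OF q UNIV_I]] polar_vector_derivative R0)
      \<comment> \<open>Since \<open>z\<close> is within \<delta> of \<open>c\<close> and R > 2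
        \<delta>, the far end of each ray is more than \<delta> away from \<open>c\<close>, outside
        the support.\<close>
      moreover have "q (z + of_real R * cis t) = 0"
      proof (rule zero)
        have "R \<le> dist c (z + of_real R * cis t) + dist c z"
        proof -
          have "R = norm ((z + of_real R * cis t - c) - (z - c))" using R0 by (simp add: norm_mult)
          also have "\<dots> \<le> norm (z + of_real R * cis t - c) + norm (z - c)" by (rule norm_triangle_ineq4)
          finally show ?thesis by (simp add: dist_norm norm_minus_commute)
        qed
        then show "\<delta> < dist c (z + of_real R * cis t)" using z R by linarith
      qed
      ultimately have "((\<lambda>r. A (r, t)) has_integral - q z) {0..R}" by (simp add: A_def cis_cnj)
      then show ?thesis by (simp add: integral_unique)
    qed
    have "integral ?B A = integral (cbox 0 R) (\<lambda>r. integral (cbox 0 (2*pi)) (\<lambda>t. A (r, t)))"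
      by (rule integral_prod_continuous[OF cA])
    also have "\<dots> = integral (cbox 0 (2*pi)) (\<lambda>t. integral (cbox 0 R) (\<lambda>r. A (r, t)))"
      by (rule integral_swap_continuous) (use cA in \<open>simp add: split_beta\<close>)
    also have "\<dots> = - 2 * of_real pi * q z" unfolding in1 by (simp add: scaleR_conv_of_real)
    finally show ?thesis .
  qed
  have "integral ?B (\<lambda>x. b (?g x) * cis (- snd x)) = integral ?B (\<lambda>x. (A x - T x) * (1/2))"
    by (rule arg_cong[of _ _ "integral ?B"]) (simp add: fun_eq_iff A_def T_def)
  also have "\<dots> = (integral ?B A - integral ?B T) * (1/2)"
    by (subst integral_mult_left) (simp add: Henstock_Kurzweil_Integration.integral_diff integrable_continuous cA cT)
  also have "\<dots> = - of_real pi * q z" by (simp add: iA iT)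
  finally show ?thesis unfolding cauchy_tr_def by simp
qed

lemma C1w_local_one:
  assumes "C1w UNIV \<eta> \<eta>z \<eta>b" "\<And>z. dist c z < \<alpha> \<Longrightarrow> \<eta> z = 1" "dist c z < \<alpha>"
  shows "\<eta>z z = 0" "\<eta>b z = 0"
proof -
  have "has_wirt \<eta> 0 0 z"
    using has_wirt_cong[OF has_wirt_const[of 1 z], of "ball c \<alpha>" \<eta>] assms(2,3) by auto
  moreover have "has_wirt \<eta> (\<eta>z z) (\<eta>b z) z" using assms(1) C1wD by blast
  ultimately show "\<eta>z z = 0" "\<eta>b z = 0" using has_wirt_imp by metis+
qed

text \<open>The cutoff makes the right-hand side compactly supported in the disc of radius \<beta>,
  and the Cauchy transform of the product solves the equation where the cutoff is 1. Radius 3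
  \<beta> meets the requirement of exceeding 2 \<beta>.\<close>

lemma dbar_solution:
  assumes "open S" "c \<in> S" "C1 S q"
  obtains r s sz where "0 < r" "ball c r \<subseteq> S" "C1w (ball c r) s sz q"
proof -
  obtain qz qb where q: "C1w S q qz qb" using assms(3) C1_def by auto
  obtain \<beta> where \<beta>: "0 < \<beta>" "cball c \<beta> \<subseteq> S" using assms(1,2) open_contains_cball by blast
  obtain \<eta> \<eta>z \<eta>b where \<eta>: "C1w UNIV \<eta> \<eta>z \<eta>b" "C1 UNIV \<eta>z" "C1 UNIV \<eta>b" "\<And>z. dist c z < \<beta>/2 \<Longrightarrow> \<eta> z = 1" "\<And>z. \<beta> < dist c z \<Longrightarrow> \<eta> z = 0"
    by (rule cutoff_exists[of "\<beta>/2" \<beta> c]) (use \<beta>(1) in linarith, use \<beta>(1) in linarith, blast)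
  note m = C1w_cutoff_mult[OF \<eta>(1) q assms(1) \<beta>(2) \<eta>(5)]
  have "C1w (ball c (\<beta>/2)) (cauchy_tr (3*\<beta>) (\<lambda>z. \<eta> z * q z)) (cauchy_tr (3*\<beta>) (\<lambda>z. \<eta>z z * q z + \<eta> z * qz z)) q"
  proof (rule C1w_eq_rhs[OF C1w_subset[OF cauchy_tr_C1w[OF m]]])
    fix z assume z: "z \<in> ball c (\<beta>/2)"
    have "cauchy_tr (3*\<beta>) (\<lambda>z. \<eta>b z * q z + \<eta> z * qb z) z = \<eta> z * q z"
      by (rule cauchy_tr_dbar[OF m, of \<beta> c]) (use \<eta>(5) z \<beta>(1) in auto)
    then show "q z = cauchy_tr (3*\<beta>) (\<lambda>z. \<eta>b z * q z + \<eta> z * qb z) z" using \<eta>(4) z by simp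
  qed auto
  moreover have "ball c (\<beta>/2) \<subseteq> S" using \<beta> by (auto simp: subset_iff)
  ultimately show ?thesis using that[of "\<beta>/2"] \<beta>(1) by simp
qed

lemma dbar_zero_holomorphic:
  assumes "open S" "C1w S f a (\<lambda>z. 0)"
  shows "f holomorphic_on S" "z \<in> S \<Longrightarrow> deriv f z = a z"
proof -
  have *: "(f has_field_derivative a z) (at z)" if "z \<in> S" for z
    using C1wD[OF assms(2) that] by (simp add: has_wirt_field)
  then show "f holomorphic_on S" using assms(1) by (auto simp: holomorphic_on_open)
  show "z \<in> S \<Longrightarrow> deriv f z = a z" using * DERIV_imp_deriv by blast
qed

text \<open>
  A priori \<open>Lz\<close> is only continuous; \<open>q\<close> is the \<open>dbar\<close> derivative of \<open>Lz + G\<close> in the weak sense. With \<open>\<eta>\<close> a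
  cutoff function and \<open>s\<close> the Cauchy transform of \<open>\<eta> b\<close>, the function \<open>L - s\<close> is holomorphic near \<open>c\<close>, and
  \<open>Lz + G\<close> differs from its derivative by the Cauchy transform of the \<open>C\<^sup>1\<close> function \<open>N\<close>.
\<close>

lemma dbar_regularity:
  assumes S: "open S" "c \<in> S" and L: "C1w S L Lz b" and b: "C1w S b bz bb" and G: "C1w S G Gz Gb"
    and q: "C1 S q" and eq: "\<And>z. z \<in> S \<Longrightarrow> bz z + Gb z = q z"
  obtains r wz where "0 < r" "ball c r \<subseteq> S" "C1w (ball c r) (\<lambda>z. Lz z + G z) wz q"
proof -
  obtain qz qb where q: "C1w S q qz qb" using q C1_def by auto
  obtain \<beta> where \<beta>: "0 < \<beta>" "cball c \<beta> \<subseteq> S" using S open_contains_cball by blast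
  obtain \<eta> \<eta>z \<eta>b where \<eta>: "C1w UNIV \<eta> \<eta>z \<eta>b" "C1 UNIV \<eta>z" "C1 UNIV \<eta>b"
    "\<And>z. dist c z < \<beta>/2 \<Longrightarrow> \<eta> z = 1" "\<And>z. \<beta> < dist c z \<Longrightarrow> \<eta> z = 0"
    by (rule cutoff_exists[of "\<beta>/2" \<beta> c]) (use \<beta>(1) in linarith, use \<beta>(1) in linarith, blast)
  obtain \<eta>1 \<eta>2 where \<eta>z: "C1w UNIV \<eta>z \<eta>1 \<eta>2" using \<eta>(2) C1_def by auto
  obtain \<eta>3 \<eta>4 where \<eta>b: "C1w UNIV \<eta>b \<eta>3 \<eta>4" using \<eta>(3) C1_def by auto
  have out: "\<eta>z z = 0" "\<eta>b z = 0" if "\<beta> < dist c z" for z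
    using C1w_zero_outside[OF \<eta>(1) \<eta>(5) that] by auto
  have one: "\<eta>z z = 0" "\<eta>b z = 0" if "dist c z < \<beta>/2" for z
    using C1w_local_one[OF \<eta>(1) \<eta>(4) that] by auto
  note mb = C1w_cutoff_mult[OF \<eta>(1) b S(1) \<beta>(2) \<eta>(5)]
  note mG = C1w_cutoff_mult[OF \<eta>(1) G S(1) \<beta>(2) \<eta>(5)]
  note mq = C1w_cutoff_mult[OF \<eta>(1) q S(1) \<beta>(2) \<eta>(5)]
  note mzb = C1w_cutoff_mult[OF \<eta>z b S(1) \<beta>(2) out(1)]
  note mbG = C1w_cutoff_mult[OF \<eta>b G S(1) \<beta>(2) out(2)]
  let ?C = "cauchy_tr (3*\<beta>)"
  let ?D = "ball c (\<beta>/2)"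
  have DS: "?D \<subseteq> S" using \<beta> by (auto simp: subset_iff)
  define s where "s = ?C (\<lambda>z. \<eta> z * b z)"
  define sz where "sz = ?C (\<lambda>z. \<eta>z z * b z + \<eta> z * bz z)"
  define N where "N z = \<eta>z z * b z + \<eta> z * q z + \<eta>b z * G z" for z
  have dbar: "?C f' z = f z" if "C1w UNIV f f1 f'" "\<And>z. \<beta> < dist c z \<Longrightarrow> f z = 0" "z \<in> ?D" for f f1 f' z
    by (rule cauchy_tr_dbar[OF that(1,2)]) (use that(3) \<beta>(1) in auto)
  have s: "C1w ?D s sz b"
    unfolding s_def sz_def
  proof (rule C1w_eq_rhs[OF C1w_subset[OF cauchy_tr_C1w[OF mb]]])
    fix z assume z: "z \<in> ?D"
    then show "b z = ?C (\<lambda>z. \<eta>b z * b z + \<eta> z * bb z) z"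
      using dbar[OF mb _ z] \<eta>(4,5) by simp
  qed auto
  have "C1w ?D (\<lambda>z. L z - s z) (\<lambda>z. Lz z - sz z) (\<lambda>z. 0)"
    using C1w_diff[OF C1w_subset[OF L DS] s] by simp
  note h = dbar_zero_holomorphic[OF open_ball this]
  obtain Nz Nb where N: "C1w UNIV N Nz Nb"
    using C1w_add[OF C1w_add[OF mzb mq] mbG] unfolding N_def by blast
  have Nout: "N z = 0" if "\<beta> < dist c z" for z
    using that out \<eta>(5) by (simp add: N_def)
  have Lz: "Lz z + G z = deriv (\<lambda>z. L z - s z) z + ?C N z" if z: "z \<in> ?D" for z
  proof -
    have "G z = ?C (\<lambda>z. \<eta>b z * G z + \<eta> z * Gb z) z"
      using dbar[OF mG _ z] \<eta>(4,5) z by simp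
    \<comment> \<open>Separately \<open>bz\<close> and \<open>Gb\<close> are only continuous; their
      sum \<open>q\<close> is C1. The two transforms must therefore be merged before anything is
      differentiated.\<close>
    moreover have "sz z + ?C (\<lambda>z. \<eta>b z * G z + \<eta> z * Gb z) z = ?C N z"
    proof -
      have "(\<lambda>z. \<eta>z z * b z + \<eta> z * bz z + (\<eta>b z * G z + \<eta> z * Gb z)) = N"
      proof
        fix z
        have "\<eta> z * (bz z + Gb z) = \<eta> z * q z"
        proof (cases "z \<in> S")
          case False
          then have "\<beta> < dist c z" using \<beta>(2) by (force simp: subset_iff)
          then show ?thesis using \<eta>(5) by simp
        qed (simp add: eq)
        then show "\<eta>z z * b z + \<eta> z * bz z + (\<eta>b z * G z + \<eta> z * Gb z) = N z"
          by (simp add: N_def algebra_simps)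
      qed
      then show ?thesis
        using cauchy_tr_add[OF C1w_cont_z[OF mb] C1w_cont_zbar[OF mG], of "3 * \<beta>" z] by (simp only: sz_def)
    qed
    ultimately have e: "?C N z = sz z + G z" by (simp only:)
    show ?thesis unfolding e h(2)[OF z] by simp
  qed
  have "C1w ?D (\<lambda>z. deriv (\<lambda>z. L z - s z) z + ?C N z) (\<lambda>z. deriv (deriv (\<lambda>z. L z - s z)) z + ?C Nz z) (\<lambda>z. 0 + ?C Nb z)"
    by (rule C1w_add[OF C1w_holo[OF holomorphic_deriv[OF h(1) open_ball] open_ball] C1w_subset[OF cauchy_tr_C1w[OF N]]]) auto
  then have "C1w ?D (\<lambda>z. Lz z + G z) (\<lambda>z. deriv (deriv (\<lambda>z. L z - s z)) z + ?C Nz z) q"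
  proof (rule C1w_cong)
    fix z assume z: "z \<in> ?D"
    have "?C Nb z = N z" by (rule dbar[OF N Nout z])
    also have "\<dots> = q z" using z one[of z] \<eta>(4) by (simp add: N_def)
    finally show "q z = 0 + ?C Nb z" by simp
  qed (auto simp: Lz)
  then show ?thesis using that[of "\<beta>/2"] DS \<beta>(1) by simp
qed

text \<open>Symmetry of second derivatives by integration: f(x,y) - f(x,0) is the integral of f_y.
  Differentiating in x under the integral sign and then in y at 0 identifies the two mixed
  derivatives. In Wirtinger form their equality reads \<open>a2 = b1\<close>.\<close>

lemma C1w_mixed_derivatives:
  assumes S: "open S" "z \<in> S" and f: "C1w S f a b" and a: "C1w S a a1 a2" and b: "C1w S b b1 b2"
  shows "a2 z = b1 z"
proof -
  \<comment> \<open>The factor 2 makes room for the square |x|, |y| <= e, by the triangle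
    inequality.\<close>
  obtain e where e: "0 < e" "cball z (2*e) \<subseteq> S"
  proof -
    obtain d where "0 < d" "cball z d \<subseteq> S" using S open_contains_cball by blast
    then show ?thesis using that[of "d/2"] by simp
  qed
  define p where "p x y = z + of_real x + \<i> * of_real y" for x y
  have pS: "p x y \<in> S" if "\<bar>x\<bar> \<le> e" "\<bar>y\<bar> \<le> e" for x y
  proof -
    have "dist z (p x y) \<le> \<bar>x\<bar> + \<bar>y\<bar>"
    proof -
      have "z - p x y = - (of_real x + \<i> * of_real y)" by (simp add: p_def)
      then have "dist z (p x y) = norm (of_real x + \<i> * of_real y)" by (simp only: dist_norm norm_minus_cancel)
      then show ?thesis using norm_triangle_ineq[of "of_real x" "\<i> * of_real y"] by (simp add: norm_mult)
    qed
    then show ?thesis using e that by auto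
  qed
  have dx: "((\<lambda>x. g (p x y)) has_vector_derivative (\<alpha> + \<beta>)) (at x within T)"
    if "has_wirt g \<alpha> \<beta> (p x y)" for g \<alpha> \<beta> x y T
  proof -
    have "((\<lambda>x. p x y) has_vector_derivative 1) (at x within T)"
      unfolding p_def has_vector_derivative_def by (auto intro!: derivative_eq_intros simp: scaleR_conv_of_real)
    from has_wirt_path[OF that this] show ?thesis by simp
  qed
  have dy: "((\<lambda>y. g (p x y)) has_vector_derivative (\<i> * (\<alpha> - \<beta>))) (at y within T)"
    if "has_wirt g \<alpha> \<beta> (p x y)" for g \<alpha> \<beta> x y T
  proof -
    have "((\<lambda>y. p x y) has_vector_derivative \<i>) (at y within T)"
      unfolding p_def has_vector_derivative_def by (auto intro!: derivative_eq_intros simp: scaleR_conv_of_real)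
    from has_wirt_path[OF that this] show ?thesis by (simp add: algebra_simps)
  qed
  have cp: "continuous_on (X \<times> Y) (\<lambda>x. g (p (fst x) (snd x)))"
    if "continuous_on S g" "X \<subseteq> {-e..e}" "Y \<subseteq> {-e..e}" for g :: "complex \<Rightarrow> complex" and X Y
    using that(2,3)
    by (intro continuous_on_compose2[OF that(1)]) (force simp: p_def intro!: continuous_intros pS[unfolded p_def])+
  have cp1: "continuous_on Y (\<lambda>y. g (p x y))"
    if "continuous_on S g" "x \<in> {-e..e}" "Y \<subseteq> {-e..e}" for g :: "complex \<Rightarrow> complex" and x Y
    using that(2,3)
    by (intro continuous_on_compose2[OF that(1)]) (force simp: p_def intro!: continuous_intros pS[unfolded p_def])+
  \<comment> \<open>The x-derivative of f_y = \<i> (a - b).\<close>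
  define D where "D w = \<i> * (a1 w + a2 w - (b1 w + b2 w))" for w
  have cD: "continuous_on S D" and cfy: "continuous_on S (\<lambda>w. \<i> * (a w - b w))"
    unfolding D_def
    by (intro continuous_intros C1w_cont_z[OF a] C1w_cont_zbar[OF a] C1w_cont_z[OF b] C1w_cont_zbar[OF b] C1w_cont[OF a] C1w_cont[OF b])+
  have key: "(a (p 0 y) + b (p 0 y)) - (a z + b z) = integral {0..y} (\<lambda>t. D (p 0 t))" if y: "y \<in> {0..e}" for y
  proof -
    have ftc: "f (p x y) - f (p x 0) = integral (cbox 0 y) (\<lambda>t. \<i> * (a (p x t) - b (p x t)))" if "x \<in> {-e..e}" for x
    proof -
      have "((\<lambda>t. \<i> * (a (p x t) - b (p x t))) has_integral (f (p x y) - f (p x 0))) {0..y}"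
        using y that by (intro fundamental_theorem_of_calculus dy C1wD[OF f] pS) auto
      from integral_unique[OF this] show ?thesis by (simp only: cbox_interval)
    qed
    have "((\<lambda>x. integral (cbox 0 y) (\<lambda>t. \<i> * (a (p x t) - b (p x t)))) has_vector_derivative
        integral (cbox 0 y) (\<lambda>t. D (p 0 t))) (at 0 within {-e..e})"
    proof (rule leibniz_rule_vector_derivative)
      fix x t assume xt: "x \<in> {-e..e}" "t \<in> cbox 0 y"
      have s: "p x t \<in> S" using xt y by (intro pS) auto
      have "has_wirt (\<lambda>w. \<i> * (a w - b w)) (\<i> * (a1 (p x t) - b1 (p x t))) (\<i> * (a2 (p x t) - b2 (p x t))) (p x t)"
        using has_wirt_mult[OF has_wirt_const[of "\<i>"] has_wirt_diff[OF C1wD[OF a s] C1wD[OF b s]]] by simp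
      from dx[OF this] show "((\<lambda>x. \<i> * (a (p x t) - b (p x t))) has_vector_derivative D (p x t)) (at x within {-e..e})"
        by (simp add: D_def algebra_simps)
    next
      fix x assume "x \<in> {-e..e}"
      then show "(\<lambda>t. \<i> * (a (p x t) - b (p x t))) integrable_on cbox 0 y"
        using y by (intro integrable_continuous cp1[OF cfy]) auto
    next
      show "continuous_on ({-e..e} \<times> cbox 0 y) (\<lambda>(x, t). D (p x t))"
        using cp[OF cD, of "{-e..e}" "cbox 0 y"] y e(1) by (auto simp: split_beta subset_iff)
    qed (use e(1) in auto)
    moreover have "((\<lambda>x. f (p x y) - f (p x 0)) has_vector_derivative
        ((a (p 0 y) + b (p 0 y)) - (a (p 0 0) + b (p 0 0)))) (at 0 within {-e..e})"
      using y e(1) by (intro has_vector_derivative_diff dx C1wD[OF f] pS) auto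
    then have "((\<lambda>x. integral (cbox 0 y) (\<lambda>t. \<i> * (a (p x t) - b (p x t)))) has_vector_derivative
        ((a (p 0 y) + b (p 0 y)) - (a (p 0 0) + b (p 0 0)))) (at 0 within {-e..e})"
      by (rule has_vector_derivative_transform[rotated 2]) (use e(1) ftc in auto)
    ultimately have "(a (p 0 y) + b (p 0 y)) - (a (p 0 0) + b (p 0 0)) = integral (cbox 0 y) (\<lambda>t. D (p 0 t))"
      using e(1) by (intro vector_derivative_unique_within_closed_interval[of "-e" e 0]) auto
    then show ?thesis by (simp add: p_def)
  qed
  have p00: "p 0 0 = z" by (simp add: p_def)
  have "((\<lambda>y. integral {0..y} (\<lambda>t. D (p 0 t))) has_vector_derivative D (p 0 0)) (at 0 within {0..e})"
    using e(1) by (intro integral_has_vector_derivative cp1[OF cD]) auto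
  then have "((\<lambda>y. (a (p 0 y) + b (p 0 y)) - (a z + b z)) has_vector_derivative D z) (at 0 within {0..e})"
    unfolding p00 by (rule has_vector_derivative_transform[rotated 2]) (use e(1) key in auto)
  moreover have "((\<lambda>y. (a (p 0 y) + b (p 0 y)) - (a z + b z)) has_vector_derivative
      (\<i> * (a1 (p 0 0) - a2 (p 0 0)) + \<i> * (b1 (p 0 0) - b2 (p 0 0))) - 0) (at 0 within {0..e})"
    using e(1) by (intro has_vector_derivative_diff has_vector_derivative_add has_vector_derivative_const dy C1wD[OF a] C1wD[OF b] pS) auto
  ultimately have "D z = \<i> * (a1 z - a2 z) + \<i> * (b1 z - b2 z)"
    unfolding p00 using e(1) by (intro vector_derivative_unique_within_closed_interval[of 0 e 0]) auto
  then have "\<i> * (2 * (a2 z - b1 z)) = 0" unfolding D_def by (simp add: algebra_simps)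
  then show ?thesis by simp
qed

section \<open>Circle means\<close>

lemma C1w_real_deriv_polar:
  fixes u :: "complex \<Rightarrow> real"
  assumes "has_wirt (\<lambda>z. of_real (u z)) w w' (a + of_real r * cis t)"
  shows "((\<lambda>r. u (a + of_real r * cis t)) has_vector_derivative (2 * Re (w * cis t))) (at r within T)"
proof -
  have "((\<lambda>r. complex_of_real (u (a + of_real r * cis t))) has_vector_derivative (w * cis t + w' * cnj (cis t))) (at r within T)"
    by (rule has_wirt_path[OF _ polar_vector_derivative(2)]) (rule assms)
  from bounded_linear.has_vector_derivative[OF bounded_linear_Re this]
  show ?thesis using has_wirt_real_partials(3)[OF assms] by (simp add: complex_add_cnj)
qed

text \<open>
  For the mean \<open>M(r)\<close> the quantity \<open>r M'(r) = 2 Re (N r)\<close> is nondecreasing, and it cannot be negative anywhere, as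
  then \<open>M\<close> would grow logarithmically at \<open>0\<close>. Nothing but continuity is needed at the centre, which is
  essential at the zeros of \<open>h\<^sub>z\<close>.
\<close>

lemma circle_mean_ge:
  fixes u :: "complex \<Rightarrow> real"
  assumes u: "continuous_on (ball a R) u"
    and w: "C1w (ball a R - {a}) (\<lambda>z. of_real (u z)) w w'"
    and wb: "C1w (ball a R - {a}) w wz wb"
    and pos: "\<And>z. z \<in> ball a R - {a} \<Longrightarrow> 0 \<le> Re (wb z)"
    and r: "0 < r" "r < R"
  shows "2 * pi * u a \<le> integral {0..2*pi} (\<lambda>t. u (a + of_real r * cis t))"
proof -
  let ?g = "\<lambda>r t. a + of_real r * cis t"
  let ?A = "ball a R - {a}"
  have g: "?g s t \<in> ?A" if "s \<in> {0<..<R}" for s t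
    using that by (auto simp: dist_norm norm_mult)
  have cg: "continuous_on ({0<..<R} \<times> T) (\<lambda>x. h (?g (fst x) (snd x)))"
    if "continuous_on ?A h" for h :: "complex \<Rightarrow> 'b::topological_space" and T
    by (rule continuous_on_compose2[OF that]) (auto intro!: continuous_intros simp: dist_norm norm_mult)
  have cg1: "continuous_on T (\<lambda>t. h (?g s t))"
    if "continuous_on ?A h" "s \<in> {0<..<R}" for h :: "complex \<Rightarrow> 'b::topological_space" and T s
    by (rule continuous_on_compose2[OF that(1)]) (use g[OF that(2)] in \<open>auto intro!: continuous_intros\<close>)
  note cu = continuous_on_subset[OF u, of ?A, simplified]
  note cw = C1w_cont[OF wb] and cwz = C1w_cont_z[OF wb] and cwb = C1w_cont_zbar[OF wb]
  define M where "M s = integral (cbox 0 (2*pi)) (\<lambda>t. u (?g s t))" for s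
  define N where "N s = integral (cbox 0 (2*pi)) (\<lambda>t. of_real s * w (?g s t) * cis t)" for s
  have M': "(M has_real_derivative (2 * Re (N s) / s)) (at s)" if s: "s \<in> {0<..<R}" for s
  proof -
    have "(M has_vector_derivative integral (cbox 0 (2*pi)) (\<lambda>t. 2 * Re (w (?g s t) * cis t))) (at s within {0<..<R})"
      unfolding M_def
    proof (rule leibniz_rule_vector_derivative)
      show "((\<lambda>x. u (?g x t)) has_vector_derivative 2 * Re (w (?g x t) * cis t)) (at x within {0<..<R})"
        if "x \<in> {0<..<R}" for x t
        by (rule C1w_real_deriv_polar[OF C1wD[OF w g[OF that]]])
      show "(\<lambda>t. u (?g x t)) integrable_on cbox 0 (2*pi)" if "x \<in> {0<..<R}" for x
        by (rule integrable_continuous[OF cg1[OF cu that]])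
      show "continuous_on ({0<..<R} \<times> cbox 0 (2*pi)) (\<lambda>(x, t). 2 * Re (w (?g x t) * cis t))"
        unfolding split_beta by (intro continuous_intros cg cw)
    qed (use s in auto)
    moreover have "integral (cbox 0 (2*pi)) (\<lambda>t. 2 * Re (w (?g s t) * cis t)) = 2 * Re (N s) / s"
    proof -
      have i: "(\<lambda>t. w (?g s t) * cis t) integrable_on cbox 0 (2*pi)"
        by (intro integrable_continuous continuous_intros cg1[OF cw s])
      have "integral (cbox 0 (2*pi)) (\<lambda>t. 2 * Re (w (?g s t) * cis t)) = 2 * Re (integral (cbox 0 (2*pi)) (\<lambda>t. w (?g s t) * cis t))"
        using integral_linear[OF i bounded_linear_Re] by (simp only: o_def integral_mult_right)
      moreover have "N s = of_real s * integral (cbox 0 (2*pi)) (\<lambda>t. w (?g s t) * cis t)"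
        unfolding N_def mult.assoc by simp
      ultimately show ?thesis using s by simp
    qed
    ultimately show ?thesis
      using s at_within_open[of s "{0<..<R}"] by (simp add: has_real_derivative_iff_has_vector_derivative)
  qed
  have N': "\<exists>y. ((\<lambda>s. Re (N s)) has_real_derivative y) (at s) \<and> 0 \<le> y" if s: "s \<in> {0<..<R}" for s
  proof -
    define K where "K t = of_real s * (wz (?g s t) * cis t + wb (?g s t) * cis (- t)) * cis t + w (?g s t) * cis t" for t
    have "(N has_vector_derivative integral (cbox 0 (2*pi)) K) (at s within {0<..<R})"
      unfolding N_def K_def
    proof (rule leibniz_rule_vector_derivative)
      fix x t assume x: "x \<in> {0<..<R}"
      have "((\<lambda>x. w (?g x t)) has_vector_derivative (wz (?g x t) * cis t + wb (?g x t) * cnj (cis t))) (at x within {0<..<R})"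
        by (rule has_wirt_path[OF C1wD[OF wb g[OF x]] polar_vector_derivative(2)])
      have "(complex_of_real has_vector_derivative 1) (at x within {0<..<R})"
        unfolding has_vector_derivative_def by (auto intro!: derivative_eq_intros simp: scaleR_conv_of_real)
      from has_vector_derivative_mult[OF this \<open>((\<lambda>x. w (?g x t)) has_vector_derivative _) _\<close>]
      have "((\<lambda>x. of_real x * w (?g x t)) has_vector_derivative
          (of_real x * (wz (?g x t) * cis t + wb (?g x t) * cis (- t)) + w (?g x t))) (at x within {0<..<R})"
        by (simp add: cis_cnj)
      from has_vector_derivative_mult_left[OF this, of "cis t"]
      show "((\<lambda>x. of_real x * w (?g x t) * cis t) has_vector_derivative
          (of_real x * (wz (?g x t) * cis t + wb (?g x t) * cis (- t)) * cis t + w (?g x t) * cis t)) (at x within {0<..<R})"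
        by (simp add: algebra_simps)
    next
      show "(\<lambda>t. of_real x * w (?g x t) * cis t) integrable_on cbox 0 (2*pi)" if "x \<in> {0<..<R}" for x
        by (intro integrable_continuous continuous_intros cg1[OF cw that])
      show "continuous_on ({0<..<R} \<times> cbox 0 (2*pi))
          (\<lambda>(x, t). of_real x * (wz (?g x t) * cis t + wb (?g x t) * cis (- t)) * cis t + w (?g x t) * cis t)"
        unfolding split_beta by (intro continuous_intros cg cw cwz cwb)
    qed (use s in auto)
    then have d: "((\<lambda>s. Re (N s)) has_real_derivative Re (integral (cbox 0 (2*pi)) K)) (at s)"
      using bounded_linear.has_vector_derivative[OF bounded_linear_Re] s at_within_open[of s "{0<..<R}"]
      by (simp add: has_real_derivative_iff_has_vector_derivative)
    \<comment> \<open>The angular derivative of \<open>w cis t\<close> integrates to zero over a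
      full turn. It accounts for all of \<open>K\<close> except 2 s \<open>wb\<close>, so the
      derivative of \<open>N\<close> is the integral of 2 s \<open>wb\<close>.\<close>
    have "((\<lambda>t. (wz (?g s t) * (of_real s * (\<i> * cis t)) + wb (?g s t) * cnj (of_real s * (\<i> * cis t))) * cis t + w (?g s t) * (\<i> * cis t))
        has_integral (w (?g s (2*pi)) * cis (2*pi) - w (?g s 0) * cis 0)) {0..2*pi}"
      by (intro fundamental_theorem_of_calculus has_vector_derivative_eq_rhs[OF has_vector_derivative_mult[OF
          has_wirt_path[OF C1wD[OF wb g[OF s]] polar_vector_derivative(1)] cis_vector_derivative]]) (auto simp: algebra_simps)
    moreover have "(\<lambda>t. (wz (?g s t) * (of_real s * (\<i> * cis t)) + wb (?g s t) * cnj (of_real s * (\<i> * cis t))) * cis t + w (?g s t) * (\<i> * cis t))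
        = (\<lambda>t. \<i> * (K t - 2 * of_real s * wb (?g s t)))"
    proof
      fix t
      have c: "cis (- t) * cis t = 1" by (simp add: cis_mult)
      have "\<i> * (K t - 2 * of_real s * wb (?g s t)) =
        \<i> * (of_real s * wz (?g s t) * cis t * cis t + of_real s * wb (?g s t) * (cis (- t) * cis t) + w (?g s t) * cis t - 2 * of_real s * wb (?g s t))"
        by (simp add: K_def algebra_simps)
      also have "\<dots> = \<i> * (of_real s * wz (?g s t) * cis t * cis t - of_real s * wb (?g s t) * (cis (- t) * cis t) + w (?g s t) * cis t)"
        unfolding c by (simp add: algebra_simps)
      also have "\<dots> = (wz (?g s t) * (of_real s * (\<i> * cis t)) + wb (?g s t) * cnj (of_real s * (\<i> * cis t))) * cis t + w (?g s t) * (\<i> * cis t)"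
        by (simp add: cis_cnj algebra_simps)
      finally show "(wz (?g s t) * (of_real s * (\<i> * cis t)) + wb (?g s t) * cnj (of_real s * (\<i> * cis t))) * cis t + w (?g s t) * (\<i> * cis t)
        = \<i> * (K t - 2 * of_real s * wb (?g s t))" by simp
    qed
    ultimately have "((\<lambda>t. \<i> * (K t - 2 * of_real s * wb (?g s t))) has_integral 0) {0..2*pi}" by simp
    from has_integral_mult_right[OF this, of "-\<i>"]
    have h0: "((\<lambda>t. K t - 2 * of_real s * wb (?g s t)) has_integral 0) {0..2*pi}"
      by (simp add: mult.assoc[symmetric])
    have iw: "(\<lambda>t. 2 * of_real s * wb (?g s t)) integrable_on {0..2*pi}"
      by (intro integrable_continuous_interval continuous_intros cg1[OF cwb s])
    have "(K has_integral (integral {0..2*pi} (\<lambda>t. 2 * of_real s * wb (?g s t)))) {0..2*pi}"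
      using has_integral_add[OF h0 integrable_integral[OF iw]] by simp
    then have "Re (integral (cbox 0 (2*pi)) K) = integral {0..2*pi} (\<lambda>t. Re (2 * of_real s * wb (?g s t)))"
      using integral_linear[OF iw bounded_linear_Re] by (simp only: cbox_interval o_def integral_unique)
    also have "\<dots> \<ge> 0"
      using pos[OF g[OF s]] s integrable_linear[OF iw bounded_linear_Re]
      by (intro Henstock_Kurzweil_Integration.integral_nonneg) (auto simp: o_def mult_nonneg_nonneg)
    finally show ?thesis using d by blast
  qed
  have Nmono: "Re (N s) \<le> Re (N s')" if "0 < s" "s \<le> s'" "s' < R" for s s'
    by (rule DERIV_nonneg_imp_nondecreasing[OF that(2)]) (use N' that in auto)
  have Npos: "0 \<le> Re (N s)" if s: "s \<in> {0<..<R}" for s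
  proof (rule ccontr)
    assume "\<not> 0 \<le> Re (N s)"
    define n where "n = - 2 * Re (N s)"
    then have n: "n > 0" using \<open>\<not> 0 \<le> Re (N s)\<close> by simp
    have "compact (u ` cball a s)"
      using s by (intro compact_continuous_image continuous_on_subset[OF u]) auto
    then have "bounded (u ` cball a s)" by (rule compact_imp_bounded)
    then obtain B where "\<forall>z\<in>cball a s. \<bar>u z\<bar> \<le> B"
      unfolding bounded_iff by auto
    then have B: "\<And>z. z \<in> cball a s \<Longrightarrow> \<bar>u z\<bar> \<le> B" by blast
    have MB: "M x \<le> 2 * pi * B" if "x \<in> {0<..s}" for x
    proof -
      have "x \<in> {0<..<R}" using that s by auto
      then have "M x \<le> integral (cbox 0 (2*pi)) (\<lambda>t. B)"
        unfolding M_def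
        using that by (intro integral_le integrable_continuous cg1[OF cu]) (auto intro!: order_trans[OF abs_ge_self B] simp: dist_norm norm_mult)
      then show ?thesis by simp
    qed
    \<comment> \<open>By monotonicity x M'(x) <= - n for all x up to \<open>s\<close>, so M + n ln
      decreases and \<open>M\<close> would have to blow up at 0.\<close>
    have low: "M s + n * ln s \<le> M x + n * ln x" if "x \<in> {0<..s}" for x
    proof (rule DERIV_nonpos_imp_nonincreasing[of x s "\<lambda>x. M x + n * ln x"])
      show "x \<le> s" using that by simp
      fix y assume y: "x \<le> y" "y \<le> s"
      have yR: "y \<in> {0<..<R}" using y that s by auto
      have "((\<lambda>x. M x + n * ln x) has_real_derivative (2 * Re (N y) / y + n * (1 / y))) (at y)"
        using yR by (intro DERIV_add M' DERIV_cmult DERIV_ln_divide) auto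
      moreover have "2 * Re (N y) / y + n * (1 / y) \<le> 0"
      proof -
        have "2 * Re (N y) + n \<le> 0" using Nmono[of y s] y yR s by (simp add: n_def)
        then have "(2 * Re (N y) + n) / y \<le> 0" using yR by (intro divide_nonpos_pos) auto
        then show ?thesis by (simp add: add_divide_distrib)
      qed
      ultimately show "\<exists>d. ((\<lambda>x. M x + n * ln x) has_real_derivative d) (at y) \<and> d \<le> 0" by blast
    qed
    \<comment> \<open>exp (- K) is the radius of contradiction: the first entry keeps it at most
      \<open>s\<close>, the second lifts n K above the bound that continuity of \<open>u\<close>
      allows.\<close>
    define K where "K = max (- ln s) ((2 * pi * B - (M s + n * ln s)) / n + 1)"
    have "exp (- K) \<in> {0<..s}"
    proof -
      have "- K \<le> ln s" by (simp add: K_def)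
      then show ?thesis using s by (metis exp_gt_zero exp_le_cancel_iff exp_ln greaterThanAtMost_iff greaterThanLessThan_iff)
    qed
    from low[OF this] MB[OF this] have "n * K \<le> 2 * pi * B - (M s + n * ln s)" by (simp add: algebra_simps)
    then have "K \<le> (2 * pi * B - (M s + n * ln s)) / n" using n by (simp add: field_simps)
    moreover have "(2 * pi * B - (M s + n * ln s)) / n + 1 \<le> K" by (simp add: K_def)
    ultimately show False by linarith
  qed
  have Mmono: "M s \<le> M r" if "0 < s" "s \<le> r" for s
  proof (rule DERIV_nonneg_imp_nondecreasing[OF that(2)])
    fix x assume "s \<le> x" "x \<le> r"
    then have "x \<in> {0<..<R}" using that r by auto
    from M'[OF this] Npos[OF this] this show "\<exists>y. (M has_real_derivative y) (at x) \<and> 0 \<le> y"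
      by (intro exI[of _ "2 * Re (N x) / x"]) auto
  qed
  \<comment> \<open>Continuity at the centre makes the mean over a small circle nearly u a, and
    monotonicity of \<open>M\<close> carries this out to \<open>r\<close>.\<close>
  have "2 * pi * u a \<le> M r + e" if e: "0 < e" for e
  proof -
    have "continuous (at a within ball a R) u" using u r by (simp add: continuous_on_eq_continuous_within)
    moreover have "0 < e / (2*pi)" using e by simp
    ultimately obtain d where d: "0 < d" "\<And>z. z \<in> ball a R \<Longrightarrow> dist z a < d \<Longrightarrow> dist (u z) (u a) < e / (2*pi)"
      unfolding continuous_within_eps_delta by metis
    define s where "s = min r (d/2)"
    have s: "0 < s" "s \<le> r" "s < d" using d(1) r by (auto simp: s_def)
    have sR: "s \<in> {0<..<R}" using s r by auto
    have lb: "u a - e / (2*pi) \<le> u (?g s t)" for t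
    proof -
      have "dist (u (?g s t)) (u a) < e / (2*pi)"
        using s g[OF sR, of t] by (intro d(2)) (auto simp: dist_norm norm_mult)
      then show ?thesis unfolding dist_real_def by linarith
    qed
    have "integral (cbox 0 (2*pi)) (\<lambda>t. u a - e / (2*pi)) \<le> M s"
      unfolding M_def by (intro integral_le integrable_continuous cg1[OF cu sR] lb) auto
    then have "2 * pi * u a - e \<le> M s" by (simp add: algebra_simps)
    then show ?thesis using Mmono[OF s(1,2)] by linarith
  qed
  then have "2 * pi * u a \<le> M r" by (rule field_le_epsilon)
  then show ?thesis by (simp add: M_def)
qed

section \<open>Winding numbers and degenerate maps\<close>

text \<open>The contour integrand is constant. Negative \<open>k\<close> is included because the
  loop with k = -1 models an orientation-reversing linear map.\<close>

lemma winding_number_exp_loop: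
  assumes "c \<noteq> 0"
  shows "winding_number (\<lambda>t. w0 + c * exp (of_real (2 * pi * of_int k * t) * \<i>)) w0 = of_int k"
proof -
  let ?g = "\<lambda>t. w0 + c * exp (of_real (2 * pi * of_int k * t) * \<i>)"
  let ?d = "\<lambda>t. c * (of_real (2 * pi * of_int k) * \<i> * exp (of_real (2 * pi * of_int k * t) * \<i>))"
  have d: "(?g has_vector_derivative ?d t) (at t within T)" for t T
  proof -
    have "((\<lambda>t. exp (of_real t * (of_real (2 * pi * of_int k) * \<i>))) has_vector_derivative
        (of_real (2 * pi * of_int k) * \<i> * exp (of_real t * (of_real (2 * pi * of_int k) * \<i>)))) (at t within T)"
      by (rule has_vector_derivative_real_field) (auto intro!: derivative_eq_intros)
    moreover have "of_real t * (of_real (2 * pi * of_int k) * \<i>) = of_real (2 * pi * of_int k * t) * \<i>" for t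
      by simp
    ultimately have "((\<lambda>t. exp (of_real (2 * pi * of_int k * t) * \<i>)) has_vector_derivative
        (of_real (2 * pi * of_int k) * \<i> * exp (of_real (2 * pi * of_int k * t) * \<i>))) (at t within T)"
      by (simp only:)
    from has_vector_derivative_add[OF has_vector_derivative_const has_vector_derivative_mult_right[OF this]]
    show ?thesis by (simp only: add_0_left)
  qed
  have "?g C1_differentiable_on {0..1}"
    unfolding C1_differentiable_on_def
    using d by (intro exI[of _ ?d]) (auto intro!: continuous_intros)
  then have v: "valid_path ?g"
    by (simp add: valid_path_def C1_differentiable_imp_piecewise)
  have nin: "w0 \<notin> path_image ?g" using assms by (auto simp: path_image_def)
  have h: "((\<lambda>t. K) has_integral K) {0..1::real}" for K :: complex
    using has_integral_const_real[of K 0 1] by simp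
  have "((\<lambda>w. 1 / (w - w0)) has_contour_integral (of_real (2 * pi * of_int k) * \<i>)) ?g"
    unfolding has_contour_integral_def
  proof (rule has_integral_eq[OF _ h])
    fix t :: real assume "t \<in> {0..1}"
    then have "vector_derivative ?g (at t within {0..1}) = ?d t"
      by (intro vector_derivative_within_cbox[of 0 1 t, unfolded cbox_interval, OF _ _ d]) auto
    then show "of_real (2 * pi * of_int k) * \<i> = 1 / (?g t - w0) * vector_derivative ?g (at t within {0..1})"
      using assms by simp
  qed
  then have "contour_integral ?g (\<lambda>w. 1 / (w - w0)) = of_real (2 * pi * of_int k) * \<i>"
    by (rule contour_integral_unique)
  then show ?thesis using winding_number_valid_path[OF v nin] by simp
qed

text \<open>Rouche's principle for a merely continuous map: on the circle the error is smaller than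
  the distance of the model loop from its centre.\<close>

lemma winding_number_near_power:
  fixes H :: "complex \<Rightarrow> complex"
  assumes "continuous_on (cball a r) H" "0 < r"
    and near: "\<And>\<zeta>. cmod \<zeta> = r \<Longrightarrow> cmod (H (a + \<zeta>) - H a - c * \<zeta> ^ n) < cmod c * r ^ n"
  shows "winding_number (H \<circ> circlepath a r) (H a) = of_nat n"
proof -
  let ?g = "\<lambda>t. H a + (c * of_real r ^ n) * exp (of_real (2 * pi * of_int (int n) * t) * \<i>)"
  let ?h = "H \<circ> circlepath a r"
  have c: "c \<noteq> 0" using near[of "of_real r"] assms(2) by auto
  have "winding_number ?h (H a) = winding_number ?g (H a)"
  proof (rule winding_number_nearby_loops_eq)
    show "path ?g" unfolding path_def by (intro continuous_intros)
    show "path ?h" 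
      by (rule path_continuous_image[OF path_circlepath continuous_on_subset[OF assms(1)]]) (use assms(2) in \<open>auto simp: path_image_circlepath\<close>)
    show "pathfinish ?g = pathstart ?g"
      by (simp add: pathfinish_def pathstart_def exp_eq_1 mult.commute)
    show "pathfinish ?h = pathstart ?h" by (simp add: pathfinish_compose pathstart_compose)
    fix t :: real assume "t \<in> {0..1}"
    define \<zeta> where "\<zeta> = of_real r * exp (2 * of_real pi * \<i> * of_real t)"
    have \<zeta>: "cmod \<zeta> = r" using assms(2) by (simp add: \<zeta>_def norm_mult)
    have "\<zeta> ^ n = of_real r ^ n * exp (of_real (2 * pi * of_int (int n) * t) * \<i>)"
      unfolding \<zeta>_def power_mult_distrib exp_of_nat_mult[symmetric] by (simp add: mult_ac)
    then have g: "?g t = H a + c * \<zeta> ^ n" by simp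
    have h: "?h t = H (a + \<zeta>)" by (simp add: circlepath \<zeta>_def)
    show "norm (?h t - ?g t) < norm (?g t - H a)"
      unfolding g h using near[OF \<zeta>] \<zeta> by (simp add: norm_mult norm_power diff_diff_eq)
  qed
  also have "\<dots> = of_int (int n)" by (rule winding_number_exp_loop) (use c assms(2) in simp)
  finally show ?thesis by simp
qed

text \<open>The same comparison with the model loop run backwards, for points at which the
  antilinear part of the differential dominates.\<close>

lemma winding_number_near_cnj:
  fixes H :: "complex \<Rightarrow> complex"
  assumes "continuous_on (cball a r) H" "0 < r"
    and near: "\<And>\<zeta>. cmod \<zeta> = r \<Longrightarrow> cmod (H (a + \<zeta>) - H a - c * cnj \<zeta>) < cmod c * r"
  shows "winding_number (H \<circ> circlepath a r) (H a) = - 1"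
proof -
  let ?g = "\<lambda>t. H a + (c * of_real r) * exp (of_real (2 * pi * of_int (- 1) * t) * \<i>)"
  let ?h = "H \<circ> circlepath a r"
  have c: "c \<noteq> 0" using near[of "of_real r"] assms(2) by auto
  have "winding_number ?h (H a) = winding_number ?g (H a)"
  proof (rule winding_number_nearby_loops_eq)
    show "path ?g" unfolding path_def by (intro continuous_intros)
    show "path ?h" 
      by (rule path_continuous_image[OF path_circlepath continuous_on_subset[OF assms(1)]]) (use assms(2) in \<open>auto simp: path_image_circlepath\<close>)
    show "pathfinish ?g = pathstart ?g"
      by (simp add: pathfinish_def pathstart_def exp_minus mult.commute)
    show "pathfinish ?h = pathstart ?h" by (simp add: pathfinish_compose pathstart_compose)
    fix t :: real assume "t \<in> {0..1}"
    define \<zeta> where "\<zeta> = of_real r * exp (2 * of_real pi * \<i> * of_real t)"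
    have \<zeta>: "cmod \<zeta> = r" using assms(2) by (simp add: \<zeta>_def norm_mult)
    have "cnj \<zeta> = of_real r * exp (of_real (2 * pi * of_int (- 1) * t) * \<i>)"
      unfolding \<zeta>_def by (simp add: exp_cnj mult_ac)
    then have g: "?g t = H a + c * cnj \<zeta>" by simp
    have h: "?h t = H (a + \<zeta>)" by (simp add: circlepath \<zeta>_def)
    show "norm (?h t - ?g t) < norm (?g t - H a)"
      unfolding g h using near[OF \<zeta>] \<zeta> by (simp add: norm_mult diff_diff_eq)
  qed
  also have "\<dots> = of_int (- 1)" by (rule winding_number_exp_loop) (use c assms(2) in simp)
  finally show ?thesis by simp
qed

text \<open>If |P| = |Q| throughout, the differential is singular and Sard's theorem makes the image
  a null set, whereas invariance of domain makes it open and nonempty.\<close>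

lemma injective_jacobian_nonzero:
  assumes S: "open S" "S \<noteq> {}" and inj: "inj_on H S"
    and H: "\<And>z. z \<in> S \<Longrightarrow> has_wirt H (P z) (Q z) z"
  shows "\<exists>z\<in>S. cmod (P z) \<noteq> cmod (Q z)"
proof (rule ccontr)
  assume "\<not> ?thesis"
  then have eq: "\<And>z. z \<in> S \<Longrightarrow> cmod (P z) = cmod (Q z)" by auto
  \<comment> \<open>Sard's theorem is phrased by ranks of matrices, so the map is conjugated to
    \<open>real^2\<close>.\<close>
  define T :: "complex \<Rightarrow> real^2" where "T z = vector [Re z, Im z]" for z
  define T' :: "real^2 \<Rightarrow> complex" where "T' v = Complex (v $ 1) (v $ 2)" for v
  have TT': "T (T' v) = v" for v by (simp add: T_def T'_def vec_eq_iff forall_2)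
  have T'T: "T' (T z) = z" for z by (simp add: T_def T'_def)
  have lT: "linear T"
    by (rule linearI) (simp_all add: T_def vec_eq_iff forall_2)
  have lT': "linear T'"
    by (rule linearI) (simp_all add: T'_def complex_eq_iff)
  have bT: "bounded_linear T" and bT': "bounded_linear T'"
    using lT lT' linear_conv_bounded_linear by blast+
  define f where "f v = T (H (T' v))" for v
  have "negligible (f ` (T ` S))"
  proof (rule baby_Sard)
    fix v assume "v \<in> T ` S"
    then have v: "T' v \<in> S" using T'T by auto
    let ?D = "\<lambda>d. P (T' v) * d + Q (T' v) * cnj d"
    have "(T' has_derivative T') (at v within T ` S)" using bT' by (rule bounded_linear_imp_has_derivative)
    moreover have "(H has_derivative ?D) (at (T' v))" using H[OF v] by (simp add: has_wirt_def)
    moreover have "(T has_derivative T) (at (H (T' v)))" using bT by (rule bounded_linear_imp_has_derivative)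
    ultimately have "((\<lambda>v. T (H (T' v))) has_derivative (\<lambda>d. T (?D (T' d)))) (at v within T ` S)"
      by (intro has_derivative_compose[OF has_derivative_compose[of T' T' v _ H]])
    then show "(f has_derivative (\<lambda>d. T (?D (T' d)))) (at v within T ` S)"
      by (simp add: f_def[abs_def])
    then have lin: "linear (\<lambda>d. T (?D (T' d)))" using has_derivative_linear by blast
    obtain d where d: "d \<noteq> 0" "?D d = 0"
    proof (cases "P (T' v) = 0")
      case True
      then have "Q (T' v) = 0" using eq[OF v] by simp
      then show ?thesis using that[of 1] True by simp
    next
      case False
      \<comment> \<open>A unit vector satisfies cnj d = 1 / d, so a kernel vector of P d + Q cnj d
        is a square root of - Q / P, which has modulus 1.\<close>
      define d where "d = csqrt (- Q (T' v) / P (T' v))"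
      have "Q (T' v) \<noteq> 0" using eq[OF v] False by (metis norm_eq_zero)
      then have "cmod (d\<^sup>2) = 1" using eq[OF v] by (simp add: d_def norm_divide)
      then have nd: "cmod d = 1" using norm_ge_zero[of d] by (auto simp: norm_power power2_eq_1_iff)
      then have "d * cnj d = 1" by (simp add: complex_norm_square[symmetric])
      have "P (T' v) * d\<^sup>2 + Q (T' v) = 0" using False by (simp add: d_def)
      then have "cnj d * (P (T' v) * d\<^sup>2 + Q (T' v)) = 0" by simp
      then have "P (T' v) * d * (d * cnj d) + Q (T' v) * cnj d = 0" by (simp add: algebra_simps power2_eq_square)
      then have "?D d = 0" by (simp add: \<open>d * cnj d = 1\<close>)
      moreover have "d \<noteq> 0" using nd by auto
      ultimately show ?thesis using that by blast
    qed
    have "\<not> inj (\<lambda>d. T (?D (T' d)))"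
    proof
      assume "inj (\<lambda>d. T (?D (T' d)))"
      moreover have "T (?D (T' (T d))) = T (?D (T' 0))"
        using d(2) by (simp add: T'T linear_0[OF lT'] linear_0[OF lT])
      ultimately have "T d = 0" by (rule injD)
      then show False using d(1) T'T[of d] linear_0[OF lT'] by simp
    qed
    then show "rank (matrix (\<lambda>d. T (?D (T' d)))) < CARD(2)"
      using less_rank_noninjective[of "matrix (\<lambda>d. T (?D (T' d)))"] matrix_vector_mul(2)[OF lin] by simp
  qed simp
  moreover have "f ` (T ` S) = T' -` (H ` S)"
    unfolding f_def using T'T TT' by (auto simp: image_image) (metis imageI)
  moreover have "open (H ` S)"
    using S(1) inj H by (intro invariance_of_domain) (auto intro!: continuous_at_imp_continuous_on has_wirt_imp_isCont)
  then have "open (T' -` (H ` S))"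
    using bT' by (intro continuous_open_vimage) (auto intro: linear_continuous_at)
  moreover have "T' -` (H ` S) \<noteq> {}" using S(2) T'T by (metis empty_iff ex_in_conv imageI vimageI2)
  ultimately show False using open_not_negligible by metis
qed

section \<open>Harmonic maps in a conformal parameter\<close>

lemma C1w_wirt: "C1w S f a b \<Longrightarrow> C1w S f (wirt_z f) (wirt_zbar f)"
  using C1w_eq_rhs[of S f a b "wirt_z f" "wirt_zbar f"] has_wirt_imp(3,4)[OF C1wD[of S f a b]] by blast

lemma C1_D: "C1 S f \<Longrightarrow> C1w S f (wirt_z f) (wirt_zbar f)"
  unfolding C1_def by (blast intro: C1w_wirt)

lemma C1_cong: "C1 S f \<Longrightarrow> open S \<Longrightarrow> (\<And>z. z \<in> S \<Longrightarrow> g z = f z) \<Longrightarrow> C1 S g"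
  unfolding C1_def by (blast intro: C1w_cong)

definition C2 :: "complex set \<Rightarrow> (complex \<Rightarrow> complex) \<Rightarrow> bool" where
  "C2 S f \<longleftrightarrow> (\<exists>a b. C1w S f a b \<and> C1 S a \<and> C1 S b)"

lemma C2_const: "C2 S (\<lambda>z. c)"
  unfolding C2_def using C1w_const C1_const by blast

lemma C2_diff: "C2 S f \<Longrightarrow> C2 S h \<Longrightarrow> C2 S (\<lambda>z. f z - h z)"
  unfolding C2_def by (blast intro: C1w_diff C1_diff)

lemma C2_mult: "C2 S f \<Longrightarrow> C2 S h \<Longrightarrow> C2 S (\<lambda>z. f z * h z)"
proof -
  assume "C2 S f" "C2 S h"
  then obtain a b c d where f: "C1w S f a b" "C1 S a" "C1 S b" and h: "C1w S h c d" "C1 S c" "C1 S d"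
    unfolding C2_def by blast
  have "C1 S (\<lambda>z. a z * h z + f z * c z)" "C1 S (\<lambda>z. b z * h z + f z * d z)"
    by (intro C1_add C1_mult f h C1I[OF f(1)] C1I[OF h(1)])+
  then show ?thesis unfolding C2_def using C1w_mult[OF f(1) h(1)] by blast
qed

lemma mult_cnj_norm: "z * cnj z = (complex_of_real (cmod z))\<^sup>2"
  using complex_norm_square[of z] by simp

lemma C1w_of_real_Ck:
  fixes u :: "complex \<Rightarrow> real"
  assumes "Ck_on (Suc 0) S u"
  shows "C1w S (\<lambda>z. of_real (u z)) (\<lambda>z. (of_real (partial_x u z) - \<i> * of_real (partial_y u z)) / 2)
     (\<lambda>z. (of_real (partial_x u z) + \<i> * of_real (partial_y u z)) / 2)"
proof -
  have "continuous_on S (partial_x u)" "continuous_on S (partial_y u)"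
    using assms by auto
  then show ?thesis
    using assms by (auto simp: C1w_def intro!: has_wirt_of_real_partials continuous_intros)
qed

text \<open>Three derivatives of \<rho> are spent: one on \<open>g\<close>, one on the curvature
  term \<open>wirt_zbar g\<close>, and one on making that term C1, which the regularity argument for
  \<open>\<omega>\<close> relies on.\<close>

lemma metric_log_C1w:
  assumes "open \<Omega>" "smooth_plane_metric \<Omega> \<rho>"
  defines "g \<equiv> wirt_z (\<lambda>w. of_real (ln ((\<rho> w)\<^sup>2)))"
  shows "C1w \<Omega> (\<lambda>w. of_real (ln ((\<rho> w)\<^sup>2))) g (\<lambda>w. cnj (g w))"
    and "C1w \<Omega> g (wirt_z g) (wirt_zbar g)"
    and "C1 \<Omega> (wirt_zbar g)"
    and "w \<in> \<Omega> \<Longrightarrow> laplacian (\<lambda>v. ln (\<rho> v)) w = 2 * Re (wirt_zbar g w)"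
proof -
  have pos: "\<And>w. w \<in> \<Omega> \<Longrightarrow> 0 < \<rho> w" and k3: "Ck_on (Suc (Suc (Suc 0))) \<Omega> \<rho>"
    using assms(2) by (auto simp: smooth_plane_metric_def smooth_on_def)
  have k2: "Ck_on (Suc (Suc 0)) \<Omega> (partial_x \<rho>)" "Ck_on (Suc (Suc 0)) \<Omega> (partial_y \<rho>)"
    using k3 unfolding Ck_on.simps(2)[of "Suc (Suc 0)"] by auto
  have k1: "Ck_on (Suc 0) \<Omega> (partial_x (partial_x \<rho>))" "Ck_on (Suc 0) \<Omega> (partial_y (partial_x \<rho>))"
    "Ck_on (Suc 0) \<Omega> (partial_x (partial_y \<rho>))" "Ck_on (Suc 0) \<Omega> (partial_y (partial_y \<rho>))"
    using k2 unfolding Ck_on.simps(2)[of "Suc 0"] by auto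
  note d2 = k2[THEN Ck_on_Suc_imp]
  have C1real: "C1 \<Omega> (\<lambda>z. of_real (u z))" if "Ck_on (Suc 0) \<Omega> u" for u
    using C1w_of_real_Ck[OF that] C1_def by blast
  define rz where "rz = (\<lambda>z. (of_real (partial_x \<rho> z) - \<i> * of_real (partial_y \<rho> z)) / (2::complex))"
  define rb where "rb = (\<lambda>z. (of_real (partial_x \<rho> z) + \<i> * of_real (partial_y \<rho> z)) / (2::complex))"
  have R: "C1w \<Omega> (\<lambda>w. of_real (\<rho> w)) rz rb"
    unfolding rz_def rb_def using C1w_of_real_Ck[OF Ck_on_Suc_imp[OF Ck_on_Suc_imp[OF k3]]] .
  have crz: "C1 \<Omega> rz" and crb: "C1 \<Omega> rb"
    unfolding rz_def rb_def by (intro C1_intros C1real d2; simp)+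
  have C2real: "C2 \<Omega> (\<lambda>z. of_real (u z))"
    if "Ck_on (Suc 0) \<Omega> u" "Ck_on (Suc 0) \<Omega> (partial_x u)" "Ck_on (Suc 0) \<Omega> (partial_y u)" for u
    unfolding C2_def using C1w_of_real_Ck[OF that(1)]
    by (intro exI conjI, assumption) (intro C1_intros C1real that; simp)+
  have "C2 \<Omega> rz"
    unfolding rz_def divide_inverse by (intro C2_mult C2_diff C2_const C2real d2 k1)
  then obtain rzb where rz: "C1w \<Omega> rz (wirt_z rz) rzb" "C1 \<Omega> rzb"
    unfolding C2_def by (metis (no_types, lifting) C1_cong C1wD C1w_wirt assms(1) has_wirt_imp(4))
  have nz: "complex_of_real (\<rho> w) \<noteq> 0" if "w \<in> \<Omega>" for w using pos[OF that] by simp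
  have dln: "continuous_on (\<rho> ` \<Omega>) (\<lambda>x. 1 / x)"
    using pos by (intro continuous_intros) (metis imageE less_irrefl)
  have lnr: "C1w \<Omega> (\<lambda>w. of_real (ln (\<rho> w))) (\<lambda>w. rz w / of_real (\<rho> w)) (\<lambda>w. rb w / of_real (\<rho> w))"
    using C1w_real_compose[OF R, of ln "\<lambda>x. 1 / x", OF _ dln] pos
    by (simp add: DERIV_ln_divide)
  have "C1w \<Omega> (\<lambda>w. of_real (ln ((\<rho> w)\<^sup>2))) (\<lambda>w. 2 * (rz w / of_real (\<rho> w))) (\<lambda>w. 2 * (rb w / of_real (\<rho> w)))"
    by (rule C1w_cong[OF C1w_mult[OF C1w_const[of _ 2] lnr] assms(1)]) (use pos in \<open>auto simp: ln_realpow\<close>)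
  note l = this
  have g_eq: "g w = 2 * (rz w / of_real (\<rho> w))" if "w \<in> \<Omega>" for w
    unfolding g_def using has_wirt_imp(3)[OF C1wD[OF l that]] .
  have "cnj (g w) = 2 * (rb w / of_real (\<rho> w))" if "w \<in> \<Omega>" for w
    unfolding g_eq[OF that] using has_wirt_real_partials(3)[OF C1wD[OF l that]] by auto
  then show "C1w \<Omega> (\<lambda>w. of_real (ln ((\<rho> w)\<^sup>2))) g (\<lambda>w. cnj (g w))"
    using C1w_eq_rhs[OF l] g_eq by simp
  note q = C1w_divide[OF rz(1) R nz]
  have g1: "C1w \<Omega> g (\<lambda>w. 2 * ((wirt_z rz w * of_real (\<rho> w) - rz w * rz w) / (of_real (\<rho> w))\<^sup>2))
      (\<lambda>w. 2 * ((rzb w * of_real (\<rho> w) - rz w * rb w) / (of_real (\<rho> w))\<^sup>2))"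
    by (rule C1w_cong[OF C1w_mult[OF C1w_const[of _ 2] q] assms(1)]) (auto simp: g_eq)
  then show "C1w \<Omega> g (wirt_z g) (wirt_zbar g)" by (rule C1w_wirt)
  have g2: "wirt_zbar g w = 2 * ((rzb w * of_real (\<rho> w) - rz w * rb w) / (of_real (\<rho> w))\<^sup>2)" if "w \<in> \<Omega>" for w
    using has_wirt_imp(4)[OF C1wD[OF g1 that]] .
  have "C1 \<Omega> (\<lambda>w. 2 * ((rzb w * of_real (\<rho> w) - rz w * rb w) / (of_real (\<rho> w))\<^sup>2))"
    unfolding power2_eq_square by (intro C1_intros rz(2) C1I[OF R] crz crb) (use nz in auto)
  then show "C1 \<Omega> (wirt_zbar g)" by (rule C1_cong[OF _ assms(1)]) (simp add: g2)
  show "laplacian (\<lambda>v. ln (\<rho> v)) w = 2 * Re (wirt_zbar g w)" if "w \<in> \<Omega>"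
    using laplacian_eq[OF assms(1) that lnr q] unfolding g2[OF that] by simp
qed

text \<open>The algebra behind the dbar derivative of J_z / J. Here \<open>f\<close>,
  \<open>x\<close>, \<open>d\<close> stand for \<Phi>, \<omega>, \<Phi>', and the primed letters for
  their conjugates; treating these as independent leaves a rational identity in which the mixed
  terms complete a square.\<close>

lemma log_jacobian_identity:
  fixes F J x x' f f' d d' q :: complex
  assumes "F \<noteq> 0" "J \<noteq> 0" and J: "J = F - f * f' / F"
  shows "((q * (F + f * f' / F) + x * (F * x' - f * f' / F * x' + f * d' / F) - (d * d' / F - d * f' * x' / F)) * J
       - (x * (F + f * f' / F) - d * f' / F) * (x' * (F + f * f' / F) - d' * f / F)) / J\<^sup>2 =
     q * (F + f * f' / F) / J - (2 * x * f - d) * (2 * x' * f' - d') / J\<^sup>2"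
proof -
  have *: "(q * (F + f * f' / F) + x * (F * x' - f * f' / F * x' + f * d' / F) - (d * d' / F - d * f' * x' / F)) * J
       - (x * (F + f * f' / F) - d * f' / F) * (x' * (F + f * f' / F) - d' * f / F) =
     q * (F + f * f' / F) * J - (2 * x * f - d) * (2 * x' * f' - d')"
    using assms(1) unfolding J by (simp add: field_simps)
  show ?thesis unfolding * using assms(2) by (simp add: diff_divide_distrib power2_eq_square)
qed

section \<open>The Hopf differential and the regularity of log F\<close>

locale plane_harmonic =
  fixes S \<Omega> :: "complex set" and \<rho> :: "complex \<Rightarrow> real" and H :: "complex \<Rightarrow> complex"
  assumes open_S: "open S" and open_Om: "open \<Omega>" and metric: "smooth_plane_metric \<Omega> \<rho>"
    and H_in: "H ` S \<subseteq> \<Omega>" and H_C2: "Ck_on 2 S H"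
    and harmonic: "\<And>z. z \<in> S \<Longrightarrow> wirt_zbar (wirt_z H) z +
      wirt_z (\<lambda>w. of_real (ln ((\<rho> w)\<^sup>2))) (H z) * wirt_z H z * wirt_zbar H z = 0"
begin

abbreviation P where "P \<equiv> wirt_z H"
abbreviation Q where "Q \<equiv> wirt_zbar H"
definition g where "g = wirt_z (\<lambda>w. complex_of_real (ln ((\<rho> w)\<^sup>2)))"
definition E where "E z = complex_of_real ((\<rho> (H z))\<^sup>2)"
definition \<Phi> where "\<Phi> z = E z * P z * cnj (Q z)"
definition F where "F z = E z * P z * cnj (P z)"
text \<open>The future dbar derivative of \<open>\<omega>\<close>, a quarter of the Laplacian of log
  F. The formula has only first derivatives of \<open>H\<close>, so \<open>q\<close> is C1 before
  \<open>\<omega>\<close> is known to be differentiable.\<close>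

definition q where "q z = wirt_zbar g (H z) * (P z * cnj (P z) - Q z * cnj (Q z))"
text \<open>The \<open>z\<close>-derivative of \<open>log F\<close>; junk at the zeros of \<open>P\<close>.\<close>

definition \<omega> where "\<omega> z = g (H z) * P z + wirt_z P z / P z"
abbreviation J where "J \<equiv> metric_jacobian \<rho> H"
definition S0 where "S0 = {z \<in> S. P z \<noteq> 0}"

lemmas l_C1w = metric_log_C1w(1)[OF open_Om metric, folded g_def]
  and g_C1w = metric_log_C1w(2)[OF open_Om metric, folded g_def]
  and gb_C1 = metric_log_C1w(3)[OF open_Om metric, folded g_def]
  and laplacian_ln_metric = metric_log_C1w(4)[OF open_Om metric, folded g_def]

lemma metric_pos: "z \<in> S \<Longrightarrow> 0 < \<rho> (H z)"
  using metric H_in by (auto simp: smooth_plane_metric_def)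

lemma E_nz: "z \<in> S \<Longrightarrow> E z \<noteq> 0"
  using metric_pos[of z] by (simp add: E_def)

lemma H_C1w: "C1w S H P Q"
  using H_C2 by (intro C1w_of_Ck Ck_on_Suc_imp[of "Suc 0"]) (simp only: numeral_2_eq_2)

lemma PQ_C1: "C1 S P" "C1 S Q"
proof -
  have "Ck_on (Suc (Suc 0)) S H" using H_C2 by (simp only: numeral_2_eq_2)
  then have "Ck_on (Suc 0) S (partial_x H)" "Ck_on (Suc 0) S (partial_y H)"
    unfolding Ck_on.simps(2)[of "Suc 0"] by auto
  then have "C1 S (partial_x H)" "C1 S (partial_y H)" by (auto intro: C1I[OF C1w_of_Ck] simp del: Ck_on.simps)
  then show "C1 S P" "C1 S Q"
    unfolding wirt_z_def[abs_def] wirt_zbar_def[abs_def] by (intro C1_intros; simp)+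
qed

lemma PQ_mixed: "z \<in> S \<Longrightarrow> wirt_z Q z = wirt_zbar P z"
  using C1w_mixed_derivatives[OF open_S _ H_C1w C1_D[OF PQ_C1(1)] C1_D[OF PQ_C1(2)]] by simp

lemma Pb_eq: "z \<in> S \<Longrightarrow> wirt_zbar P z = - (g (H z) * P z * Q z)"
  using harmonic[of z] by (simp add: g_def add_eq_0_iff2)

lemma P_C1w: "C1w S P (wirt_z P) (\<lambda>z. - (g (H z) * P z * Q z))"
  by (rule C1w_eq_rhs[OF C1_D[OF PQ_C1(1)]]) (simp_all add: Pb_eq)

lemma Q_C1w: "C1w S Q (\<lambda>z. - (g (H z) * P z * Q z)) (wirt_zbar Q)"
  by (rule C1w_eq_rhs[OF C1_D[OF PQ_C1(2)]]) (simp_all add: PQ_mixed Pb_eq)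

lemma open_S0: "open S0"
proof -
  have "continuous_on S P" using C1w_cont[OF P_C1w] .
  then have "open (S \<inter> P -` (- {0}))" by (intro continuous_open_preimage open_S) auto
  moreover have "S \<inter> P -` (- {0}) = S0" by (auto simp: S0_def)
  ultimately show ?thesis by simp
qed

lemma S0_S: "S0 \<subseteq> S" by (auto simp: S0_def)

text \<open>Writing \<open>E\<close> as the exponential of log (\<rho>^2) along \<open>H\<close>
  turns its derivatives into multiples of \<open>E\<close> with coefficients from \<open>g\<close>,
  ready to cancel against the harmonic map equation.\<close>

lemma E_C1w: "C1w S E (\<lambda>z. E z * (g (H z) * P z + cnj (g (H z)) * cnj (Q z)))
    (\<lambda>z. E z * (g (H z) * Q z + cnj (g (H z)) * cnj (P z)))"
proof (rule C1w_cong[OF C1w_real_compose[OF C1w_compose[OF H_C1w l_C1w H_in], of exp exp] open_S])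
  have *: "E z = of_real (exp (ln ((\<rho> (H z))\<^sup>2)))" if "z \<in> S" for z
    using metric_pos[OF that] by (simp add: E_def)
  show "E z = of_real (exp (ln ((\<rho> (H z))\<^sup>2)))" if "z \<in> S" for z
    by (rule *[OF that])
  show "E z * (g (H z) * P z + cnj (g (H z)) * cnj (Q z)) =
      of_real (exp (ln ((\<rho> (H z))\<^sup>2))) * (g (H z) * P z + cnj (g (H z)) * cnj (Q z))" if "z \<in> S" for z
    unfolding *[OF that] ..
  show "E z * (g (H z) * Q z + cnj (g (H z)) * cnj (P z)) =
      of_real (exp (ln ((\<rho> (H z))\<^sup>2))) * (g (H z) * Q z + cnj (g (H z)) * cnj (P z))" if "z \<in> S" for z
    unfolding *[OF that] ..
qed (auto intro!: continuous_intros)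

lemma gH_C1w: "C1w S (\<lambda>z. g (H z)) (\<lambda>z. wirt_z g (H z) * P z + wirt_zbar g (H z) * cnj (Q z))
    (\<lambda>z. wirt_z g (H z) * Q z + wirt_zbar g (H z) * cnj (P z))"
  by (rule C1w_compose[OF H_C1w g_C1w H_in])

lemma q_C1: "C1 S q"
  unfolding q_def[abs_def] by (intro C1_intros PQ_C1 C1_compose[OF gb_C1 C1I[OF H_C1w] H_in])

text \<open>The two terms from differentiating \<open>E\<close> cancel against - g Q from
  \<open>P\<close> and - cnj (g P) from \<open>cnj Q\<close>, both supplied by the harmonic map
  equation.\<close>

lemma \<Phi>_C1w: "C1w S \<Phi> (\<lambda>z. E z * ((g (H z) * P z + cnj (g (H z)) * cnj (Q z)) * P z * cnj (Q z)
    + wirt_z P z * cnj (Q z) + P z * cnj (wirt_zbar Q z))) (\<lambda>z. 0)"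
  unfolding \<Phi>_def[abs_def]
  by (rule C1w_eq_rhs[OF C1w_mult[OF C1w_mult[OF E_C1w P_C1w] C1w_cnj[OF Q_C1w]]]) (simp_all add: algebra_simps)

lemma \<Phi>_holomorphic: "\<Phi> holomorphic_on S"
  using dbar_zero_holomorphic(1)[OF open_S \<Phi>_C1w] .

lemma deriv_\<Phi>: "z \<in> S \<Longrightarrow> deriv \<Phi> z = E z * ((g (H z) * P z + cnj (g (H z)) * cnj (Q z)) * P z * cnj (Q z)
    + wirt_z P z * cnj (Q z) + P z * cnj (wirt_zbar Q z))"
  using dbar_zero_holomorphic(2)[OF open_S \<Phi>_C1w] .

text \<open>In the z-derivative the term with cnj (g) cnj (Q) from \<open>E\<close> cancels the one
  from \<open>cnj P\<close>; what remains is the logarithmic derivative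
  \<open>\<omega>\<close>.\<close>

lemma F_C1w: "C1w S0 F (\<lambda>z. F z * \<omega> z) (\<lambda>z. F z * cnj (\<omega> z))"
  unfolding F_def[abs_def]
  by (rule C1w_eq_rhs[OF C1w_subset[OF C1w_mult[OF C1w_mult[OF E_C1w P_C1w] C1w_cnj[OF P_C1w]] S0_S]])
    (auto simp: \<omega>_def S0_def field_simps)

text \<open>
  \<open>\<omega> = Lz + g(H) P\<close> for a local branch \<open>L\<close> of \<open>log P\<close>, whose \<open>dbar\<close> derivative \<open>- g(H) Q\<close> is \<open>C\<^sup>1\<close>.
\<close>

lemma \<omega>_local:
  assumes c: "c \<in> S0"
  shows "\<exists>r wz. 0 < r \<and> ball c r \<subseteq> S0 \<and> C1w (ball c r) \<omega> wz q"
proof -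
  have Pc: "P c \<noteq> 0" using c by (simp add: S0_def)
  \<comment> \<open>Dividing by P c brings the values near 1, away from the branch cut of
    \<open>Ln\<close>.\<close>
  let ?p = "\<lambda>z. P z / P c"
  have p: "C1w S0 ?p (\<lambda>z. wirt_z P z / P c) (\<lambda>z. - (g (H z) * P z * Q z) / P c)"
    using C1w_divide[OF C1w_subset[OF P_C1w S0_S] C1w_const[of _ "P c"]] Pc
    by (simp add: power2_eq_square)
  have "open (S0 \<inter> ?p -` (- \<real>\<^sub>\<le>\<^sub>0))"
    by (intro continuous_open_preimage open_S0 C1w_cont[OF p]) (simp add: open_Compl)
  moreover have "c \<in> S0 \<inter> ?p -` (- \<real>\<^sub>\<le>\<^sub>0)" using c Pc by simp
  ultimately obtain r where r: "0 < r" "ball c r \<subseteq> S0 \<inter> ?p -` (- \<real>\<^sub>\<le>\<^sub>0)"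
    by (meson open_contains_ball)
  let ?B = "ball c r"
  have BS0: "?B \<subseteq> S0" and BS: "?B \<subseteq> S" using r S0_S by auto
  have Pnz: "P z \<noteq> 0" if "z \<in> ?B" for z using that BS0 by (auto simp: S0_def)
  have "C1w ?B (\<lambda>z. Ln (?p z)) (\<lambda>z. deriv Ln (?p z) * (wirt_z P z / P c)) (\<lambda>z. deriv Ln (?p z) * (- (g (H z) * P z * Q z) / P c))"
    by (rule C1w_holo_compose[OF C1w_subset[OF p BS0], of _ "- \<real>\<^sub>\<le>\<^sub>0"]) (use r in \<open>auto intro!: holomorphic_intros simp: open_Compl\<close>)
  moreover have "deriv Ln (?p z) = P c / P z" if "z \<in> ?B" for z
  proof -
    have "?p z \<notin> \<real>\<^sub>\<le>\<^sub>0" using r that by auto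
    from DERIV_imp_deriv[OF has_field_derivative_Ln[OF this]] show ?thesis by (simp add: inverse_eq_divide)
  qed
  ultimately have L: "C1w ?B (\<lambda>z. Ln (?p z)) (\<lambda>z. wirt_z P z / P z) (\<lambda>z. - (g (H z) * Q z))"
    by (elim C1w_eq_rhs) (use Pc Pnz in \<open>auto simp: field_simps\<close>)
  note gB = C1w_subset[OF gH_C1w BS] and PB = C1w_subset[OF P_C1w BS] and QB = C1w_subset[OF Q_C1w BS]
  have b: "C1w ?B (\<lambda>z. - (g (H z) * Q z))
     (\<lambda>z. - ((wirt_z g (H z) * P z + wirt_zbar g (H z) * cnj (Q z)) * Q z + g (H z) * (- (g (H z) * P z * Q z))))
     (\<lambda>z. - ((wirt_z g (H z) * Q z + wirt_zbar g (H z) * cnj (P z)) * Q z + g (H z) * wirt_zbar Q z))"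
    using C1w_diff[OF C1w_const[of _ 0] C1w_mult[OF gB QB]] by simp
  \<comment> \<open>In the sum of the z-derivative of - g(H) Q and the dbar derivative of g(H) P,
    the terms with \<open>wirt_z g\<close> and with g^2 cancel, leaving \<open>q\<close>.\<close>
  obtain r' wz where r': "0 < r'" "ball c r' \<subseteq> ?B" "C1w (ball c r') (\<lambda>z. wirt_z P z / P z + g (H z) * P z) wz q"
  proof (rule dbar_regularity[OF open_ball _ L b C1w_mult[OF gB PB] C1_subset[OF q_C1 BS]])
    show "c \<in> ?B" using r(1) by simp
  qed (auto simp: q_def algebra_simps)
  have "\<omega> = (\<lambda>z. wirt_z P z / P z + g (H z) * P z)" by (simp add: fun_eq_iff \<omega>_def)
  then show ?thesis using r' BS0 by (metis order_trans)
qed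

lemma \<omega>_C1w: "C1w S0 \<omega> (wirt_z \<omega>) q"
proof (rule C1w_Union)
  fix z assume "z \<in> S0"
  from \<omega>_local[OF this] obtain r wz where r: "0 < r" "ball z r \<subseteq> S0" "C1w (ball z r) \<omega> wz q" by blast
  have "C1w (ball z r) \<omega> (wirt_z \<omega>) q"
    by (rule C1w_eq_rhs[OF r(3)]) (use has_wirt_imp(3)[OF C1wD[OF r(3)]] in auto)
  then show "\<exists>T. open T \<and> z \<in> T \<and> C1w T \<omega> (wirt_z \<omega>) q" using r(1) by (intro exI[of _ "ball z r"]) auto
qed

section \<open>The Jacobian and the Laplacian of its logarithm\<close>

lemma J_eq: "of_real (J z) = E z * (P z * cnj (P z) - Q z * cnj (Q z))"
  unfolding metric_jacobian_def E_def by (simp add: mult_cnj_norm)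

lemma F_nz: "z \<in> S0 \<Longrightarrow> F z \<noteq> 0"
  using E_nz by (auto simp: F_def S0_def)

lemma J_eq_F: "z \<in> S0 \<Longrightarrow> of_real (J z) = F z - \<Phi> z * cnj (\<Phi> z) / F z"
  using F_nz[of z] E_nz[of z] S0_S unfolding J_eq \<Phi>_def F_def
  by (auto simp: field_simps E_def S0_def)

lemma \<Phi>_F: "z \<in> S0 \<Longrightarrow> \<Phi> z * cnj (\<Phi> z) / F z = E z * (Q z * cnj (Q z))"
  using F_nz[of z] E_nz[of z] S0_S unfolding \<Phi>_def F_def
  by (auto simp: field_simps E_def S0_def)

lemma D_eq_F:
  assumes "z \<in> S0"
  shows "of_real (energy_density \<rho> H z) = F z + \<Phi> z * cnj (\<Phi> z) / F z"
  unfolding \<Phi>_F[OF assms] unfolding energy_density_def F_def E_def mult.assoc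
  by (simp add: mult_cnj_norm distrib_left)

lemma J_continuous: "continuous_on S J"
proof -
  have "continuous_on S (\<lambda>z. E z * (P z * cnj (P z) - Q z * cnj (Q z)))"
    by (intro continuous_intros C1w_cont[OF E_C1w] C1w_cont[OF P_C1w] C1w_cont[OF Q_C1w])
  then have "continuous_on S (\<lambda>z. Re (complex_of_real (J z)))"
    unfolding J_eq by (rule continuous_on_Re)
  then show ?thesis by simp
qed

lemma J_pos_S0: "z \<in> S \<Longrightarrow> 0 < J z \<Longrightarrow> z \<in> S0"
  unfolding S0_def metric_jacobian_def using metric_pos[of z]
  by (auto simp: zero_less_mult_iff)

definition S1 where "S1 = {z \<in> S. 0 < J z}"

lemma open_S1: "open S1"
proof -
  have "open (S \<inter> J -` {0<..})" by (intro continuous_open_preimage J_continuous open_S) auto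
  moreover have "S \<inter> J -` {0<..} = S1" by (auto simp: S1_def)
  ultimately show ?thesis by simp
qed

lemma S1_S0: "S1 \<subseteq> S0" using J_pos_S0 by (auto simp: S1_def)

lemma d\<Phi>_C1w: "C1w S \<Phi> (deriv \<Phi>) (\<lambda>z. 0)" "C1w S (deriv \<Phi>) (deriv (deriv \<Phi>)) (\<lambda>z. 0)"
  by (intro C1w_holo open_S \<Phi>_holomorphic holomorphic_deriv)+

text \<open>The z-derivative of F - |\<Phi>|^2 / F. Second derivatives of \<open>H\<close> occur
  only inside \<open>\<omega>\<close> and \<Phi>', which are both known to be C1.\<close>

definition Jz where "Jz z = \<omega> z * (F z + \<Phi> z * cnj (\<Phi> z) / F z) - deriv \<Phi> z * cnj (\<Phi> z) / F z"

lemma F_real: "cnj (F z) = F z" by (simp add: F_def E_def mult.commute mult.left_commute)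

lemma J_C1w: "C1w S0 (\<lambda>z. of_real (J z)) Jz (\<lambda>z. cnj (Jz z))"
proof -
  note D = C1w_subset[OF d\<Phi>_C1w(1) S0_S]
  show ?thesis
    by (rule C1w_cong[OF C1w_diff[OF F_C1w C1w_divide[OF C1w_mult[OF D C1w_cnj[OF D]] F_C1w F_nz]] open_S0])
      (auto simp: J_eq_F Jz_def F_nz F_real divide_simps power2_eq_square, auto simp: algebra_simps)
qed

text \<open>This is where \<open>J\<close> gains its second derivatives although \<open>H\<close> is
  only C2. The Laplacian is read off the dbar derivative, so just that one is made explicit.\<close>

lemma Jz_C1w: "\<exists>a. C1w S0 Jz a (\<lambda>z. q z * (F z + \<Phi> z * cnj (\<Phi> z) / F z)
    + \<omega> z * (F z * cnj (\<omega> z) - \<Phi> z * cnj (\<Phi> z) / F z * cnj (\<omega> z) + \<Phi> z * cnj (deriv \<Phi> z) / F z)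
    - (deriv \<Phi> z * cnj (deriv \<Phi> z) / F z - deriv \<Phi> z * cnj (\<Phi> z) * cnj (\<omega> z) / F z))"
proof -
  note D = C1w_subset[OF d\<Phi>_C1w(1) S0_S] and D2 = C1w_subset[OF d\<Phi>_C1w(2) S0_S]
  note C = C1w_diff[OF C1w_mult[OF \<omega>_C1w C1w_add[OF F_C1w C1w_divide[OF C1w_mult[OF D C1w_cnj[OF D]] F_C1w F_nz]]]
      C1w_divide[OF C1w_mult[OF D2 C1w_cnj[OF D]] F_C1w F_nz]]
  show ?thesis
    unfolding Jz_def[abs_def]
    by (rule exI, rule C1w_eq_rhs[OF C], assumption, assumption, rule refl)
      (simp_all add: F_nz divide_simps power2_eq_square, simp_all add: algebra_simps)
qed

lemma curvature_eq: "z \<in> S \<Longrightarrow> gauss_curvature \<rho> (H z) * (\<rho> (H z))\<^sup>2 = - 4 * Re (wirt_zbar g (H z))"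
  using metric_pos[of z] laplacian_ln_metric[of "H z"] H_in by (auto simp: gauss_curvature_def)

text \<open>Together with \<open>q\<close> being the dbar derivative of \<open>\<omega>\<close>,
  this is the Bochner formula for log F.\<close>

lemma Re_q: "z \<in> S \<Longrightarrow> 4 * Re (q z) = - (gauss_curvature \<rho> (H z) * J z)"
proof -
  assume z: "z \<in> S"
  have "q z = wirt_zbar g (H z) * of_real ((cmod (P z))\<^sup>2 - (cmod (Q z))\<^sup>2)"
    by (simp add: q_def mult_cnj_norm)
  then have "4 * Re (q z) = 4 * Re (wirt_zbar g (H z)) * ((cmod (P z))\<^sup>2 - (cmod (Q z))\<^sup>2)" by simp
  also have "\<dots> = - (gauss_curvature \<rho> (H z) * (\<rho> (H z))\<^sup>2) * ((cmod (P z))\<^sup>2 - (cmod (Q z))\<^sup>2)"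
    unfolding curvature_eq[OF z] by simp
  finally show ?thesis by (simp add: metric_jacobian_def algebra_simps)
qed

lemma ln_J_C1w: "C1w S1 (\<lambda>z. of_real (ln (J z))) (\<lambda>z. Jz z / of_real (J z)) (\<lambda>z. cnj (Jz z / of_real (J z)))"
proof -
  have "continuous_on (J ` S1) (\<lambda>x. 1 / x)" by (intro continuous_intros) (auto simp: S1_def)
  from C1w_real_compose[OF C1w_subset[OF J_C1w S1_S0], of ln "\<lambda>x. 1 / x", OF _ this]
  show ?thesis by (simp add: S1_def DERIV_ln_divide)
qed

lemma ln_J_C2w: "\<exists>a. C1w S1 (\<lambda>z. Jz z / of_real (J z)) a
  (\<lambda>z. q z * (F z + \<Phi> z * cnj (\<Phi> z) / F z) / of_real (J z) -
     (2 * \<omega> z * \<Phi> z - deriv \<Phi> z) * (2 * cnj (\<omega> z) * cnj (\<Phi> z) - cnj (deriv \<Phi> z)) / (of_real (J z))\<^sup>2)"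
proof -
  obtain a where a: "C1w S0 Jz a (\<lambda>z. q z * (F z + \<Phi> z * cnj (\<Phi> z) / F z)
    + \<omega> z * (F z * cnj (\<omega> z) - \<Phi> z * cnj (\<Phi> z) / F z * cnj (\<omega> z) + \<Phi> z * cnj (deriv \<Phi> z) / F z)
    - (deriv \<Phi> z * cnj (deriv \<Phi> z) / F z - deriv \<Phi> z * cnj (\<Phi> z) * cnj (\<omega> z) / F z))"
    using Jz_C1w by blast
  have nz: "complex_of_real (J z) \<noteq> 0" if "z \<in> S1" for z using that by (simp add: S1_def)
  have cJz: "cnj (Jz z) = cnj (\<omega> z) * (F z + \<Phi> z * cnj (\<Phi> z) / F z) - cnj (deriv \<Phi> z) * \<Phi> z / F z" for z
    by (simp add: Jz_def F_real mult.commute)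
  show ?thesis
  proof (rule exI, rule C1w_eq_rhs[OF C1w_divide[OF C1w_subset[OF a S1_S0] C1w_subset[OF J_C1w S1_S0] nz]], assumption, rule refl)
    fix z assume z: "z \<in> S1"
    then have F: "F z \<noteq> 0" and Jeq: "of_real (J z) = F z - \<Phi> z * cnj (\<Phi> z) / F z"
      using F_nz J_eq_F S1_S0 by auto
    show "q z * (F z + \<Phi> z * cnj (\<Phi> z) / F z) / of_real (J z) -
     (2 * \<omega> z * \<Phi> z - deriv \<Phi> z) * (2 * cnj (\<omega> z) * cnj (\<Phi> z) - cnj (deriv \<Phi> z)) / (of_real (J z))\<^sup>2 =
      ((q z * (F z + \<Phi> z * cnj (\<Phi> z) / F z)
    + \<omega> z * (F z * cnj (\<omega> z) - \<Phi> z * cnj (\<Phi> z) / F z * cnj (\<omega> z) + \<Phi> z * cnj (deriv \<Phi> z) / F z)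
    - (deriv \<Phi> z * cnj (deriv \<Phi> z) / F z - deriv \<Phi> z * cnj (\<Phi> z) * cnj (\<omega> z) / F z)) * of_real (J z) - Jz z * cnj (Jz z)) / (of_real (J z))\<^sup>2"
      unfolding cJz unfolding Jz_def by (rule log_jacobian_identity[OF F nz[OF z] Jeq, symmetric])
  qed
qed

text \<open>Kept apart from the Laplacian because the mean value inequality works with this real
  part directly. The product of conjugates becomes a squared modulus, which exhibits the
  sign.\<close>

lemma ln_J_second:
  assumes "z \<in> S1"
  shows "4 * Re (q z * (F z + \<Phi> z * cnj (\<Phi> z) / F z) / of_real (J z) -
     (2 * \<omega> z * \<Phi> z - deriv \<Phi> z) * (2 * cnj (\<omega> z) * cnj (\<Phi> z) - cnj (deriv \<Phi> z)) / (of_real (J z))\<^sup>2) =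
   - (gauss_curvature \<rho> (H z) * energy_density \<rho> H z) - 4 * (cmod (2 * \<omega> z * \<Phi> z - deriv \<Phi> z))\<^sup>2 / (J z)\<^sup>2"
proof -
  have z: "z \<in> S0" "z \<in> S" "0 < J z" using assms S1_S0 by (auto simp: S1_def)
  have "q z * (F z + \<Phi> z * cnj (\<Phi> z) / F z) / of_real (J z) = q z * of_real (energy_density \<rho> H z / J z)"
    using D_eq_F[OF z(1)] by simp
  then have "4 * Re (q z * (F z + \<Phi> z * cnj (\<Phi> z) / F z) / of_real (J z)) = 4 * Re (q z * of_real (energy_density \<rho> H z / J z))"
    by (simp only:)
  also have "\<dots> = 4 * Re (q z) * (energy_density \<rho> H z / J z)"
    by simp
  also have "\<dots> = - (gauss_curvature \<rho> (H z) * energy_density \<rho> H z)"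
    unfolding Re_q[OF z(2)] using z(3) by simp
  finally have 1: "4 * Re (q z * (F z + \<Phi> z * cnj (\<Phi> z) / F z) / of_real (J z)) = - (gauss_curvature \<rho> (H z) * energy_density \<rho> H z)" .
  have "(2 * \<omega> z * \<Phi> z - deriv \<Phi> z) * (2 * cnj (\<omega> z) * cnj (\<Phi> z) - cnj (deriv \<Phi> z)) / (of_real (J z))\<^sup>2
     = of_real ((cmod (2 * \<omega> z * \<Phi> z - deriv \<Phi> z))\<^sup>2 / (J z)\<^sup>2)"
    by (simp only: of_real_divide of_real_power[symmetric] complex_norm_square) simp
  then show ?thesis by (simp only: minus_complex.sel Re_complex_of_real right_diff_distrib 1)
qed

lemma laplacian_ln_J:
  assumes "z \<in> S" "0 < J z"
  shows "laplacian (\<lambda>\<zeta>. ln (J \<zeta>)) z =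
    - (gauss_curvature \<rho> (H z) * energy_density \<rho> H z) - 4 * (cmod (2 * \<omega> z * \<Phi> z - deriv \<Phi> z))\<^sup>2 / (J z)\<^sup>2"
proof -
  have z: "z \<in> S1" using assms by (simp add: S1_def)
  obtain a where "C1w S1 (\<lambda>z. Jz z / of_real (J z)) a
  (\<lambda>z. q z * (F z + \<Phi> z * cnj (\<Phi> z) / F z) / of_real (J z) -
     (2 * \<omega> z * \<Phi> z - deriv \<Phi> z) * (2 * cnj (\<omega> z) * cnj (\<Phi> z) - cnj (deriv \<Phi> z)) / (of_real (J z))\<^sup>2)"
    using ln_J_C2w by blast
  from laplacian_eq[OF open_S1 z ln_J_C1w this] show ?thesis unfolding ln_J_second[OF z] .
qed

text \<open>With u = A cnj Q / cnj P and v = B P / Q, the quantity 2 \<omega> \<Phi> - \<Phi>' is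
  \<rho>^2 (u - v). In |u - v|^2 the quotients cancel from the cross term, as u cnj v = A cnj
  B.\<close>

lemma laplacian_formula:
  assumes z: "z \<in> S" "0 < J z" "Q z \<noteq> 0"
  defines "A \<equiv> wirt_z P z * wirt_zbar (\<lambda>\<zeta>. cnj (H \<zeta>)) z + wirt_zbar (wirt_z (\<lambda>\<zeta>. cnj (H \<zeta>))) z * P z"
    and "B \<equiv> wirt_zbar P z * wirt_z (\<lambda>\<zeta>. cnj (H \<zeta>)) z + Q z * wirt_z (wirt_z (\<lambda>\<zeta>. cnj (H \<zeta>))) z"
  shows "- laplacian (\<lambda>\<zeta>. ln (J \<zeta>)) z =
     gauss_curvature \<rho> (H z) * energy_density \<rho> H z +
     4 * \<rho> (H z) ^ 4 / (J z)\<^sup>2 *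
       ((cmod (P z))\<^sup>2 / (cmod (Q z))\<^sup>2 * (cmod B)\<^sup>2 + (cmod (Q z))\<^sup>2 / (cmod (P z))\<^sup>2 * (cmod A)\<^sup>2 - 2 * Re (A * cnj B))"
proof -
  have Pz: "P z \<noteq> 0" using J_pos_S0[OF z(1,2)] by (simp add: S0_def)
  have hb: "C1w S (\<lambda>\<zeta>. cnj (H \<zeta>)) (\<lambda>z. cnj (Q z)) (\<lambda>z. cnj (P z))" by (rule C1w_cnj[OF H_C1w])
  have hz: "wirt_z (\<lambda>\<zeta>. cnj (H \<zeta>)) y = cnj (Q y)" and hzb: "wirt_zbar (\<lambda>\<zeta>. cnj (H \<zeta>)) y = cnj (P y)" if "y \<in> S" for y
    using has_wirt_imp(3,4)[OF C1wD[OF hb that]] by auto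
  have "C1w S (wirt_z (\<lambda>\<zeta>. cnj (H \<zeta>))) (\<lambda>z. cnj (wirt_zbar Q z)) (\<lambda>z. cnj (- (g (H z) * P z * Q z)))"
    by (rule C1w_cong[OF C1w_cnj[OF Q_C1w] open_S]) (auto simp: hz)
  note h2 = has_wirt_imp(3,4)[OF C1wD[OF this z(1)]]
  have A: "A = wirt_z P z * cnj (P z) - cnj (g (H z)) * cnj (P z) * cnj (Q z) * P z"
    unfolding A_def h2 hzb[OF z(1)] by simp
  have B: "B = - (g (H z) * P z * Q z) * cnj (Q z) + Q z * cnj (wirt_zbar Q z)"
    unfolding B_def h2 hz[OF z(1)] Pb_eq[OF z(1)] by simp
  have "2 * \<omega> z * \<Phi> z - deriv \<Phi> z = E z * (A * cnj (Q z) / cnj (P z) - B * P z / Q z)"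
    unfolding A B deriv_\<Phi>[OF z(1)] \<omega>_def \<Phi>_def using Pz z(3)
    by (simp add: field_simps)
  then have "(cmod (2 * \<omega> z * \<Phi> z - deriv \<Phi> z))\<^sup>2 = \<rho> (H z) ^ 4 * (cmod (A * cnj (Q z) / cnj (P z) - B * P z / Q z))\<^sup>2"
    by (simp add: norm_mult power_mult_distrib E_def norm_power)
  also have "(cmod (A * cnj (Q z) / cnj (P z) - B * P z / Q z))\<^sup>2 =
     (cmod (P z))\<^sup>2 / (cmod (Q z))\<^sup>2 * (cmod B)\<^sup>2 + (cmod (Q z))\<^sup>2 / (cmod (P z))\<^sup>2 * (cmod A)\<^sup>2 - 2 * Re (A * cnj B)"
  proof -
    have e: "(cmod (u - v))\<^sup>2 = (cmod v)\<^sup>2 + (cmod u)\<^sup>2 - 2 * Re (u * cnj v)" for u v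
      unfolding cmod_power2 by (simp add: power2_eq_square algebra_simps)
    have "(A * cnj (Q z) / cnj (P z)) * cnj (B * P z / Q z) = A * cnj B"
      using Pz z(3) by (simp add: field_simps)
    then show ?thesis unfolding e by (simp add: norm_mult norm_divide power_mult_distrib power_divide mult.commute)
  qed
  finally show ?thesis unfolding laplacian_ln_J[OF z(1,2)] by simp
qed

text \<open>|Q| / |P| = |\<Phi>| / F, and log |\<Phi>| is harmonic where the holomorphic \<Phi> has
  no zeros, so only - q from log F survives. The computation goes through the square of the
  quotient, which is rational in \<Phi>, its conjugate and F.\<close>

lemma ln_\<tau>_C2w:
  assumes "T \<subseteq> S0" "\<And>z. z \<in> T \<Longrightarrow> Q z \<noteq> 0" "open T"
  shows "C1w T (\<lambda>z. of_real (ln (cmod (Q z) / cmod (P z)))) (\<lambda>z. deriv \<Phi> z / (2 * \<Phi> z) - \<omega> z)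
      (\<lambda>z. cnj (deriv \<Phi> z / (2 * \<Phi> z) - \<omega> z))"
    and "\<exists>a. C1w T (\<lambda>z. deriv \<Phi> z / (2 * \<Phi> z) - \<omega> z) a (\<lambda>z. - q z)"
proof -
  have TS: "T \<subseteq> S" using assms S0_S by auto
  have nz: "P z \<noteq> 0" "Q z \<noteq> 0" "E z \<noteq> 0" "F z \<noteq> 0" "\<Phi> z \<noteq> 0" if "z \<in> T" for z
    using that assms TS E_nz[of z] F_nz[of z] by (auto simp: S0_def \<Phi>_def)
  note D = C1w_subset[OF d\<Phi>_C1w(1) TS] and D2 = C1w_subset[OF d\<Phi>_C1w(2) TS]
    and FT = C1w_subset[OF F_C1w assms(1)] and oT = C1w_subset[OF \<omega>_C1w assms(1)]
  have ff: "F z * F z \<noteq> 0" if "z \<in> T" for z using nz that by simp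
  let ?t = "\<lambda>z. (cmod (Q z) / cmod (P z))\<^sup>2"
  let ?w = "\<lambda>z. deriv \<Phi> z / (2 * \<Phi> z) - \<omega> z"
  have t_eq: "of_real (?t z) = \<Phi> z * cnj (\<Phi> z) / (F z * F z)" if "z \<in> T" for z
    unfolding power_divide of_real_divide of_real_power[symmetric] complex_norm_square
    using nz[OF that] by (simp add: \<Phi>_def F_def E_def)
  have t: "C1w T (\<lambda>z. of_real (?t z)) (\<lambda>z. of_real (?t z) * (2 * ?w z)) (\<lambda>z. of_real (?t z) * (2 * cnj (?w z)))"
  proof (rule C1w_cong[OF C1w_divide[OF C1w_mult[OF D C1w_cnj[OF D]] C1w_mult[OF FT FT] ff] assms(3)])
    fix z assume z: "z \<in> T"
    show "of_real (?t z) = \<Phi> z * cnj (\<Phi> z) / (F z * F z)" by (rule t_eq[OF z])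
    show "of_real (?t z) * (2 * ?w z) =
       ((deriv \<Phi> z * cnj (\<Phi> z) + \<Phi> z * cnj 0) * (F z * F z) - \<Phi> z * cnj (\<Phi> z) * (F z * \<omega> z * F z + F z * (F z * \<omega> z))) / (F z * F z)\<^sup>2"
      unfolding t_eq[OF z] using nz[OF z] by (simp add: divide_simps power2_eq_square) (simp add: algebra_simps)
    show "of_real (?t z) * (2 * cnj (?w z)) =
       ((0 * cnj (\<Phi> z) + \<Phi> z * cnj (deriv \<Phi> z)) * (F z * F z) - \<Phi> z * cnj (\<Phi> z) * (F z * cnj (\<omega> z) * F z + F z * (F z * cnj (\<omega> z)))) / (F z * F z)\<^sup>2"
      unfolding t_eq[OF z] using nz[OF z] by (simp add: divide_simps power2_eq_square) (simp add: algebra_simps)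
  qed
  have tp: "0 < ?t z" if "z \<in> T" for z using nz[OF that] by simp
  show "C1w T (\<lambda>z. of_real (ln (cmod (Q z) / cmod (P z)))) ?w (\<lambda>z. cnj (?w z))"
  proof (rule C1w_cong[OF C1w_real_compose[OF t, of "\<lambda>x. ln x / 2" "\<lambda>x. 1 / (2 * x)"] assms(3)])
    show "((\<lambda>x. ln x / 2) has_real_derivative 1 / (2 * ?t z)) (at (?t z))" if "z \<in> T" for z
      using tp[OF that] by (auto intro!: derivative_eq_intros simp: field_simps)
    show "continuous_on (?t ` T) (\<lambda>x. 1 / (2 * x))"
      using tp by (intro continuous_intros) force
    fix z assume z: "z \<in> T"
    show "of_real (ln (cmod (Q z) / cmod (P z))) = complex_of_real (ln (?t z) / 2)"
      using nz[OF z] by (simp add: ln_realpow)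
    have "complex_of_real (?t z) \<noteq> 0" using tp[OF z] by simp
    then show "?w z = of_real (1 / (2 * ?t z)) * (of_real (?t z) * (2 * ?w z))"
      "cnj (?w z) = of_real (1 / (2 * ?t z)) * (of_real (?t z) * (2 * cnj (?w z)))"
      by (simp_all only: of_real_divide of_real_mult of_real_1) (simp_all add: field_simps)
  qed
  have "C1w T (\<lambda>z. 2 * \<Phi> z) (\<lambda>z. 2 * deriv \<Phi> z) (\<lambda>z. 0)"
    using C1w_mult[OF C1w_const[of _ 2] D] by simp
  from C1w_diff[OF C1w_divide[OF D2 this] oT] nz
  show "\<exists>a. C1w T ?w a (\<lambda>z. - q z)" by simp blast
qed

end

section \<open>Positivity of the Jacobian\<close>

locale plane_harmonic_homeo = plane_harmonic +
  assumes inj: "inj_on H S"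
    and winding: "\<And>a r. 0 < r \<Longrightarrow> cball a r \<subseteq> S \<Longrightarrow> winding_number (H \<circ> circlepath a r) (H a) = 1"
    and curvature_nonneg: "\<And>w. w \<in> \<Omega> \<Longrightarrow> 0 \<le> gauss_curvature \<rho> w"
begin

lemma curvature_H: "z \<in> S \<Longrightarrow> 0 \<le> gauss_curvature \<rho> (H z)"
  using curvature_nonneg H_in by blast

text \<open>Where |Q| > |P| the antilinear part controls small circles, and \<open>H\<close> would
  wind -1 times around the image of the centre.\<close>

lemma Q_le_P:
  assumes "z \<in> S" shows "cmod (Q z) \<le> cmod (P z)"
proof (rule ccontr)
  assume neg: "\<not> cmod (Q z) \<le> cmod (P z)"
  \<comment> \<open>Half the gap between |Q| and |P|, so that the error of the linear approximation
    and |P| together stay below |Q|.\<close>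
  define e where "e = (cmod (Q z) - cmod (P z)) / 2"
  then have e: "0 < e" "e + cmod (P z) < cmod (Q z)" using neg by (auto simp: field_simps)
  have "has_wirt H (P z) (Q z) z" using C1wD[OF H_C1w assms] .
  then obtain d where d: "0 < d"
    "\<And>y. norm (y - z) < d \<Longrightarrow> norm (H y - H z - (P z * (y - z) + Q z * cnj (y - z))) \<le> e * norm (y - z)"
    unfolding has_wirt_def has_derivative_at_alt using e(1) by blast
  obtain r0 where r0: "0 < r0" "cball z r0 \<subseteq> S" using open_S assms open_contains_cball by blast
  define r where "r = min r0 (d / 2)"
  have r: "0 < r" "r < d" "cball z r \<subseteq> S" using r0 d(1) by (auto simp: r_def)
  have "winding_number (H \<circ> circlepath z r) (H z) = - 1"
  proof (rule winding_number_near_cnj[OF continuous_on_subset[OF C1w_cont[OF H_C1w] r(3)] r(1)])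
    fix \<zeta> :: complex assume \<zeta>: "cmod \<zeta> = r"
    have "cmod (H (z + \<zeta>) - H z - Q z * cnj \<zeta>) =
        cmod ((H (z + \<zeta>) - H z - (P z * \<zeta> + Q z * cnj \<zeta>)) + P z * \<zeta>)" by (simp add: algebra_simps)
    also have "\<dots> \<le> e * r + cmod (P z) * r"
      using d(2)[of "z + \<zeta>"] \<zeta> r by (intro norm_triangle_le add_mono) (auto simp: norm_mult)
    also have "\<dots> < cmod (Q z) * r"
      using e(2) r(1) by (simp flip: distrib_right)
    finally show "cmod (H (z + \<zeta>) - H z - Q z * cnj \<zeta>) < cmod (Q z) * r" .
  qed
  then show False using winding[OF r(1,3)] by simp
qed

lemma J_nonneg: "z \<in> S \<Longrightarrow> 0 \<le> J z"
  unfolding metric_jacobian_def using Q_le_P[of z] by (simp add: power_mono)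

lemma not_degenerate:
  assumes "open T" "T \<noteq> {}" "T \<subseteq> S"
  shows "\<exists>z\<in>T. cmod (P z) \<noteq> cmod (Q z)"
  using injective_jacobian_nonzero[OF assms(1,2) inj_on_subset[OF inj assms(3)]] C1wD[OF H_C1w] assms(3) by blast

text \<open>\<open>s\<close> is chosen with \<open>dbar\<close> derivative \<open>g(H) Q\<close>, which makes \<open>P exp s\<close> holomorphic.\<close>

lemma P_local_form:
  assumes c: "c \<in> S"
  obtains r s k n where "0 < r" "ball c r \<subseteq> S" "continuous_on (ball c r) s" "k holomorphic_on ball c r"
    "\<And>z. z \<in> ball c r \<Longrightarrow> k z \<noteq> 0" "\<And>z. z \<in> ball c r \<Longrightarrow> P z = (z - c) ^ n * k z * exp (- s z)"
proof -
  have "C1 S (\<lambda>z. g (H z) * Q z)" by (rule C1_mult[OF C1I[OF gH_C1w] C1I[OF Q_C1w]])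
  then obtain r s sz where r: "0 < r" "ball c r \<subseteq> S" and s: "C1w (ball c r) s sz (\<lambda>z. g (H z) * Q z)"
    using dbar_solution[OF open_S c] by metis
  define p where "p z = P z * exp (s z)" for z
  have "C1w (ball c r) (\<lambda>z. exp (s z)) (\<lambda>z. deriv exp (s z) * sz z) (\<lambda>z. deriv exp (s z) * (g (H z) * Q z))"
    by (rule C1w_holo_compose[OF s holomorphic_on_exp open_UNIV]) auto
  moreover have de: "deriv exp w = exp w" for w :: complex by (intro DERIV_imp_deriv DERIV_exp)
  ultimately have "C1w (ball c r) (\<lambda>z. exp (s z)) (\<lambda>z. exp (s z) * sz z) (\<lambda>z. exp (s z) * (g (H z) * Q z))"
    by (simp only: de)
  note M = C1w_mult[OF C1w_subset[OF P_C1w r(2)] this]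
  have "C1w (ball c r) p (\<lambda>z. wirt_z P z * exp (s z) + P z * (exp (s z) * sz z)) (\<lambda>z. 0)"
    unfolding p_def[abs_def] by (rule C1w_eq_rhs[OF M]) (auto simp: algebra_simps)
  note p_holo = dbar_zero_holomorphic(1)[OF open_ball this]
  have P_eq: "P z = p z * exp (- s z)" for z by (simp add: p_def exp_minus)
  have "\<exists>r' k n. 0 < r' \<and> ball c r' \<subseteq> ball c r \<and> k holomorphic_on ball c r' \<and>
      (\<forall>z\<in>ball c r'. k z \<noteq> 0 \<and> p z = (z - c) ^ n * k z)"
  proof (cases "p c = 0")
    case True
    \<comment> \<open>Otherwise \<open>P\<close> vanishes on the disc, then so does \<open>Q\<close>
      by |Q| <= |P|, and \<open>H\<close> is degenerate on an open set.\<close>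
    have "\<not> p constant_on ball c r"
    proof
      assume "p constant_on ball c r"
      then have "p z = 0" if "z \<in> ball c r" for z
        using True r(1) that unfolding constant_on_def by (metis centre_in_ball)
      then have "P z = 0" if "z \<in> ball c r" for z using that P_eq by simp
      then have "cmod (P z) = cmod (Q z)" if "z \<in> ball c r" for z
        using that Q_le_P[of z] r(2) by force
      then show False using not_degenerate[of "ball c r"] r by auto
    qed
    then show ?thesis
      using holomorphic_factor_zero_nonconstant[OF p_holo open_ball connected_ball _ True] r(1)
      by (smt (verit, best) centre_in_ball)
  next
    case False
    have "isCont p c"
      using p_holo r(1) by (meson centre_in_ball continuous_on_eq_continuous_at holomorphic_on_imp_continuous_on open_ball)
    then obtain d where d: "0 < d" "\<And>z. dist z c < d \<Longrightarrow> p z \<noteq> 0"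
      using continuous_at_avoid[of c p 0] False by (auto simp: dist_commute)
    show ?thesis
      using d r(1)
      by (intro exI[of _ "min d r"] exI[of _ p] exI[of _ 0]) (auto intro: holomorphic_on_subset[OF p_holo] simp: dist_commute)
  qed
  then obtain r' k n where rk: "0 < r'" "ball c r' \<subseteq> ball c r" "k holomorphic_on ball c r'"
      "\<And>z. z \<in> ball c r' \<Longrightarrow> k z \<noteq> 0" "\<And>z. z \<in> ball c r' \<Longrightarrow> p z = (z - c) ^ n * k z" by blast
  show ?thesis
  proof (rule that[OF rk(1) _ _ rk(3,4)])
    show "ball c r' \<subseteq> S" using rk r by blast
    show "continuous_on (ball c r') s" using C1w_cont[OF s] rk(2) continuous_on_subset by blast
    show "P z = (z - c) ^ n * k z * exp (- s z)" if "z \<in> ball c r'" for z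
      using P_eq[of z] rk(5)[OF that] by simp
  qed
qed

text \<open>
  \<open>\<tau>\<close> extends continuously to \<open>c\<close> since \<open>\<Phi> / (P exp s)\<^sup>2\<close> is holomorphic off \<open>c\<close> and bounded, by \<open>|Q| \<le> |P|\<close>.
\<close>

lemma dilatation_local_form:
  assumes c: "c \<in> S"
  obtains r \<alpha> \<tau> n where "0 < r" "ball c r \<subseteq> S" "continuous_on (ball c r) \<alpha>" "continuous_on (ball c r) \<tau>"
    "\<And>z. z \<in> ball c r \<Longrightarrow> \<alpha> z \<noteq> 0" "\<And>z. z \<in> ball c r \<Longrightarrow> P z = \<alpha> z * (z - c) ^ n"
    "\<And>z. z \<in> ball c r \<Longrightarrow> cmod (Q z) = \<tau> z * cmod (P z)"
proof -
  obtain r s k n where r: "0 < r" "ball c r \<subseteq> S" and s: "continuous_on (ball c r) s" and k: "k holomorphic_on ball c r"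
    "\<And>z. z \<in> ball c r \<Longrightarrow> k z \<noteq> 0" and P: "\<And>z. z \<in> ball c r \<Longrightarrow> P z = (z - c) ^ n * k z * exp (- s z)"
    using P_local_form[OF c] by metis
  let ?B = "ball c r"
  define \<Psi> where "\<Psi> z = \<Phi> z / ((z - c) ^ n * k z)\<^sup>2" for z
  have \<Psi>: "\<Psi> holomorphic_on ?B - {c}"
    unfolding \<Psi>_def[abs_def]
    by (intro holomorphic_intros holomorphic_on_subset[OF \<Phi>_holomorphic] holomorphic_on_subset[OF k(1)])
      (use r(2) k(2) in auto)
  have P_exp: "cmod (P z) * cmod (exp (s z)) = cmod ((z - c) ^ n * k z)" if "z \<in> ?B" for z
    unfolding P[OF that] by (simp add: norm_mult exp_minus norm_inverse)
  have \<Phi>_abs: "cmod (\<Phi> z) = cmod (E z) * cmod (P z) * cmod (Q z)" for z by (simp add: \<Phi>_def norm_mult)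
  have \<Psi>_abs: "cmod (\<Psi> z) * cmod (P z) * (cmod (exp (s z)))\<^sup>2 = cmod (E z) * cmod (Q z)"
    "P z \<noteq> 0" if z: "z \<in> ?B - {c}" for z
  proof -
    show Pnz: "P z \<noteq> 0" using P[of z] k(2)[of z] z by auto
    have "cmod (\<Psi> z) * (cmod (P z) * cmod (exp (s z)))\<^sup>2 = cmod (\<Phi> z)"
      using z k(2)[of z] P_exp[of z] by (simp add: \<Psi>_def norm_divide norm_power)
    then have "(cmod (\<Psi> z) * cmod (P z) * (cmod (exp (s z)))\<^sup>2) * cmod (P z) = cmod (E z) * cmod (Q z) * cmod (P z)"
      unfolding \<Phi>_abs by (simp add: power2_eq_square mult_ac)
    then show "cmod (\<Psi> z) * cmod (P z) * (cmod (exp (s z)))\<^sup>2 = cmod (E z) * cmod (Q z)" using Pnz by simp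
  qed
  have cE: "continuous_on ?B E" using C1w_cont[OF E_C1w] r(2) continuous_on_subset by blast
  have "\<exists>B. eventually (\<lambda>z. cmod (\<Psi> z) \<le> B) (at c)"
  proof -
    define b where "b z = cmod (E z) / (cmod (exp (s z)))\<^sup>2" for z
    have "continuous_on ?B b" unfolding b_def[abs_def] by (intro continuous_intros cE s) simp
    then have "isCont b c" using r(1) by (simp add: continuous_on_eq_continuous_at)
    then have "eventually (\<lambda>z. b z < b c + 1) (at c)"
      by (intro order_tendstoD(2)) (auto simp: isCont_def)
    moreover have "eventually (\<lambda>z. z \<in> ?B - {c}) (at c)"
      using r(1) by (intro eventually_at_in_open) auto
    ultimately have "eventually (\<lambda>z. cmod (\<Psi> z) \<le> b c + 1) (at c)"
    proof eventually_elim
      case (elim z)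
      have "cmod (\<Psi> z) * cmod (P z) * (cmod (exp (s z)))\<^sup>2 \<le> cmod (E z) * cmod (P z)"
        unfolding \<Psi>_abs(1)[OF elim(2)] using Q_le_P[of z] r(2) elim(2) by (intro mult_left_mono) auto
      then have "cmod (P z) * (cmod (\<Psi> z) * (cmod (exp (s z)))\<^sup>2) \<le> cmod (P z) * cmod (E z)"
        by (simp add: mult_ac)
      then have "cmod (\<Psi> z) * (cmod (exp (s z)))\<^sup>2 \<le> cmod (E z)" using \<Psi>_abs(2)[OF elim(2)] by simp
      then have "cmod (\<Psi> z) \<le> b z" unfolding b_def by (subst pos_le_divide_eq) auto
      then show ?case using elim(1) by linarith
    qed
    then show ?thesis by blast
  qed
  then obtain \<psi> where \<psi>: "\<psi> holomorphic_on ?B" "\<And>z. z \<in> ?B - {c} \<Longrightarrow> \<psi> z = \<Psi> z"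
    using holomorphic_on_extend_bounded[OF \<Psi>] r(1) by auto
  \<comment> \<open>\<open>\<Psi>_abs\<close> solved for |Q| / |P|, with the extension
    \<open>\<psi>\<close> in place of \<open>\<Psi>\<close>.\<close>
  define \<tau> where "\<tau> z = cmod (\<psi> z) * (cmod (exp (s z)))\<^sup>2 / cmod (E z)" for z
  define \<alpha> where "\<alpha> z = k z * exp (- s z)" for z
  have Enz: "E z \<noteq> 0" if "z \<in> ?B" for z using E_nz r(2) that by blast
  have c\<alpha>: "continuous_on ?B \<alpha>"
    unfolding \<alpha>_def[abs_def] by (intro continuous_intros s holomorphic_on_imp_continuous_on[OF k(1)])
  have c\<tau>: "continuous_on ?B \<tau>"
    unfolding \<tau>_def[abs_def]
    by (intro continuous_intros s cE holomorphic_on_imp_continuous_on[OF \<psi>(1)]) (use Enz in auto)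
  have off: "cmod (Q z) = \<tau> z * cmod (P z)" if z: "z \<in> ?B - {c}" for z
    using \<Psi>_abs(1)[OF z] Enz[of z] z unfolding \<tau>_def \<psi>(2)[OF z] by (simp add: field_simps)
  \<comment> \<open>At \<open>c\<close>, where \<open>P\<close> may vanish, the relation is obtained
    as a limit: \<open>D\<close> is continuous and zero off \<open>c\<close>.\<close>
  define D where "D z = cmod (Q z) - \<tau> z * cmod (P z)" for z
  have "continuous_on ?B D" unfolding D_def
    by (intro continuous_intros c\<tau> continuous_on_subset[OF C1w_cont[OF P_C1w] r(2)] continuous_on_subset[OF C1w_cont[OF Q_C1w] r(2)])
  then have "D \<midarrow>c\<rightarrow> D c" using r(1) by (simp add: continuous_on_eq_continuous_at isCont_def)
  moreover have "D \<midarrow>c\<rightarrow> 0"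
  proof (rule tendsto_eventually)
    have "eventually (\<lambda>z. z \<in> ?B - {c}) (at c)" using r(1) by (intro eventually_at_in_open) auto
    then show "eventually (\<lambda>z. D z = 0) (at c)" by eventually_elim (use off in \<open>auto simp: D_def\<close>)
  qed
  ultimately have "D c = 0" by (rule LIM_unique)
  then have "cmod (Q z) = \<tau> z * cmod (P z)" if "z \<in> ?B" for z
    using off[of z] that by (cases "z = c") (auto simp: D_def)
  then show ?thesis
    by (intro that[OF r c\<alpha> c\<tau>]) (use k(2) P in \<open>auto simp: \<alpha>_def\<close>)
qed

text \<open>u = log \<tau> is nonpositive and subharmonic off \<open>c\<close>, and continuous at
  \<open>c\<close> with value 0. On each small circle its mean is at least 0, so \<open>u\<close>
  vanishes on the whole circle. Sweeping over all radii gives |P| = |Q| on a punctured disc.\<close>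

lemma dilatation_ne_one:
  assumes r: "0 < r" "ball c r \<subseteq> S" and \<tau>: "continuous_on (ball c r) \<tau>"
    and P: "\<And>z. z \<in> ball c r - {c} \<Longrightarrow> P z \<noteq> 0"
    and Q: "\<And>z. z \<in> ball c r \<Longrightarrow> cmod (Q z) = \<tau> z * cmod (P z)"
  shows "\<tau> c \<noteq> 1"
proof
  assume one: "\<tau> c = 1"
  have "isCont \<tau> c" using \<tau> r(1) by (simp add: continuous_on_eq_continuous_at)
  then obtain d where d: "0 < d" "\<And>z. dist z c < d \<Longrightarrow> \<bar>\<tau> z - 1\<bar> < 1"
    using one unfolding continuous_at_eps_delta dist_real_def by (metis zero_less_one)
  \<comment> \<open>Within distance \<open>d\<close> the value of \<tau> is positive, so its
    logarithm is continuous and \<open>Q\<close> has no zeros off \<open>c\<close>.\<close>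
  define R where "R = min r d"
  have R: "0 < R" "ball c R \<subseteq> ball c r" "ball c R \<subseteq> S" using d(1) r by (auto simp: R_def)
  have pos: "0 < \<tau> z" if "z \<in> ball c R" for z
    using d(2)[of z] that by (auto simp: R_def dist_commute abs_less_iff)
  define u where "u z = ln (\<tau> z)" for z
  let ?T = "ball c R - {c}"
  have oT: "open ?T" by (simp add: open_Diff)
  have TS0: "?T \<subseteq> S0" using P R by (auto simp: S0_def)
  have TS: "?T \<subseteq> S" using R by auto
  have QT: "Q z \<noteq> 0" if "z \<in> ?T" for z
    using Q[of z] pos[of z] P[of z] that R(2) by (metis DiffD1 mult_eq_0_iff norm_eq_zero order_less_irrefl subsetD Diff_iff)
  have u_eq: "u z = ln (cmod (Q z) / cmod (P z))" if "z \<in> ?T" for z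
    using Q[of z] P[of z] that R(2) by (auto simp: u_def)
  have cu: "continuous_on (ball c R) u"
    unfolding u_def[abs_def] by (intro continuous_intros continuous_on_subset[OF \<tau> R(2)]) (use pos in force)
  have u_le: "u z \<le> 0" if z: "z \<in> ?T" for z
  proof -
    have "z \<in> ball c r" "z \<in> S" using z R(2) TS by blast+
    then have "\<tau> z * cmod (P z) \<le> 1 * cmod (P z)" using Q[of z] Q_le_P[of z] by simp
    then have "\<tau> z \<le> 1" using P[of z] z R(2) by (auto dest: mult_right_le_imp_le)
    then show ?thesis using pos[of z] z by (simp add: u_def)
  qed
  have w: "C1w ?T (\<lambda>z. of_real (u z)) (\<lambda>z. deriv \<Phi> z / (2 * \<Phi> z) - \<omega> z) (\<lambda>z. cnj (deriv \<Phi> z / (2 * \<Phi> z) - \<omega> z))"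
    by (rule C1w_cong[OF ln_\<tau>_C2w(1)[OF TS0 QT oT] oT]) (auto simp: u_eq)
  obtain a where wb: "C1w ?T (\<lambda>z. deriv \<Phi> z / (2 * \<Phi> z) - \<omega> z) a (\<lambda>z. - q z)"
    using ln_\<tau>_C2w(2)[OF TS0 QT oT] by blast
  have sup: "0 \<le> Re (- q z)" if "z \<in> ?T" for z
    using Re_q[of z] J_nonneg[of z] curvature_H[of z] that TS
    by (metis (no_types, opaque_lifting) mult_nonneg_nonneg neg_0_le_iff_le neg_le_0_iff_le subsetD uminus_complex.sel(1) zero_le_mult_iff zero_le_numeral mult_le_0_iff not_numeral_le_zero)
  have circ: "u (c + of_real \<rho>' * cis t) = 0" if \<rho>': "0 < \<rho>'" "\<rho>' < R" and t: "t \<in> {0..2*pi}" for \<rho>' t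
  proof -
    have inT: "c + of_real \<rho>' * cis t \<in> ?T" for t using \<rho>' by (auto simp: dist_norm norm_mult)
    have cont: "continuous_on {0..2*pi} (\<lambda>t. - u (c + of_real \<rho>' * cis t))"
      by (intro continuous_intros continuous_on_compose2[OF cu]) (use inT in auto)
    have "2 * pi * u c \<le> integral {0..2*pi} (\<lambda>t. u (c + of_real \<rho>' * cis t))"
      by (rule circle_mean_ge[OF cu w wb sup \<rho>'])
    then have "integral {0..2*pi} (\<lambda>t. - u (c + of_real \<rho>' * cis t)) \<le> 0"
      by (simp add: u_def one)
    moreover have "0 \<le> integral {0..2*pi} (\<lambda>t. - u (c + of_real \<rho>' * cis t))"
      by (intro Henstock_Kurzweil_Integration.integral_nonneg integrable_continuous_interval cont) (use u_le[OF inT] in auto)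
    ultimately have "integral {0..2*pi} (\<lambda>t. - u (c + of_real \<rho>' * cis t)) = 0" by linarith
    then show ?thesis
      using integral_eq_0_iff[OF cont] u_le[OF inT] t by auto
  qed
  have "cmod (P z) = cmod (Q z)" if z: "z \<in> ?T" for z
  proof -
    let ?s = "cmod (z - c)"
    have s: "0 < ?s" "?s < R" using z by (auto simp: dist_norm norm_minus_commute)
    obtain t where t: "0 \<le> t" "t < 2*pi" "z - c = of_real ?s * exp (\<i> * of_real t)"
      using Arg2pi_ge_0[of "z - c"] Arg2pi_lt_2pi[of "z - c"] Arg2pi_eq[of "z - c"] by metis
    then have "z = c + of_real ?s * cis t" by (simp add: cis_conv_exp algebra_simps)
    then have "u z = 0" using circ[OF s, of t] t by simp
    then have "\<tau> z = 1" using pos[of z] z by (simp add: u_def)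
    then show ?thesis using Q[of z] z R(2) by auto
  qed
  moreover have "?T \<noteq> {}"
  proof -
    have "c + of_real (R/2) \<in> ?T" using R(1) by (auto simp: dist_norm)
    then show ?thesis by blast
  qed
  ultimately show False using not_degenerate[OF oT _ TS] by blast
qed

text \<open>Integrating the differential along the segment from \<open>c\<close> to
  \<open>c + \<zeta>\<close>, the leading term contributes \<alpha>(c) \<zeta>^(n+1) / (n+1). As
  \<tau>(c) < 1 the rest is strictly smaller, so the winding number is n + 1, which has to be
  1.\<close>

lemma order_zero:
  assumes r: "0 < r" "ball c r \<subseteq> S" and \<alpha>: "continuous_on (ball c r) \<alpha>" "\<alpha> c \<noteq> 0" and \<tau>: "continuous_on (ball c r) \<tau>" "\<tau> c < 1"
    and P: "\<And>z. z \<in> ball c r \<Longrightarrow> P z = \<alpha> z * (z - c) ^ n"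
    and Q: "\<And>z. z \<in> ball c r \<Longrightarrow> cmod (Q z) = \<tau> z * cmod (P z)"
  shows "n = 0"
proof -
  \<comment> \<open>A bound for \<tau> near \<open>c\<close>, strictly between \<tau>(c) and 1. The
    maximum with 0 secures \<kappa> >= 0, as no sign of \<tau> is assumed.\<close>
  define \<kappa> where "\<kappa> = max 0 ((1 + \<tau> c) / 2)"
  have \<kappa>: "0 \<le> \<kappa>" "\<kappa> < 1" "\<tau> c < \<kappa>" using \<tau>(2) by (auto simp: \<kappa>_def max_def field_simps)
  \<comment> \<open>The quarter gives e (1 + \<kappa>) <= 2 e < (1 - \<kappa>) |\<alpha>(c)|, which
    is the inequality C < |\<alpha>(c)| below.\<close>
  define e where "e = (1 - \<kappa>) * cmod (\<alpha> c) / 4"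
  have e: "0 < e" using \<kappa> \<alpha>(2) by (simp add: e_def)
  have "isCont \<tau> c" "isCont \<alpha> c" using \<tau>(1) \<alpha>(1) r(1) by (simp_all add: continuous_on_eq_continuous_at)
  obtain d1 where d1: "0 < d1" "\<And>z. dist z c < d1 \<Longrightarrow> \<tau> z < \<kappa>"
  proof -
    have "0 < \<kappa> - \<tau> c" using \<kappa> by simp
    then obtain d where "0 < d" "\<And>z. dist z c < d \<Longrightarrow> \<bar>\<tau> z - \<tau> c\<bar> < \<kappa> - \<tau> c"
      using \<open>isCont \<tau> c\<close> unfolding continuous_at_eps_delta dist_real_def by metis
    then show ?thesis using that[of d] by (smt (verit))
  qed
  obtain d2 where d2: "0 < d2" "\<And>z. dist z c < d2 \<Longrightarrow> cmod (\<alpha> z - \<alpha> c) < e"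
    using \<open>isCont \<alpha> c\<close> e unfolding continuous_at_eps_delta dist_norm by metis
  define R where "R = min (r/2) (min d1 d2 / 2)"
  have R: "0 < R" "R < r" "R < d1" "R < d2" using r(1) d1(1) d2(1) by (auto simp: R_def min_def)
  have RB: "cball c R \<subseteq> ball c r" "cball c R \<subseteq> S" using R r(2) by auto
  \<comment> \<open>The error budget: \<open>e\<close> for replacing \<alpha> by its value at
    \<open>c\<close>, the other summand for the term with \<open>Q\<close>, bounded by \<kappa>
    |P|.\<close>
  define C where "C = e + \<kappa> * (cmod (\<alpha> c) + e)"
  have C: "C < cmod (\<alpha> c)"
  proof -
    have "e * (1 + \<kappa>) \<le> e * 2" using e \<kappa> by (intro mult_left_mono) auto
    moreover have "e * 2 < (1 - \<kappa>) * cmod (\<alpha> c)" using e by (simp add: e_def)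
    ultimately show ?thesis unfolding C_def by (simp add: algebra_simps)
  qed
  have "winding_number (H \<circ> circlepath c R) (H c) = of_nat (Suc n)"
  proof (rule winding_number_near_power[OF continuous_on_subset[OF C1w_cont[OF H_C1w] RB(2)] R(1), where c = "\<alpha> c / of_nat (Suc n)"])
    fix \<zeta> :: complex assume \<zeta>: "cmod \<zeta> = R"
    have in_ball: "c + of_real t * \<zeta> \<in> cball c R" if "t \<in> {0..1}" for t
      using that \<zeta> R(1) by (auto simp: dist_norm norm_mult mult_left_le_one_le)
    have d_line: "((\<lambda>t. c + of_real t * \<zeta>) has_vector_derivative \<zeta>) (at t within {0..1})" for t
      unfolding has_vector_derivative_def by (auto intro!: derivative_eq_intros simp: scaleR_conv_of_real)
    let ?i = "\<lambda>t. P (c + of_real t * \<zeta>) * \<zeta> + Q (c + of_real t * \<zeta>) * cnj \<zeta>"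
    have "(?i has_integral (H (c + of_real 1 * \<zeta>) - H (c + of_real 0 * \<zeta>))) {0..1}"
      by (intro fundamental_theorem_of_calculus has_wirt_path[OF C1wD[OF H_C1w] d_line]) (use in_ball RB(2) in auto)
    then have hi: "(?i has_integral (H (c + \<zeta>) - H c)) {0..1}" by simp
    have hp: "((\<lambda>t::real. t ^ n) has_integral (1 / of_nat (Suc n))) {0..1}"
    proof -
      have "((\<lambda>t::real. t ^ n) has_integral (1 ^ Suc n / real (Suc n) - 0 ^ Suc n / real (Suc n))) {0..1}"
      proof (rule fundamental_theorem_of_calculus)
        show "((\<lambda>t. t ^ Suc n / real (Suc n)) has_vector_derivative t ^ n) (at t within {0..1})" for t :: real
          unfolding has_real_derivative_iff_has_vector_derivative[symmetric]
          by (auto intro!: derivative_eq_intros simp del: of_nat_Suc power_Suc simp: field_simps)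
      qed simp
      then show ?thesis by simp
    qed
    have "((\<lambda>t. of_real (t ^ n) * (\<alpha> c * \<zeta> ^ Suc n)) has_integral (of_real (1 / of_nat (Suc n)) * (\<alpha> c * \<zeta> ^ Suc n))) {0..1}"
      by (intro has_integral_mult_left has_integral_of_real hp)
    then have hs: "((\<lambda>t. of_real (t ^ n) * (\<alpha> c * \<zeta> ^ Suc n)) has_integral (\<alpha> c / of_nat (Suc n) * \<zeta> ^ Suc n)) {0..1}"
      by (simp add: field_simps)
    note hd = has_integral_diff[OF hi hs]
    note hb = has_integral_mult_right[OF hp, of "C * R ^ Suc n"]
    have bound: "norm (?i t - of_real (t ^ n) * (\<alpha> c * \<zeta> ^ Suc n)) \<le> C * R ^ Suc n * t ^ n" if t: "t \<in> {0..1}" for t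
    proof -
      let ?z = "c + of_real t * \<zeta>"
      have zB: "?z \<in> cball c R" by (rule in_ball[OF t])
      then have zb: "?z \<in> ball c r" and zd: "dist ?z c < d1" "dist ?z c < d2" using RB(1) R by (auto simp: dist_commute)
      have Pz: "P ?z = \<alpha> ?z * (of_real (t ^ n) * \<zeta> ^ n)" using P[OF zb] by (simp add: power_mult_distrib)
      have \<alpha>z: "cmod (\<alpha> ?z) \<le> cmod (\<alpha> c) + e"
        using d2(2)[OF zd(2)] norm_triangle_ineq2[of "\<alpha> ?z" "\<alpha> c"] by linarith
      have tn: "0 \<le> t ^ n" using t by simp
      have "cmod (Q ?z) \<le> \<kappa> * cmod (P ?z)"
        unfolding Q[OF zb] using d1(2)[OF zd(1)] by (intro mult_right_mono) auto
      also have "\<dots> \<le> \<kappa> * ((cmod (\<alpha> c) + e) * (t ^ n * R ^ n))"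
        unfolding Pz using \<kappa> \<alpha>z \<zeta> tn t R(1) by (intro mult_left_mono) (auto simp: norm_mult norm_power intro!: mult_right_mono)
      finally have Qz: "cmod (Q ?z) \<le> \<kappa> * (cmod (\<alpha> c) + e) * (t ^ n * R ^ n)" by (simp add: mult.assoc)
      have "?i t - of_real (t ^ n) * (\<alpha> c * \<zeta> ^ Suc n) = (\<alpha> ?z - \<alpha> c) * (of_real (t ^ n) * \<zeta> ^ Suc n) + Q ?z * cnj \<zeta>"
        unfolding Pz by (simp add: algebra_simps)
      also have "norm \<dots> \<le> e * (t ^ n * R ^ Suc n) + \<kappa> * (cmod (\<alpha> c) + e) * (t ^ n * R ^ n) * R"
      proof (intro norm_triangle_le add_mono)
        show "norm ((\<alpha> ?z - \<alpha> c) * (of_real (t ^ n) * \<zeta> ^ Suc n)) \<le> e * (t ^ n * R ^ Suc n)"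
          unfolding norm_mult norm_power norm_of_real \<zeta> using d2(2)[OF zd(2)] tn R(1) t e
          by (intro mult_mono) auto
        show "norm (Q ?z * cnj \<zeta>) \<le> \<kappa> * (cmod (\<alpha> c) + e) * (t ^ n * R ^ n) * R"
          unfolding norm_mult complex_mod_cnj \<zeta> using Qz R(1) by (intro mult_right_mono) auto
      qed
      also have "\<dots> = C * R ^ Suc n * t ^ n" by (simp add: C_def algebra_simps)
      finally show ?thesis .
    qed
    have "norm (integral {0..1} (\<lambda>t. ?i t - of_real (t ^ n) * (\<alpha> c * \<zeta> ^ Suc n))) \<le> integral {0..1} (\<lambda>t. C * R ^ Suc n * t ^ n)"
      by (intro integral_norm_bound_integral has_integral_integrable[OF hd] has_integral_integrable[OF hb] bound)
    then have "cmod (H (c + \<zeta>) - H c - \<alpha> c / of_nat (Suc n) * \<zeta> ^ Suc n) \<le> C * R ^ Suc n * (1 / of_nat (Suc n))"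
      unfolding integral_unique[OF hd] integral_unique[OF hb] .
    also have "\<dots> < cmod (\<alpha> c) * R ^ Suc n * (1 / of_nat (Suc n))"
      using C R(1) by (intro mult_strict_right_mono) auto
    also have "\<dots> = cmod (\<alpha> c / of_nat (Suc n)) * R ^ Suc n"
      by (simp add: norm_divide del: of_nat_Suc)
    finally show "cmod (H (c + \<zeta>) - H c - \<alpha> c / of_nat (Suc n) * \<zeta> ^ Suc n) < cmod (\<alpha> c / of_nat (Suc n)) * R ^ Suc n" .
  qed
  then have "(of_nat (Suc n) :: complex) = of_nat 1" using winding[OF R(1) RB(2)] by simp
  then show ?thesis using of_nat_eq_iff[of "Suc n" 1, where 'a = complex] by simp
qed

text \<open>The analogue of Lewy's theorem. Excluding \<tau>(c) = 1 needs the curvature sign; once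
  \<tau>(c) < 1, the winding number excludes a zero of \<open>P\<close>, and |Q| < |P| follows at
  \<open>c\<close>.\<close>

lemma J_positive:
  assumes c: "c \<in> S" shows "0 < J c"
proof -
  obtain r \<alpha> \<tau> n where r: "0 < r" "ball c r \<subseteq> S" and \<alpha>: "continuous_on (ball c r) \<alpha>" and \<tau>: "continuous_on (ball c r) \<tau>"
    and nz: "\<And>z. z \<in> ball c r \<Longrightarrow> \<alpha> z \<noteq> 0" and P: "\<And>z. z \<in> ball c r \<Longrightarrow> P z = \<alpha> z * (z - c) ^ n"
    and Q: "\<And>z. z \<in> ball c r \<Longrightarrow> cmod (Q z) = \<tau> z * cmod (P z)"
    by (rule dilatation_local_form[OF c]) blast
  have cB: "c \<in> ball c r" using r(1) by simp
  have Pnz: "P z \<noteq> 0" if "z \<in> ball c r - {c}" for z using P[of z] nz[of z] that by auto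
  have "\<tau> c \<noteq> 1" by (rule dilatation_ne_one[OF r \<tau> Pnz Q])
  \<comment> \<open>The inequality |Q| <= |P| bounds \<tau> only where \<open>P\<close> is nonzero,
    so the bound reaches \<open>c\<close> as a limit.\<close>
  moreover have "\<tau> c \<le> 1"
  proof (rule tendsto_upperbound)
    show "(\<tau> \<longlongrightarrow> \<tau> c) (at c)"
      using \<tau> r(1) by (simp add: continuous_on_eq_continuous_at isCont_def)
    have "eventually (\<lambda>z. z \<in> ball c r - {c}) (at c)" using r(1) by (intro eventually_at_in_open) auto
    then show "eventually (\<lambda>z. \<tau> z \<le> 1) (at c)"
    proof eventually_elim
      case (elim z)
      then have "\<tau> z * cmod (P z) \<le> 1 * cmod (P z)" using Q[of z] Q_le_P[of z] r(2) by auto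
      then show ?case using Pnz[OF elim] by (auto dest: mult_right_le_imp_le)
    qed
  qed simp
  ultimately have lt: "\<tau> c < 1" by simp
  have "n = 0" by (rule order_zero[OF r \<alpha> nz[OF cB] \<tau> lt P Q])
  then have "P c \<noteq> 0" using P[OF cB] nz[OF cB] by simp
  then have "\<tau> c * cmod (P c) < 1 * cmod (P c)" using lt by (intro mult_strict_right_mono) auto
  then have "cmod (Q c) < cmod (P c)" using Q[OF cB] by simp
  then have "(cmod (Q c))\<^sup>2 < (cmod (P c))\<^sup>2" by (intro power_strict_mono) auto
  then show ?thesis using metric_pos[OF c] by (simp add: metric_jacobian_def)
qed

text \<open>Positivity makes the second-derivative formula available on all of \<open>S\<close>,
  where 4 times the relevant real part is K D plus a square.\<close>

lemma minus_ln_J_subharmonic: "subharmonic_on S (\<lambda>z. - ln (J z))"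
proof -
  have S1: "S1 = S" using J_positive by (auto simp: S1_def)
  have cont: "continuous_on S (\<lambda>z. - ln (J z))"
    using J_positive by (intro continuous_intros J_continuous) force
  show ?thesis
    unfolding subharmonic_on_def
  proof (intro conjI allI impI; (elim conjE)?)
    show "openin (top_of_set S) {z \<in> S. - ln (J z) < c}" for c
    proof -
      have "{z \<in> S. - ln (J z) < c} = S \<inter> (\<lambda>z. - ln (J z)) -` {..<c}" by auto
      then show ?thesis using continuous_openin_preimage_gen[OF cont, of "{..<c}"] by simp
    qed
    fix a r assume r: "0 < r" "cball a r \<subseteq> S"
    have circ: "a + of_real r * cis t \<in> S" for t
      using r by (auto simp: subset_iff dist_norm norm_mult)
    have "continuous_on {0..2*pi} (\<lambda>t. - ln (J (a + of_real r * cis t)))"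
      by (rule continuous_on_compose2[OF cont]) (use circ in \<open>auto intro!: continuous_intros\<close>)
    then show "(\<lambda>t. - ln (J (a + of_real r * cis t))) integrable_on {0..2*pi}"
      by (rule integrable_continuous_interval)
    \<comment> \<open>The mean value inequality asks for a disc strictly larger than the given one.
      Compactness provides an e-neighbourhood inside \<open>S\<close>; a point z just outside is
      compared with its radial projection \<open>x\<close> onto the circle of radius
      \<open>r\<close>, at distance less than \<open>e\<close>.\<close>
    obtain R where R: "r < R" "ball a R \<subseteq> S"
    proof -
      obtain e where e: "0 < e" "(\<Union>x\<in>cball a r. ball x e) \<subseteq> S"
        using compact_subset_open_imp_ball_epsilon_subset[OF compact_cball open_S r(2)] by metis
      have "z \<in> S" if z: "z \<in> ball a (r + e)" for z
      proof (cases "dist a z \<le> r")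
        case True
        then show ?thesis using r(2) by auto
      next
        case False
        define x where "x = a + of_real (r / dist a z) * (z - a)"
        have d: "cmod (z - a) = dist a z" by (simp add: dist_norm norm_minus_commute)
        have "z \<noteq> a" using False r(1) by (metis dist_self less_eq_real_def)
        have "dist a x = r"
          using r(1) d \<open>z \<noteq> a\<close> by (simp add: x_def dist_norm norm_mult norm_divide)
        moreover have "dist x z < e"
        proof -
          have "z - x = of_real (1 - r / dist a z) * (z - a)" by (simp add: x_def algebra_simps)
          then have "dist z x = \<bar>1 - r / dist a z\<bar> * dist a z"
            unfolding dist_norm[of z x] by (simp only: norm_mult norm_of_real d)
          also have "\<dots> = dist a z - r" using r(1) False \<open>z \<noteq> a\<close> by (simp add: abs_if field_simps)
          finally show ?thesis using z by (simp add: dist_commute)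
        qed
        ultimately have "x \<in> cball a r" "z \<in> ball x e" by simp_all
        then show ?thesis using e(2) by blast
      qed
      then have "ball a (r + e) \<subseteq> S" by blast
      then show ?thesis using that[of "r + e"] e(1) by simp
    qed
    have T: "ball a R - {a} \<subseteq> S1" using R(2) S1 by auto
    have w: "C1w (ball a R - {a}) (\<lambda>z. of_real (- ln (J z))) (\<lambda>z. - (Jz z / of_real (J z))) (\<lambda>z. - cnj (Jz z / of_real (J z)))"
      using C1w_diff[OF C1w_const[of _ 0] C1w_subset[OF ln_J_C1w T]] by simp
    obtain b where "C1w S1 (\<lambda>z. Jz z / of_real (J z)) b
      (\<lambda>z. q z * (F z + \<Phi> z * cnj (\<Phi> z) / F z) / of_real (J z) -
     (2 * \<omega> z * \<Phi> z - deriv \<Phi> z) * (2 * cnj (\<omega> z) * cnj (\<Phi> z) - cnj (deriv \<Phi> z)) / (of_real (J z))\<^sup>2)"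
      using ln_J_C2w by blast
    from C1w_diff[OF C1w_const[of _ 0] C1w_subset[OF this T]]
    have w2: "C1w (ball a R - {a}) (\<lambda>z. - (Jz z / of_real (J z))) (\<lambda>z. - b z)
      (\<lambda>z. - (q z * (F z + \<Phi> z * cnj (\<Phi> z) / F z) / of_real (J z) -
     (2 * \<omega> z * \<Phi> z - deriv \<Phi> z) * (2 * cnj (\<omega> z) * cnj (\<Phi> z) - cnj (deriv \<Phi> z)) / (of_real (J z))\<^sup>2))"
      by simp
    have "2 * pi * - ln (J a) \<le> integral {0..2*pi} (\<lambda>t. - ln (J (a + of_real r * cis t)))"
    proof (rule circle_mean_ge[OF continuous_on_subset[OF cont R(2)] w w2 _ r(1) R(1)])
      fix z assume z: "z \<in> ball a R - {a}"
      then have zS: "z \<in> S1" "z \<in> S" using T S1 by auto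
      have "0 \<le> energy_density \<rho> H z" by (simp add: energy_density_def)
      then have "0 \<le> gauss_curvature \<rho> (H z) * energy_density \<rho> H z" using curvature_H[OF zS(2)] by simp
      moreover have "0 \<le> 4 * (cmod (2 * \<omega> z * \<Phi> z - deriv \<Phi> z))\<^sup>2 / (J z)\<^sup>2" by simp
      ultimately have "4 * Re (q z * (F z + \<Phi> z * cnj (\<Phi> z) / F z) / of_real (J z) -
         (2 * \<omega> z * \<Phi> z - deriv \<Phi> z) * (2 * cnj (\<omega> z) * cnj (\<Phi> z) - cnj (deriv \<Phi> z)) / (of_real (J z))\<^sup>2) \<le> 0"
        unfolding ln_J_second[OF zS(1)] by linarith
      then show "0 \<le> Re (- (q z * (F z + \<Phi> z * cnj (\<Phi> z) / F z) / of_real (J z) -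
         (2 * \<omega> z * \<Phi> z - deriv \<Phi> z) * (2 * cnj (\<omega> z) * cnj (\<Phi> z) - cnj (deriv \<Phi> z)) / (of_real (J z))\<^sup>2))"
        unfolding uminus_complex.sel by linarith
    qed
    then show "- ln (J a) \<le> integral {0..2*pi} (\<lambda>t. - ln (J (a + of_real r * cis t))) / (2*pi)"
      by (subst pos_le_divide_eq) (auto simp: mult.commute)
  qed
qed

end

section \<open>From the Riemann surface to its charts\<close>

lemma chart_plane_harmonic:
  assumes "open \<Omega>" "smooth_plane_metric \<Omega> \<rho>" "harmonic_map X \<A> \<Omega> \<rho> h"
    and c: "conformal_parameter X \<A> (U, \<phi>)"
  shows "plane_harmonic (\<phi> ` U) \<Omega> \<rho> (in_parameter h (U, \<phi>))"
proof
  have U: "openin X U" and o: "open (\<phi> ` U)" using c by (auto simp: conformal_parameter_def)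
  show "open (\<phi> ` U)" by (rule o)
  have "inv_into U \<phi> z \<in> topspace X" if "z \<in> \<phi> ` U" for z
    using inv_into_into[OF that] openin_subset[OF U] by blast
  then show "in_parameter h (U, \<phi>) ` (\<phi> ` U) \<subseteq> \<Omega>"
    using assms(3) by (auto simp: harmonic_map_def)
  show "Ck_on 2 (\<phi> ` U) (in_parameter h (U, \<phi>))"
    using assms(3) c unfolding harmonic_map_def Let_def by blast
  show "wirt_zbar (wirt_z (in_parameter h (U, \<phi>))) z +
      wirt_z (\<lambda>w. of_real (ln ((\<rho> w)\<^sup>2))) (in_parameter h (U, \<phi>) z) * wirt_z (in_parameter h (U, \<phi>)) z *
      wirt_zbar (in_parameter h (U, \<phi>)) z = 0" if "z \<in> \<phi> ` U" for z
    using assms(3) c that unfolding harmonic_map_def Let_def by blast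
qed (rule assms)+

lemma chart_plane_harmonic_homeo:
  assumes "open \<Omega>" "smooth_plane_metric \<Omega> \<rho>" "harmonic_map X \<A> \<Omega> \<rho> h"
    and c: "conformal_parameter X \<A> (U, \<phi>)"
    and "homeomorphic_map X (top_of_set \<Omega>) h" "sense_preserving X \<A> h" "\<forall>w\<in>\<Omega>. 0 \<le> gauss_curvature \<rho> w"
  shows "plane_harmonic_homeo (\<phi> ` U) \<Omega> \<rho> (in_parameter h (U, \<phi>))"
proof -
  interpret plane_harmonic "\<phi> ` U" \<Omega> \<rho> "in_parameter h (U, \<phi>)"
    by (rule chart_plane_harmonic[OF assms(1-4)])
  show ?thesis
  proof
    have U: "openin X U" using c by (auto simp: conformal_parameter_def)
    have "inj_on h U"
      using homeomorphic_imp_injective_map[OF assms(5)] openin_subset[OF U] inj_on_subset by blast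
    then have "inj_on h (inv_into U \<phi> ` \<phi> ` U)"
      by (rule inj_on_subset) (auto intro: inv_into_into)
    then show "inj_on (in_parameter h (U, \<phi>)) (\<phi> ` U)"
      by (simp add: comp_inj_on inj_on_inv_into)
    show "winding_number (in_parameter h (U, \<phi>) \<circ> circlepath a r) (in_parameter h (U, \<phi>) a) = 1"
      if "0 < r" "cball a r \<subseteq> \<phi> ` U" for a r
      using assms(6) c that unfolding sense_preserving_def by blast
  qed (use assms(7) in blast)
qed

theorem theorem2p1:
  fixes X :: "'a topology" and \<A> :: "'a chart set"
    and \<sigma> :: "'a chart \<Rightarrow> complex \<Rightarrow> real"
    and \<Omega> :: "complex set" and \<rho> :: "complex \<Rightarrow> real"
    and h :: "'a \<Rightarrow> complex"
  assumes "riemann_surface X \<A>"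
    and "smooth_conformal_metric X \<A> \<sigma>"
    and "open \<Omega>" and "connected \<Omega>" and "\<Omega> \<noteq> {}"
    and "smooth_plane_metric \<Omega> \<rho>"
    and "harmonic_map X \<A> \<Omega> \<rho> h"
  shows
    "(\<forall>U \<phi> z. conformal_parameter X \<A> (U, \<phi>) \<and> z \<in> \<phi> ` U \<longrightarrow>
        (let H = in_parameter h (U, \<phi>);
             Hbar = (\<lambda>\<zeta>. cnj (H \<zeta>));
             J = metric_jacobian \<rho> H;
             A = wirt_z (wirt_z H) z * wirt_zbar Hbar z + wirt_zbar (wirt_z Hbar) z * wirt_z H z;
             B = wirt_zbar (wirt_z H) z * wirt_z Hbar z + wirt_zbar H z * wirt_z (wirt_z Hbar) z
         in 0 < J z \<and> wirt_zbar H z \<noteq> 0 \<longrightarrow>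
            - laplacian (\<lambda>\<zeta>. ln (J \<zeta>)) z =
              gauss_curvature \<rho> (H z) * energy_density \<rho> H z +
              4 * \<rho> (H z) ^ 4 / (J z)\<^sup>2 *
                ((cmod (wirt_z H z))\<^sup>2 / (cmod (wirt_zbar H z))\<^sup>2 * (cmod B)\<^sup>2 +
                 (cmod (wirt_zbar H z))\<^sup>2 / (cmod (wirt_z H z))\<^sup>2 * (cmod A)\<^sup>2 -
                 2 * Re (A * cnj B))))
     \<and>
     (homeomorphic_map X (top_of_set \<Omega>) h \<and> sense_preserving X \<A> h \<and>
      (\<forall>w\<in>\<Omega>. 0 \<le> gauss_curvature \<rho> w) \<longrightarrow>
        (\<forall>U \<phi>. conformal_parameter X \<A> (U, \<phi>) \<longrightarrow>
           (\<forall>z\<in>\<phi> ` U. 0 < metric_jacobian \<rho> (in_parameter h (U, \<phi>)) z) \<and>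
           subharmonic_on (\<phi> ` U) (\<lambda>z. - ln (metric_jacobian \<rho> (in_parameter h (U, \<phi>)) z))))"
  unfolding Let_def
proof (intro conjI allI impI ballI; (elim conjE)?)
  note base = assms(3,6,7)
  {
    fix U \<phi> z
    assume "conformal_parameter X \<A> (U, \<phi>)" "z \<in> \<phi> ` U"
      "0 < metric_jacobian \<rho> (in_parameter h (U, \<phi>)) z" "wirt_zbar (in_parameter h (U, \<phi>)) z \<noteq> 0"
    then show "- laplacian (\<lambda>\<zeta>. ln (metric_jacobian \<rho> (in_parameter h (U, \<phi>)) \<zeta>)) z =
      gauss_curvature \<rho> (in_parameter h (U, \<phi>) z) * energy_density \<rho> (in_parameter h (U, \<phi>)) z +
      4 * \<rho> (in_parameter h (U, \<phi>) z) ^ 4 / (metric_jacobian \<rho> (in_parameter h (U, \<phi>)) z)\<^sup>2 *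
      ((cmod (wirt_z (in_parameter h (U, \<phi>)) z))\<^sup>2 / (cmod (wirt_zbar (in_parameter h (U, \<phi>)) z))\<^sup>2 *
       (cmod (wirt_zbar (wirt_z (in_parameter h (U, \<phi>))) z * wirt_z (\<lambda>\<zeta>. cnj (in_parameter h (U, \<phi>) \<zeta>)) z +
              wirt_zbar (in_parameter h (U, \<phi>)) z * wirt_z (wirt_z (\<lambda>\<zeta>. cnj (in_parameter h (U, \<phi>) \<zeta>))) z))\<^sup>2 +
       (cmod (wirt_zbar (in_parameter h (U, \<phi>)) z))\<^sup>2 / (cmod (wirt_z (in_parameter h (U, \<phi>)) z))\<^sup>2 *
       (cmod (wirt_z (wirt_z (in_parameter h (U, \<phi>))) z * wirt_zbar (\<lambda>\<zeta>. cnj (in_parameter h (U, \<phi>) \<zeta>)) z +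
              wirt_zbar (wirt_z (\<lambda>\<zeta>. cnj (in_parameter h (U, \<phi>) \<zeta>))) z * wirt_z (in_parameter h (U, \<phi>)) z))\<^sup>2 -
       2 * Re ((wirt_z (wirt_z (in_parameter h (U, \<phi>))) z * wirt_zbar (\<lambda>\<zeta>. cnj (in_parameter h (U, \<phi>) \<zeta>)) z +
              wirt_zbar (wirt_z (\<lambda>\<zeta>. cnj (in_parameter h (U, \<phi>) \<zeta>))) z * wirt_z (in_parameter h (U, \<phi>)) z) *
             cnj (wirt_zbar (wirt_z (in_parameter h (U, \<phi>))) z * wirt_z (\<lambda>\<zeta>. cnj (in_parameter h (U, \<phi>) \<zeta>)) z +
              wirt_zbar (in_parameter h (U, \<phi>)) z * wirt_z (wirt_z (\<lambda>\<zeta>. cnj (in_parameter h (U, \<phi>) \<zeta>))) z)))"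
      by (intro plane_harmonic.laplacian_formula[OF chart_plane_harmonic[OF base]])
  }
  fix U \<phi>
  assume "homeomorphic_map X (top_of_set \<Omega>) h" "sense_preserving X \<A> h"
    "\<forall>w\<in>\<Omega>. 0 \<le> gauss_curvature \<rho> w" "conformal_parameter X \<A> (U, \<phi>)"
  note homeo = chart_plane_harmonic_homeo[OF base this(4,1-3)]
  show "subharmonic_on (\<phi> ` U) (\<lambda>z. - ln (metric_jacobian \<rho> (in_parameter h (U, \<phi>)) z))"
    by (rule plane_harmonic_homeo.minus_ln_J_subharmonic[OF homeo])
  show "0 < metric_jacobian \<rho> (in_parameter h (U, \<phi>)) z" if "z \<in> \<phi> ` U" for z
    by (rule plane_harmonic_homeo.J_positive[OF homeo that])
qed

end
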